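(* Let $h$ be a mixing density. For $\rho\in(0,\infty)$ and $\tau\in\mathbb{R}$ define $g_{\rho,\tau}:(0,\infty)\to[0,\infty)$ by $g_{\rho,\tau}(u)=\exp\{-\rho(\log u)^2+\tau\log u\}$. If there exist $\rho\in(0,\infty)$, $\tau\in\mathbb{R}$ and $\eta>0$ such that $h(u)/g_{\rho,\tau}(u)$ is non-decreasing in $(0,\eta)$, then the DA Markov operator $K$ is trace-class.
   Context: Setting and standing assumptions. $n,p,d$ are positive integers, $a\in\mathbb{R}$, $\mathbb{R}_+=(0,\infty)$, and $\mathcal{S}_d$ is the space of $d\times d$ (real symmetric) positive definite matrices. $X$ is a fixed $n\times p$ real matrix with $i$th row $x_i^T$, $y$ is a fixed $n\times d$ real matrix with $i$th row $y_i^T$, and $\Lambda=(X:y)$ is the $n\times(p+d)$ concatenated matrix. A mixing density is a probability density $h:(0,\infty)\to[0,\infty)$. Throughout it is assumed that (S1) $\mathrm{rank}(\Lambda)=p+d$; (S2) $n>p+2d-2a$; (S3) $\int_0^\infty u^{d/2}h(u)\,du<\infty$; (S4) $\int_0^\infty u^{-\frac{n-p+2a-2d-1}{2}}h(u)\,du<\infty$. Posterior. For $\beta\in\mathbb{R}^{p\times d}$, $\Sigma\in\mathcal{S}_d$ let $$f(y|\beta,\Sigma)=\prod_{i=1}^n\left[\int_0^\infty \frac{u^{d/2}}{(2\pi)^{d/2}|\Sigma|^{1/2}}\exp\left\{-\frac u2 (y_i-\beta^Tx_i)^T\Sigma^{-1}(y_i-\beta^Tx_i)\right\}h(u)\,du\right],$$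 the prior be $\omega(\beta,\Sigma)= |\Sigma|^{-a}I_{\mathcal{S}_d}(\Sigma)$, and $\pi(\beta,\Sigma|y)=f(y|\beta,\Sigma)\omega(\beta,\Sigma)/m(y)$, where $m(y)=\int_{\mathcal{S}_d}\int_{\mathbb{R}^{p\times d}}f(y|\beta,\Sigma)\omega(\beta,\Sigma)\,d\beta\,d\Sigma$, which is finite under (S1)–(S4). DA Markov chain. For $s\ge0$ let $\psi(u;s)=b(s)u^{d/2}e^{-su/2}h(u)$, $u\in\mathbb{R}_+$, with $b(s)$ the normalizing constant making it a probability density. For $z\in\mathbb{R}_+^n$ let $Q=Q(z)$ be the $n\times n$ diagonal matrix with $i$th diagonal element $z_i^{-1}$, $\Omega=(X^TQ^{-1}X)^{-1}$, $\mu=(X^TQ^{-1}X)^{-1}X^TQ^{-1}y$. Let $\pi(z|\beta,\Sigma,y)=\prod_{i=1}^n\psi\big(z_i;(\beta^Tx_i-y_i)^T\Sigma^{-1}(\beta^Tx_i-y_i)\big)$; let $\pi(\Sigma|z,y)$ be the $\mathrm{IW}_d\big(n-p+2a-d-1,(y^TQ^{-1}y-\mu^T\Omega^{-1}\mu)^{-1}\big)$ density; and let $\pi(\beta|\Sigma,z,y)$ be the $\mathrm{N}_{p,d}(\mu,\Omega,\Sigma)$ density. Here $\mathrm{N}_{r,c}(\theta,A,B)$ (matrix normal; $\theta$ is $r\times c$, $A$ is $r\times r$ and $B$ is $c\times c$ positive definite) has density $(2\pi)^{-rc/2}|A|^{-c/2}|B|^{-r/2}\exp[-\frac12\mathrm{tr}\{A^{-1}(z-\theta)B^{-1}(z-\theta)^T\}]$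 on $\mathbb{R}^{r\times c}$, and $\mathrm{IW}_r(m,\Theta)$ (inverse Wishart; $m>r-1$, $\Theta$ is $r\times r$ positive definite) has density proportional to $|w|^{-\frac{m+r+1}{2}}\exp\{-\frac12\mathrm{tr}(\Theta^{-1}w^{-1})\}$ on $\mathcal{S}_r$. The DA Markov chain on $\mathsf{X}=\mathbb{R}^{p\times d}\times\mathcal{S}_d$ has transition density $$k\big((\beta',\Sigma')|(\beta,\Sigma)\big)=\int_{\mathbb{R}_+^n}\pi(\beta'|\Sigma',z,y)\,\pi(\Sigma'|z,y)\,\pi(z|\beta,\Sigma,y)\,dz.$$ Operator. $L_0^2$ is the Hilbert space of functions $f:\mathsf{X}\to\mathbb{R}$ with $\int_{\mathsf{X}} f^2\,\pi(\cdot|y)<\infty$ and $\int_{\mathsf{X}} f\,\pi(\cdot|y)=0$, with inner product $\langle f_1,f_2\rangle=\int_{\mathsf{X}} f_1f_2\,\pi(\beta,\Sigma|y)\,d\beta\,d\Sigma$. The DA Markov operator $K:L_0^2\to L_0^2$ is $(Kf)(\beta,\Sigma)=\int_{\mathsf{X}}f(\beta',\Sigma')\,k((\beta',\Sigma')|(\beta,\Sigma))\,d\beta'\,d\Sigma'$; it is self-adjoint and positive. Such an operator is trace-class if it is compact and its eigenvalues are summable. *)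

theory Defs
  imports "HOL-Analysis.Analysis"
begin

section \<open>Lebesgue measure on positive definite matrices\<close>

definition pos_def :: "real^'d^'d \<Rightarrow> bool" where
  "pos_def S \<longleftrightarrow> transpose S = S \<and> (\<forall>v. v \<noteq> 0 \<longrightarrow> v \<bullet> (S *v v) > 0)"

text \<open>
  Lebesgue measure on the space of symmetric matrices, i.e. one copy of \<open>lborel\<close> for each
  of the \<open>d (d + 1) / 2\<close> free entries. The free entries are indexed by the unordered pairs
  \<open>{i, j}\<close> (with \<open>i = j\<close> allowed), which avoids choosing an order on the index type.
\<close>

definition sym_lborel :: "(real^'d^'d) measure" where
  "sym_lborel = distr (PiM {{i, j} | i j :: 'd. True} (\<lambda>_. lborel)) borel
                      (\<lambda>s. \<chi> i j. s {i, j})"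

lemma sym_lborel_map_measurable:
  "(\<lambda>s. \<chi> i j. s {i, j}) \<in>
     measurable (PiM {{i, j} | i j :: 'd. True} (\<lambda>_. lborel)) (borel :: (real^'d^'d) measure)"
proof -
  let ?P = "PiM {{i, j} | i j :: 'd. True} (\<lambda>_. lborel) :: ('d set \<Rightarrow> real) measure"
  have comp: "(\<lambda>s. s {i, j}) \<in> borel_measurable ?P" for i j :: 'd
  proof -
    have "(\<lambda>s. s {i, j}) \<in> measurable ?P lborel"
      by (rule measurable_component_singleton) auto
    then show ?thesis by simp
  qed
  show ?thesis
    using comp by (intro borel_measurable_euclidean_space[THEN iffD2])
                  (auto simp: Basis_vec_def inner_axis)
qed

definition posdef_lborel :: "(real^'d^'d) measure" where
  "posdef_lborel = restrict_space sym_lborel {S. pos_def S}"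


section \<open>Matrix distributions\<close>

definition matrix_normal_density ::
  "real^'c^'r \<Rightarrow> real^'r^'r \<Rightarrow> real^'c^'c \<Rightarrow> real^'c^'r \<Rightarrow> real" where
  "matrix_normal_density \<theta> A B z =
     (2 * pi) powr (- (real CARD('r) * real CARD('c)) / 2)
     * det A powr (- real CARD('c) / 2) * det B powr (- real CARD('r) / 2)
     * exp (- (1 / 2) * trace (matrix_inv A ** (z - \<theta>) ** matrix_inv B ** transpose (z - \<theta>)))"

definition inv_wishart_kernel :: "real \<Rightarrow> real^'r^'r \<Rightarrow> real^'r^'r \<Rightarrow> real" where
  "inv_wishart_kernel m \<Theta> w =
     det w powr (- (m + real CARD('r) + 1) / 2)
     * exp (- (1 / 2) * trace (matrix_inv \<Theta> ** matrix_inv w))"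

definition inv_wishart_density :: "real \<Rightarrow> real^'r^'r \<Rightarrow> real^'r^'r \<Rightarrow> real" where
  "inv_wishart_density m \<Theta> w =
     inv_wishart_kernel m \<Theta> w / (LINT v|posdef_lborel. inv_wishart_kernel m \<Theta> v)"


section \<open>Model and posterior\<close>

definition mixing_density :: "(real \<Rightarrow> real) \<Rightarrow> bool" where
  "mixing_density h \<longleftrightarrow>
     (\<forall>u>0. h u \<ge> 0) \<and> set_integrable lborel {0<..} h \<and> (LBINT u:{0<..}. h u) = 1"

definition concat_cols :: "real^'p^'n \<Rightarrow> real^'d^'n \<Rightarrow> real^('p + 'd)^'n" where
  "concat_cols X y = (\<chi> i j. case j of Inl k \<Rightarrow> X $ i $ k | Inr l \<Rightarrow> y $ i $ l)"

definition mahalanobis ::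
  "real^'p^'n \<Rightarrow> real^'d^'n \<Rightarrow> real^'d^'p \<Rightarrow> real^'d^'d \<Rightarrow> 'n \<Rightarrow> real" where
  "mahalanobis X y \<beta> \<Sigma> i =
     (let r = y $ i - transpose \<beta> *v (X $ i) in r \<bullet> (matrix_inv \<Sigma> *v r))"

definition likelihood ::
  "(real \<Rightarrow> real) \<Rightarrow> real^'p^'n \<Rightarrow> real^'d^'n \<Rightarrow> real^'d^'p \<Rightarrow> real^'d^'d \<Rightarrow> real" where
  "likelihood h X y \<beta> \<Sigma> =
     (\<Prod>i\<in>UNIV. LBINT u:{0<..}.
        u powr (real CARD('d) / 2) / ((2 * pi) powr (real CARD('d) / 2) * det \<Sigma> powr (1 / 2))
        * exp (- (u / 2) * mahalanobis X y \<beta> \<Sigma> i) * h u)"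

definition prior :: "real \<Rightarrow> real^'d^'p \<Rightarrow> real^'d^'d \<Rightarrow> real" where
  "prior a \<beta> \<Sigma> = det \<Sigma> powr (- a) * indicator {S. pos_def S} \<Sigma>"

definition marginal :: "(real \<Rightarrow> real) \<Rightarrow> real \<Rightarrow> real^'p^'n \<Rightarrow> real^'d^'n \<Rightarrow> real" where
  "marginal h a X y =
     (LINT \<Sigma>|posdef_lborel. LINT \<beta>|lborel. likelihood h X y \<beta> \<Sigma> * prior a (\<beta> :: real^'d^'p) \<Sigma>)"

definition posterior_density ::
  "(real \<Rightarrow> real) \<Rightarrow> real \<Rightarrow> real^'p^'n \<Rightarrow> real^'d^'n \<Rightarrow> real^'d^'p \<Rightarrow> real^'d^'d \<Rightarrow> real" where
  "posterior_density h a X y \<beta> \<Sigma> =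
     likelihood h X y \<beta> \<Sigma> * prior a \<beta> \<Sigma> / marginal h a X y"

definition state_measure :: "((real^'d^'p) \<times> (real^'d^'d)) measure" where
  "state_measure = lborel \<Otimes>\<^sub>M posdef_lborel"

definition posterior ::
  "(real \<Rightarrow> real) \<Rightarrow> real \<Rightarrow> real^'p^'n \<Rightarrow> real^'d^'n \<Rightarrow> ((real^'d^'p) \<times> (real^'d^'d)) measure" where
  "posterior h a X y =
     density state_measure (\<lambda>(\<beta>, \<Sigma>). ennreal (posterior_density h a X y \<beta> \<Sigma>))"


section \<open>The data augmentation Markov chain\<close>

definition psi_kernel :: "(real \<Rightarrow> real) \<Rightarrow> nat \<Rightarrow> real \<Rightarrow> real \<Rightarrow> real" where
  "psi_kernel h d s u = u powr (real d / 2) * exp (- s * u / 2) * h u"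

definition psi :: "(real \<Rightarrow> real) \<Rightarrow> nat \<Rightarrow> real \<Rightarrow> real \<Rightarrow> real" where
  "psi h d s u = psi_kernel h d s u / (LBINT v:{0<..}. psi_kernel h d s v)"

definition Q_mat :: "real^'n \<Rightarrow> real^'n^'n" where
  "Q_mat z = (\<chi> i j. if i = j then inverse (z $ i) else 0)"

definition Omega_mat :: "real^'p^'n \<Rightarrow> real^'n \<Rightarrow> real^'p^'p" where
  "Omega_mat X z = matrix_inv (transpose X ** matrix_inv (Q_mat z) ** X)"

definition mu_mat :: "real^'p^'n \<Rightarrow> real^'d^'n \<Rightarrow> real^'n \<Rightarrow> real^'d^'p" where
  "mu_mat X y z =
     matrix_inv (transpose X ** matrix_inv (Q_mat z) ** X) ** transpose X ** matrix_inv (Q_mat z) ** y"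

definition cond_z ::
  "(real \<Rightarrow> real) \<Rightarrow> real^'p^'n \<Rightarrow> real^'d^'n \<Rightarrow> real^'d^'p \<Rightarrow> real^'d^'d \<Rightarrow> real^'n \<Rightarrow> real" where
  "cond_z h X y \<beta> \<Sigma> z = (\<Prod>i\<in>UNIV. psi h CARD('d) (mahalanobis X y \<beta> \<Sigma> i) (z $ i))"

definition cond_Sigma ::
  "real \<Rightarrow> real^'p^'n \<Rightarrow> real^'d^'n \<Rightarrow> real^'n \<Rightarrow> real^'d^'d \<Rightarrow> real" where
  "cond_Sigma a X y z =
     inv_wishart_density
       (real CARD('n) - real CARD('p) + 2 * a - real CARD('d) - 1)
       (matrix_inv (transpose y ** matrix_inv (Q_mat z) ** y
          - transpose (mu_mat X y z) ** matrix_inv (Omega_mat X z) ** mu_mat X y z))"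

definition cond_beta ::
  "real^'p^'n \<Rightarrow> real^'d^'n \<Rightarrow> real^'d^'d \<Rightarrow> real^'n \<Rightarrow> real^'d^'p \<Rightarrow> real" where
  "cond_beta X y \<Sigma> z = matrix_normal_density (mu_mat X y z) (Omega_mat X z) \<Sigma>"

text \<open>\<open>DA_kernel h a X y x x'\<close> is the transition density from the state \<open>x\<close> to the state \<open>x'\<close>.\<close>

definition DA_kernel ::
  "(real \<Rightarrow> real) \<Rightarrow> real \<Rightarrow> real^'p^'n \<Rightarrow> real^'d^'n
   \<Rightarrow> (real^'d^'p) \<times> (real^'d^'d) \<Rightarrow> (real^'d^'p) \<times> (real^'d^'d) \<Rightarrow> real" where
  "DA_kernel h a X y = (\<lambda>(\<beta>, \<Sigma>) (\<beta>', \<Sigma>').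
     LBINT z:{z. \<forall>i. 0 < z $ i}.
       cond_beta X y \<Sigma>' z \<beta>' * cond_Sigma a X y z \<Sigma>' * cond_z h X y \<beta> \<Sigma> z)"

definition DA_operator ::
  "(real \<Rightarrow> real) \<Rightarrow> real \<Rightarrow> real^'p^'n \<Rightarrow> real^'d^'n
   \<Rightarrow> ((real^'d^'p) \<times> (real^'d^'d) \<Rightarrow> real) \<Rightarrow> (real^'d^'p) \<times> (real^'d^'d) \<Rightarrow> real" where
  "DA_operator h a X y f x = (LINT x'|state_measure. f x' * DA_kernel h a X y x x')"


section \<open>Trace-class operators on the mean-zero \<open>L\<^sup>2\<close> space\<close>

text \<open>
  Elements of \<open>L\<^sub>0\<^sup>2\<close> are represented by functions, which are identified when they agree almost
  everywhere with respect to \<open>M\<close>.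
\<close>

definition L2_zero :: "'a measure \<Rightarrow> ('a \<Rightarrow> real) set" where
  "L2_zero M = {f \<in> borel_measurable M. integrable M (\<lambda>x. (f x)\<^sup>2) \<and> (LINT x|M. f x) = 0}"

definition L2_norm :: "'a measure \<Rightarrow> ('a \<Rightarrow> real) \<Rightarrow> real" where
  "L2_norm M f = sqrt (LINT x|M. (f x)\<^sup>2)"

definition compact_operator ::
  "'a measure \<Rightarrow> (('a \<Rightarrow> real) \<Rightarrow> 'a \<Rightarrow> real) \<Rightarrow> bool" where
  "compact_operator M K \<longleftrightarrow>
     (\<forall>f\<in>L2_zero M. K f \<in> L2_zero M) \<and>
     (\<forall>F B. (\<forall>i::nat. F i \<in> L2_zero M \<and> L2_norm M (F i) \<le> B) \<longrightarrow>
        (\<exists>g\<in>L2_zero M. \<exists>r. strict_mono r \<and>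
           (\<lambda>i. L2_norm M (\<lambda>x. K (F (r i)) x - g x)) \<longlonglongrightarrow> 0))"

definition eigenspace ::
  "'a measure \<Rightarrow> (('a \<Rightarrow> real) \<Rightarrow> 'a \<Rightarrow> real) \<Rightarrow> real \<Rightarrow> ('a \<Rightarrow> real) set" where
  "eigenspace M K c = {f \<in> L2_zero M. AE x in M. K f x = c * f x}"

definition eigenvalues ::
  "'a measure \<Rightarrow> (('a \<Rightarrow> real) \<Rightarrow> 'a \<Rightarrow> real) \<Rightarrow> real set" where
  "eigenvalues M K = {c. \<exists>f\<in>eigenspace M K c. \<not> (AE x in M. f x = 0)}"

definition lin_indep_AE :: "'a measure \<Rightarrow> ('a \<Rightarrow> real) set \<Rightarrow> bool" where
  "lin_indep_AE M F \<longleftrightarrow>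
     (\<forall>c. (AE x in M. (\<Sum>f\<in>F. c f * f x) = 0) \<longrightarrow> (\<forall>f\<in>F. c f = 0))"

text \<open>The multiplicity is the dimension of the eigenspace, possibly infinite.\<close>

definition eigen_multiplicity ::
  "'a measure \<Rightarrow> (('a \<Rightarrow> real) \<Rightarrow> 'a \<Rightarrow> real) \<Rightarrow> real \<Rightarrow> ennreal" where
  "eigen_multiplicity M K c =
     (SUP F\<in>{F. finite F \<and> F \<subseteq> eigenspace M K c \<and> lin_indep_AE M F}. of_nat (card F))"

text \<open>
  This is for self-adjoint positive \<open>K\<close>. Eigenvalues are counted with multiplicity; an eigenvalue
  \<open>0\<close> contributes nothing, even if its multiplicity is infinite, since \<open>\<infinity> * 0 = 0\<close> in
  \<open>ennreal\<close>.
\<close>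

definition trace_class ::
  "'a measure \<Rightarrow> (('a \<Rightarrow> real) \<Rightarrow> 'a \<Rightarrow> real) \<Rightarrow> bool" where
  "trace_class M K \<longleftrightarrow>
     compact_operator M K \<and>
     (\<Sum>\<^sub>\<infinity>c\<in>eigenvalues M K. eigen_multiplicity M K c * ennreal \<bar>c\<bar>) < \<infinity>"


section \<open>Log-normal type comparison functions\<close>

definition g_fun :: "real \<Rightarrow> real \<Rightarrow> real \<Rightarrow> real" where
  "g_fun \<rho> \<tau> u = exp (- \<rho> * (ln u)\<^sup>2 + \<tau> * ln u)"

end

theory Submission
  imports "HOL-Probability.Distributions" Defs
begin

text \<open>
  Write \<open>x = (\<beta>, \<Sigma>)\<close> and let \<open>E x z = \<Sum>i. z i * s i\<close>, where \<open>s i\<close> is the squared Mahalanobis norm of the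
  \<open>i\<close>-th residual. The conditional density of \<open>x\<close> given \<open>z\<close> is \<open>\<phi> x z / G z\<close> with
  \<open>\<phi> x z = det \<Sigma> powr - (n/2 + a) * exp (- E x z / 2)\<close> and \<open>G z = \<integral> \<phi> x z dx\<close>, and replacing \<open>\<Sigma>\<close> by \<open>\<Sigma> / t\<close>
  gives \<open>G (t z) = t powr \<kappa> * G z\<close>. The operator factors as \<open>K = P* P\<close>, where \<open>P f z\<close> is the conditional expectation of \<open>f\<close>
  given \<open>z\<close>, and the squared Hilbert--Schmidt norm of \<open>P\<close> is \<open>\<integral>\<integral> \<pi>(x|z) \<pi>(z|x) dx dz\<close>.

  The normalizing constant of \<open>\<psi>(u; s)\<close> is bounded below by restricting its integral to \<open>v \<le> 3u/2\<close>; this yields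
  \<open>\<psi>(u; s) \<le> r(u) exp (s u / 4)\<close>. Hence \<open>\<pi>(x|z) \<pi>(z|x) \<le> (\<Prod>i. r (z i)) * \<phi> x (z/2) / G z\<close>, whose integral
  over \<open>x\<close> is \<open>2 powr - \<kappa> * (\<Prod>i. r (z i))\<close>. Comparison with \<open>g\<close> gives \<open>r(u) = O(u powr (\<epsilon> - 1))\<close> near \<open>0\<close> with
  \<open>\<epsilon> = 2 \<rho> ln (5/4)\<close>, so \<open>r\<close> is integrable.
\<close>

section \<open>Square-integrable functions\<close>

text \<open>Two losses compete in the bound on the normalizing constant. Testing only v <= c u costs
  exp (s u (c - 1) / 2), which the decay exp (- E x z / 2) of the density of x given z absorbs
  exactly when c < 2; c = 3/2 spends half of that decay. What remains is the same kernel at z/2, so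
  homogeneity cancels the denominator and no Wishart constant is ever evaluated. The values v that
  are compared with u fill an interval of length of order u, which by itself gives only r(u) =
  O(1/u), and 1/u just fails to be integrable at 0. A power of u in place of g would yield nothing
  more, because its values at proportional arguments have a fixed ratio. The squared logarithm makes
  g(v)/g(u) at least a constant times u powr - \<epsilon> for v in [5u/4, 3u/2]; keeping v at or
  above 5u/4 is what secures this gain. No spectral decomposition is used: the eigenvalue sum is
  bounded through finite orthonormal families of eigenfunctions, and compactness is obtained
  separately from weakly convergent subsequences.\<close>

definition sq_int :: "'a measure \<Rightarrow> ('a \<Rightarrow> real) \<Rightarrow> bool" where
  "sq_int M f \<longleftrightarrow> f \<in> borel_measurable M \<and> integrable M (\<lambda>x. (f x)\<^sup>2)"

lemma sq_int_measurable[measurable_dest]: "sq_int M f \<Longrightarrow> f \<in> borel_measurable M"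
  by (simp add: sq_int_def)

lemma sq_int_integrable: "sq_int M f \<Longrightarrow> integrable M (\<lambda>x. (f x)\<^sup>2)"
  by (simp add: sq_int_def)

text \<open>Kernel slices, indicators and constants serve as test functions without having mean
  zero, so the estimates are made in the larger class \<open>sq_int\<close> and the mean is treated
  separately.\<close>

lemma L2_zero_iff: "f \<in> L2_zero M \<longleftrightarrow> sq_int M f \<and> (LINT x|M. f x) = 0"
  by (auto simp: L2_zero_def sq_int_def)

lemma sq_int_mult_integrable:
  assumes f: "sq_int M f" and g: "sq_int M g"
  shows "integrable M (\<lambda>x. f x * g x)"
proof (rule Bochner_Integration.integrable_bound)
  show "integrable M (\<lambda>x. (f x)\<^sup>2 + (g x)\<^sup>2)"
    using f g by (auto simp: sq_int_def)
  show "(\<lambda>x. f x * g x) \<in> borel_measurable M"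
    using f g by (auto simp: sq_int_def)
  have "\<bar>f x * g x\<bar> \<le> (f x)\<^sup>2 + (g x)\<^sup>2" for x
  proof -
    have "0 \<le> (\<bar>f x\<bar> - \<bar>g x\<bar>)\<^sup>2" "0 \<le> \<bar>f x\<bar> * \<bar>g x\<bar>" by auto
    then have "2 * (\<bar>f x\<bar> * \<bar>g x\<bar>) \<le> (f x)\<^sup>2 + (g x)\<^sup>2" by (simp add: power2_diff)
    with \<open>0 \<le> \<bar>f x\<bar> * \<bar>g x\<bar>\<close> show ?thesis unfolding abs_mult by linarith
  qed
  then show "AE x in M. norm (f x * g x) \<le> norm ((f x)\<^sup>2 + (g x)\<^sup>2)"
    by (auto intro!: AE_I2)
qed

lemma sq_int_add:
  assumes f: "sq_int M f" and g: "sq_int M g"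
  shows "sq_int M (\<lambda>x. f x + g x)"
  unfolding sq_int_def
proof
  show "(\<lambda>x. f x + g x) \<in> borel_measurable M" using f g by (auto simp: sq_int_def)
  have "integrable M (\<lambda>x. (f x)\<^sup>2 + (g x)\<^sup>2 + 2 * (f x * g x))"
    using f g sq_int_mult_integrable[OF f g] by (auto simp: sq_int_def)
  then show "integrable M (\<lambda>x. (f x + g x)\<^sup>2)"
    by (simp add: power2_sum mult.assoc)
qed

lemma sq_int_cmult: "sq_int M f \<Longrightarrow> sq_int M (\<lambda>x. c * f x)"
  by (auto simp: sq_int_def power_mult_distrib)

lemma sq_int_diff: "sq_int M f \<Longrightarrow> sq_int M g \<Longrightarrow> sq_int M (\<lambda>x. f x - g x)"
  using sq_int_add[of M f "\<lambda>x. (-1) * g x"] sq_int_cmult[of M g "-1"] by simp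

lemma sq_int_zero: "sq_int M (\<lambda>x. 0)"
  by (simp add: sq_int_def)

lemma sq_int_sum: "(\<And>i. i \<in> I \<Longrightarrow> sq_int M (f i)) \<Longrightarrow> sq_int M (\<lambda>x. \<Sum>i\<in>I. f i x)"
  by (induction I rule: infinite_finite_induct) (auto simp: sq_int_zero sq_int_add)

lemma sq_int_const: "finite_measure M \<Longrightarrow> sq_int M (\<lambda>x. c)"
  by (simp add: sq_int_def finite_measure.integrable_const)

lemma sq_int_imp_integrable: "finite_measure M \<Longrightarrow> sq_int M f \<Longrightarrow> integrable M f"
  using sq_int_mult_integrable[OF _ sq_int_const[of M 1], of f] by simp

lemma sq_int_bound:
  assumes g: "integrable M g" and f[measurable]: "f \<in> borel_measurable M"
    and le: "AE x in M. (f x)\<^sup>2 \<le> g x"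
  shows "sq_int M f" and "(LINT x|M. (f x)\<^sup>2) \<le> (LINT x|M. g x)"
proof -
  have i: "integrable M (\<lambda>x. (f x)\<^sup>2)"
    by (rule Bochner_Integration.integrable_bound[OF g]) (use le in auto)
  then show "sq_int M f" by (simp add: sq_int_def)
  show "(LINT x|M. (f x)\<^sup>2) \<le> (LINT x|M. g x)"
    by (rule integral_mono_AE[OF i g le])
qed

text \<open>The quadratic form \<open>q\<close> in (s, t) is nonnegative; the inequality is its
  discriminant condition.\<close>

lemma sq_int_CS:
  assumes f: "sq_int M f" and g: "sq_int M g"
  shows "(LINT x|M. f x * g x)\<^sup>2 \<le> (LINT x|M. (f x)\<^sup>2) * (LINT x|M. (g x)\<^sup>2)"
proof -
  let ?a = "LINT x|M. (f x)\<^sup>2" and ?b = "LINT x|M. (g x)\<^sup>2" and ?c = "LINT x|M. f x * g x"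
  note fg = sq_int_mult_integrable[OF f g] and ff = sq_int_integrable[OF f] and gg = sq_int_integrable[OF g]
  have q: "0 \<le> s\<^sup>2 * ?a + 2 * s * t * ?c + t\<^sup>2 * ?b" for s t
  proof -
    have "0 \<le> (LINT x|M. (s * f x + t * g x)\<^sup>2)" by simp
    also have "\<dots> = (LINT x|M. s\<^sup>2 * (f x)\<^sup>2 + (2 * s * t) * (f x * g x) + t\<^sup>2 * (g x)\<^sup>2)"
      by (rule Bochner_Integration.integral_cong) (auto simp: power2_sum power_mult_distrib mult_ac)
    also have "\<dots> = s\<^sup>2 * ?a + 2 * s * t * ?c + t\<^sup>2 * ?b"
      using fg ff gg by simp
    finally show ?thesis .
  qed
  have b0: "?b \<ge> 0" "?a \<ge> 0" by auto
  show ?thesis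
  proof (cases "?b = 0")
    case True
    have "?c = 0"
    proof (rule ccontr)
      assume c: "?c \<noteq> 0"
      have "0 \<le> ?a + 2 * t * ?c" for t using q[of 1 t] True by simp
      \<comment> \<open>This t makes the right-hand side equal to -1.\<close>
      from this[of "- (?a + 1) / (2 * ?c)"] c show False by (simp add: field_simps)
    qed
    then show ?thesis using b0 by simp
  next
    case False
    \<comment> \<open>The minimizing direction s = \<open>?b\<close>, t = - \<open>?c\<close>,
      scaled so that no division by \<open>?b\<close> occurs.\<close>
    have "0 \<le> ?b\<^sup>2 * ?a + 2 * ?b * (- ?c) * ?c + (- ?c)\<^sup>2 * ?b" by (rule q)
    also have "\<dots> = ?b * (?a * ?b - ?c\<^sup>2)" by (simp add: algebra_simps power2_eq_square)
    finally have "0 \<le> ?a * ?b - ?c\<^sup>2" using False b0 by (simp add: zero_le_mult_iff)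
    then show ?thesis by simp
  qed
qed

lemma L2_norm_leD: "L2_norm M f \<le> B \<Longrightarrow> (LINT x|M. (f x)\<^sup>2) \<le> B\<^sup>2"
  unfolding L2_norm_def by (rule sqrt_le_D)


section \<open>Approximation by simple functions and weak sequential compactness\<close>

lemma simple_fun_approx_sq:
  assumes f: "sq_int M f" and "e > 0"
  obtains s where "simple_function M s" "sq_int M s" "(LINT x|M. (f x - s x)\<^sup>2) < e"
proof -
  have fm[measurable]: "f \<in> borel_measurable M" using f by (simp add: sq_int_def)
  obtain s where s: "\<And>i. simple_function M (s i)" "\<And>x. x \<in> space M \<Longrightarrow> (\<lambda>i. s i x) \<longlonglongrightarrow> f x"
    "\<And>i x. x \<in> space M \<Longrightarrow> norm (s i x) \<le> 2 * norm (f x)"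
    using borel_measurable_implies_sequence_metric[OF fm, of 0] unfolding dist_norm diff_0_right by blast
  have sm[measurable]: "s i \<in> borel_measurable M" for i
    using s(1) by (rule borel_measurable_simple_function)
  have sq2: "(s i x)\<^sup>2 \<le> 4 * (f x)\<^sup>2" if "x \<in> space M" for i x
  proof -
    have "\<bar>s i x\<bar>\<^sup>2 \<le> (2 * \<bar>f x\<bar>)\<^sup>2" using s(3)[OF that] by (intro power_mono) auto
    then show ?thesis by (simp add: power_mult_distrib)
  qed
  have i4: "integrable M (\<lambda>x. 4 * (f x)\<^sup>2)" using sq_int_integrable[OF f] by simp
  have ssq: "sq_int M (s i)" for i
    by (rule sq_int_bound[OF i4 sm]) (use sq2 in auto)
  have "(\<lambda>i. LINT x|M. (f x - s i x)\<^sup>2) \<longlonglongrightarrow> (LINT x|M. 0)"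
  proof (rule integral_dominated_convergence)
    \<comment> \<open>10 = 2 + 2 * 4, from (f - s)^2 <= 2 f^2 + 2 s^2 and the pointwise bound s^2 <=
      4 f^2.\<close>
    show "integrable M (\<lambda>x. 10 * (f x)\<^sup>2)" using sq_int_integrable[OF f] by simp
    show "AE x in M. (\<lambda>i. (f x - s i x)\<^sup>2) \<longlonglongrightarrow> 0"
    proof (rule AE_I2)
      fix x assume "x \<in> space M"
      from tendsto_power[OF tendsto_diff[OF tendsto_const[of "f x"] s(2)[OF this]], of 2]
      show "(\<lambda>i. (f x - s i x)\<^sup>2) \<longlonglongrightarrow> 0" by simp
    qed
    show "AE x in M. norm ((f x - s i x)\<^sup>2) \<le> 10 * (f x)\<^sup>2" for i
    proof (rule AE_I2)
      fix x assume x: "x \<in> space M"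
      have "0 \<le> (f x + s i x)\<^sup>2" by simp
      then have "(f x - s i x)\<^sup>2 \<le> 2 * (f x)\<^sup>2 + 2 * (s i x)\<^sup>2"
        by (simp add: power2_sum power2_diff)
      with sq2[OF x, of i] show "norm ((f x - s i x)\<^sup>2) \<le> 10 * (f x)\<^sup>2" by simp
    qed
  qed auto
  then have "eventually (\<lambda>i. (LINT x|M. (f x - s i x)\<^sup>2) < e) sequentially"
    using \<open>e > 0\<close> by (intro order_tendstoD(2)[where y=0]) auto
  then obtain i where "(LINT x|M. (f x - s i x)\<^sup>2) < e"
    by (auto simp: eventually_sequentially)
  then show ?thesis using that[of "s i"] s(1) ssq by auto
qed

text \<open>A countable product of closed intervals is compact, and first countability makes it
  sequentially compact; convergence in the product topology is convergence of every
  coordinate.\<close>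

lemma pointwise_convergent_subseq:
  fixes u :: "nat \<Rightarrow> nat \<Rightarrow> real"
  assumes "\<And>i j. \<bar>u i j\<bar> \<le> b j"
  obtains r where "strict_mono r" "\<And>j. convergent (\<lambda>i. u (r i) j)"
proof -
  have "compact (PiE UNIV (\<lambda>j. cball 0 (b j)) :: (nat \<Rightarrow> real) set)"
    using compactin_PiE[of "\<lambda>_. euclideanreal" UNIV "\<lambda>j. cball 0 (b j)"]
    by (auto simp: euclidean_product_topology compactin_euclidean_iff)
  then have "seq_compact (PiE UNIV (\<lambda>j. cball 0 (b j)) :: (nat \<Rightarrow> real) set)"
    by (rule compact_imp_seq_compact)
  moreover have "u i \<in> PiE UNIV (\<lambda>j. cball 0 (b j))" for i
    using assms by (auto simp: dist_real_def)
  ultimately obtain l r where lr: "strict_mono (r::nat\<Rightarrow>nat)" "(u \<circ> r) \<longlonglongrightarrow> l"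
    by (rule_tac seq_compactE[of _ u]) auto
  have "(\<lambda>i. u (r i) j) \<longlonglongrightarrow> l j" for j
  proof -
    have "isCont (\<lambda>x::nat \<Rightarrow> real. x j) l"
      using continuous_on_product_coordinates[where 'a=nat and 'b=real and i=j]
      unfolding continuous_on_eq_continuous_at[OF open_UNIV] by blast
    from isCont_tendsto_compose[OF this lr(2)] show ?thesis by (simp add: o_def)
  qed
  then show ?thesis using that[of r] lr(1) by (auto simp: convergent_def)
qed

text \<open>A uniform limit of convergent sequences is Cauchy. This extends convergence of integrals
  from finite disjoint unions to countable ones, and from simple functions to all square-integrable
  ones.\<close>

lemma convergent_uniform_approx:
  fixes u :: "nat \<Rightarrow> real"
  assumes "\<And>e. e > 0 \<Longrightarrow> \<exists>v. convergent v \<and> (\<forall>i. \<bar>u i - v i\<bar> \<le> e)"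
  shows "convergent u"
proof -
  have "Cauchy u"
  proof (rule metric_CauchyI)
    fix e :: real assume e: "e > 0"
    then obtain v where v: "convergent v" "\<And>i. \<bar>u i - v i\<bar> \<le> e/4"
      using assms[of "e/4"] by auto
    then have "Cauchy v" by (simp add: Cauchy_convergent_iff)
    then obtain N where N: "\<And>m n. m \<ge> N \<Longrightarrow> n \<ge> N \<Longrightarrow> dist (v m) (v n) < e/4"
      using metric_CauchyD[of v "e/4"] e by auto
    show "\<exists>N. \<forall>m\<ge>N. \<forall>n\<ge>N. dist (u m) (u n) < e"
    proof (intro exI allI impI)
      fix m n assume "m \<ge> N" "n \<ge> N"
      from N[OF this] v(2)[of m] v(2)[of n] e show "dist (u m) (u n) < e"
        unfolding dist_real_def by linarith
    qed
  qed
  then show ?thesis by (simp add: Cauchy_convergent_iff)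
qed

text \<open>Weak sequential compactness: the integrals over a countable generating \<pi>-system converge
  along a subsequence by Tychonoff, and the boundedness in norm carries convergence over to
  countable disjoint unions.\<close>

lemma weakly_convergent_subseq:
  assumes fin: "finite_measure M"
    and gen: "sets M = sigma_sets (space M) G" "countable G" "G \<subseteq> Pow (space M)" "Int_stable G"
    and F: "\<And>i::nat. sq_int M (F i)" and b: "\<And>i. (LINT x|M. (F i x)\<^sup>2) \<le> b"
  obtains r where "strict_mono r" "\<And>\<phi>. sq_int M \<phi> \<Longrightarrow> convergent (\<lambda>i. LINT x|M. \<phi> x * F (r i) x)"
proof -
  interpret finite_measure M by fact
  have b0: "b \<ge> 0" using b[of 0] by (rule order_trans[rotated]) simp
  have ind: "sq_int M (indicator A)" if "A \<in> sets M" for A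
  proof -
    have "(\<lambda>x. (indicator A x)\<^sup>2) = (indicator A :: _ \<Rightarrow> real)" by (auto simp: indicator_def)
    then show ?thesis using that by (auto simp: sq_int_def emeasure_eq_measure intro!: integrable_real_indicator)
  qed
  have ind2: "(LINT x|M. (indicator A x)\<^sup>2) = measure M A" if "A \<in> sets M" for A
  proof -
    have "(LINT x|M. (indicator A x)\<^sup>2) = (LINT x|M. indicator A x :: real)"
      by (intro Bochner_Integration.integral_cong) (auto simp: indicator_def)
    then show ?thesis using that by (simp add: Int_absorb1 sets.sets_into_space)
  qed
  have CSb: "\<bar>LINT x|M. f x * F i x\<bar> \<le> sqrt ((LINT x|M. (f x)\<^sup>2) * b)" if "sq_int M f" for f i
  proof (rule real_le_rsqrt)
    have "(LINT x|M. f x * F i x)\<^sup>2 \<le> (LINT x|M. (f x)\<^sup>2) * (LINT x|M. (F i x)\<^sup>2)"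
      by (rule sq_int_CS[OF that F])
    also have "\<dots> \<le> (LINT x|M. (f x)\<^sup>2) * b"
      by (intro mult_left_mono b) simp
    finally show "\<bar>LINT x|M. f x * F i x\<bar>\<^sup>2 \<le> (LINT x|M. (f x)\<^sup>2) * b" by simp
  qed
  \<comment> \<open>An intersection-stable generator need not contain \<open>space M\<close>, whose
    integral is needed for complements.\<close>
  define G' where "G' = insert (space M) G"
  define A where "A = from_nat_into G'"
  have "countable G'" "G' \<noteq> {}" using gen(2) by (auto simp: G'_def)
  then have rA: "range A = G'" by (simp add: A_def range_from_nat_into)
  have "G \<subseteq> sets M" using gen(1) by auto
  moreover have "A j \<in> G'" for j using rA by blast
  ultimately have AM: "A j \<in> sets M" for j unfolding G'_def by (metis insertE sets.top subsetD)
  have "\<bar>LINT x|M. indicator (A j) x * F i x\<bar> \<le> sqrt (measure M (A j) * b)" for i j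
    using CSb[OF ind[OF AM[of j]], of i] by (simp add: ind2[OF AM])
  from pointwise_convergent_subseq[of "\<lambda>i j. LINT x|M. indicator (A j) x * F i x", OF this]
  obtain r where r: "strict_mono r" "\<And>j. convergent (\<lambda>i. LINT x|M. indicator (A j) x * F (r i) x)"
    by blast
  let ?c = "\<lambda>f i. LINT x|M. f x * F (r i) x"
  have cG: "convergent (?c (indicator B))" if "B \<in> G'" for B
    using r(2) rA that by (metis rangeE)
  have spc: "B \<in> sets M \<Longrightarrow> B \<in> sigma_sets (space M) G" for B by (simp add: gen)
  have cset: "convergent (?c (indicator B))" if "B \<in> sets M" for B
    using gen(4,3) spc[OF that]
  proof (induction rule: sigma_sets_induct_disjoint)
    case (basic B) then show ?case by (intro cG) (auto simp: G'_def)
  next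
    case empty then show ?case by (simp add: convergent_const)
  next
    case (compl B)
    then have BM: "B \<in> sets M" by (simp add: gen)
    have "?c (indicator (space M - B)) i = ?c (indicator (space M)) i - ?c (indicator B) i" for i
    proof -
      have "?c (indicator (space M - B)) i = (LINT x|M. indicator (space M) x * F (r i) x - indicator B x * F (r i) x)"
        by (intro Bochner_Integration.integral_cong) (auto simp: indicator_def)
      also have "\<dots> = ?c (indicator (space M)) i - ?c (indicator B) i"
        by (intro Bochner_Integration.integral_diff sq_int_mult_integrable ind F BM) auto
      finally show ?thesis .
    qed
    moreover have "convergent (?c (indicator (space M)))" by (intro cG) (auto simp: G'_def)
    ultimately show ?case using compl by (auto intro: convergent_diff)
  next
    case (union B)
    then have BM: "range B \<subseteq> sets M" by (auto simp: gen)
    then have BM': "B n \<in> sets M" for n by auto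
    show ?case
    proof (rule convergent_uniform_approx)
      fix e :: real assume e: "e > 0"
      have "(\<lambda>n. measure M (B n)) sums measure M (\<Union>n. B n)"
        by (rule finite_measure_UNION[OF BM union(1)])
      then have "(\<lambda>k. measure M (\<Union>n. B n) - (\<Sum>n<k. measure M (B n))) \<longlonglongrightarrow> measure M (\<Union>n. B n) - measure M (\<Union>n. B n)"
        unfolding sums_def by (intro tendsto_intros)
      then have "(\<lambda>k. sqrt ((measure M (\<Union>n. B n) - (\<Sum>n<k. measure M (B n))) * b)) \<longlonglongrightarrow> sqrt (0 * b)"
        by (intro tendsto_intros) auto
      then have "eventually (\<lambda>k. sqrt ((measure M (\<Union>n. B n) - (\<Sum>n<k. measure M (B n))) * b) < e) sequentially"
        using e by (intro order_tendstoD(2)[where y=0]) auto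
      then obtain k where k: "sqrt ((measure M (\<Union>n. B n) - (\<Sum>n<k. measure M (B n))) * b) < e"
        by (auto simp: eventually_sequentially)
      \<comment> \<open>\<open>T\<close> is the tail of the disjoint union. By Cauchy--Schwarz its
        contribution is at most the square root of measure times \<open>b\<close>, for every
        \<open>i\<close> at once, so the approximation is uniform.\<close>
      define T where "T = (\<Union>n. B n) - (\<Union>n<k. B n)"
      have TM: "T \<in> sets M" using BM' by (auto simp: T_def)
      have dj: "disjoint_family_on B {..<k}" using union(1) by (auto simp: disjoint_family_on_def)
      have "measure M T = measure M (\<Union>n. B n) - measure M (\<Union>n<k. B n)"
        unfolding T_def by (rule finite_measure_Diff) (use BM' in auto)
      also have "measure M (\<Union>n<k. B n) = (\<Sum>n<k. measure M (B n))"
        by (rule finite_measure_finite_Union) (use BM' dj in auto)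
      finally have mT: "measure M T = measure M (\<Union>n. B n) - (\<Sum>n<k. measure M (B n))" .
      have indU: "indicator (\<Union>n<k. B n) x = (\<Sum>n<k. indicator (B n) x :: real)" for x
        by (rule indicator_UN_disjoint[OF _ dj]) simp
      have eq: "?c (indicator (\<Union>n. B n)) i - (\<Sum>n<k. ?c (indicator (B n)) i) = ?c (indicator T) i" for i
      proof -
        have "?c (indicator T) i = (LINT x|M. indicator (\<Union>n. B n) x * F (r i) x - (\<Sum>n<k. indicator (B n) x * F (r i) x))"
          by (intro Bochner_Integration.integral_cong)
             (auto simp: T_def indU[symmetric] simp flip: sum_distrib_right split: split_indicator)
        also have "\<dots> = ?c (indicator (\<Union>n. B n)) i - (LINT x|M. (\<Sum>n<k. indicator (B n) x * F (r i) x))"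
          by (intro Bochner_Integration.integral_diff sq_int_mult_integrable ind F
                Bochner_Integration.integrable_sum) (use BM' in auto)
        also have "(LINT x|M. (\<Sum>n<k. indicator (B n) x * F (r i) x)) = (\<Sum>n<k. ?c (indicator (B n)) i)"
          by (intro Bochner_Integration.integral_sum sq_int_mult_integrable ind F) (use BM' in auto)
        finally show ?thesis by simp
      qed
      show "\<exists>v. convergent v \<and> (\<forall>i. \<bar>?c (indicator (\<Union>n. B n)) i - v i\<bar> \<le> e)"
      proof (intro exI conjI allI)
        show "convergent (\<lambda>i. \<Sum>n<k. ?c (indicator (B n)) i)"
          by (intro convergent_sum union)
        show "\<bar>?c (indicator (\<Union>n. B n)) i - (\<Sum>n<k. ?c (indicator (B n)) i)\<bar> \<le> e" for i
          unfolding eq using CSb[OF ind[OF TM], of "r i"] k by (simp add: ind2[OF TM] mT)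
      qed
    qed
  qed
  have "convergent (?c \<phi>)" if \<phi>: "sq_int M \<phi>" for \<phi>
  proof (rule convergent_uniform_approx)
    fix e :: real assume e: "e > 0"
    \<comment> \<open>The summand 1 keeps the divisor positive when \<open>b = 0\<close>.\<close>
    have pos: "e\<^sup>2 / (b + 1) > 0" using e b0 by (intro divide_pos_pos) auto
    obtain s where
      s: "simple_function M s" "sq_int M s" "(LINT x|M. (\<phi> x - s x)\<^sup>2) < e\<^sup>2 / (b + 1)"
      by (rule simple_fun_approx_sq[OF \<phi> pos])
    have cs: "?c s i = (\<Sum>y\<in>s ` space M. y * ?c (indicator (s -` {y} \<inter> space M)) i)" for i
    proof -
      have "?c s i = (LINT x|M. (\<Sum>y\<in>s ` space M. y * (indicator (s -` {y} \<inter> space M) x * F (r i) x)))"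
      proof (intro Bochner_Integration.integral_cong refl)
        fix x assume "x \<in> space M"
        have eq: "s x * F (r i) x = (\<Sum>y\<in>s ` space M. indicator (s -` {y} \<inter> space M) x *\<^sub>R y) * F (r i) x"
          by (rule arg_cong[OF simple_function_indicator_representation_banach[OF s(1) \<open>x \<in> space M\<close>]])
        show "s x * F (r i) x = (\<Sum>y\<in>s ` space M. y * (indicator (s -` {y} \<inter> space M) x * F (r i) x))"
          unfolding eq sum_distrib_right by (intro sum.cong) auto
      qed
      also have "\<dots> = (\<Sum>y\<in>s ` space M. LINT x|M. y * (indicator (s -` {y} \<inter> space M) x * F (r i) x))"
        by (intro Bochner_Integration.integral_sum integrable_mult_right sq_int_mult_integrable ind F
             simple_functionD(2)[OF s(1)])
      finally show ?thesis by simp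
    qed
    show "\<exists>v. convergent v \<and> (\<forall>i. \<bar>?c \<phi> i - v i\<bar> \<le> e)"
    proof (intro exI conjI allI)
      show "convergent (?c s)"
        unfolding cs using simple_functionD(2)[OF s(1)]
        by (intro convergent_sum convergent_mult convergent_const cset)
      fix i
      have "?c \<phi> i - ?c s i = (LINT x|M. \<phi> x * F (r i) x - s x * F (r i) x)"
        by (intro Bochner_Integration.integral_diff[symmetric] sq_int_mult_integrable \<phi> s F)
      also have "\<dots> = (LINT x|M. (\<phi> x - s x) * F (r i) x)"
        by (simp add: left_diff_distrib)
      also have "\<bar>\<dots>\<bar> \<le> sqrt ((LINT x|M. (\<phi> x - s x)\<^sup>2) * b)"
        by (rule CSb[OF sq_int_diff[OF \<phi> s(2)]])
      also have "\<dots> \<le> sqrt (e\<^sup>2 / (b + 1) * (b + 1))"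
        using s(3) b0 by (intro real_sqrt_le_mono mult_mono) auto
      also have "\<dots> = e" using b0 e by simp
      finally show "\<bar>?c \<phi> i - ?c s i\<bar> \<le> e" .
    qed
  qed
  with r(1) show ?thesis by (rule that)
qed

section \<open>Trace-class operators with a Hilbert--Schmidt factor\<close>

text \<open>Covers the case in which the formal transition density vanishes. The only possible
  eigenvalue is 0, which contributes 0 whatever its multiplicity.\<close>

lemma trace_class_zero: "trace_class M (\<lambda>f x. 0)"
proof -
  have "compact_operator M (\<lambda>f x. 0)"
    unfolding compact_operator_def
    by (intro conjI ballI allI impI bexI[of _ "\<lambda>_. 0"] exI[of _ id]) (auto simp: L2_zero_def L2_norm_def strict_mono_def)
  moreover have "eigenvalues M (\<lambda>f x. 0) \<subseteq> {0}"
    by (auto simp: eigenvalues_def eigenspace_def)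
  then have "(\<Sum>\<^sub>\<infinity>c\<in>eigenvalues M (\<lambda>f x. 0). eigen_multiplicity M (\<lambda>f x. 0) c * ennreal \<bar>c\<bar>) = 0"
    by (intro infsum_0) auto
  ultimately show ?thesis by (simp add: trace_class_def)
qed

text \<open>The coefficients \<open>a\<close> express every orthonormal function pointwise through
  the given family, so that orthonormalizing eigenfunctions of one eigenvalue yields eigenfunctions
  of the same eigenvalue.\<close>

lemma gram_schmidt_AE:
  assumes "finite F" and "\<And>f. f \<in> F \<Longrightarrow> sq_int M f" and "lin_indep_AE M F"
  shows "\<exists>e a. \<forall>i<card F. (\<forall>x. e i x = (\<Sum>f\<in>F. a i f * f x)) \<and>
    (\<forall>j<card F. (LINT x|M. e i x * e j x) = (if i = j then 1 else 0))"
  using assms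
proof (induction F rule: finite_induct)
  case empty
  then show ?case by auto
next
  case (insert f F)
  have li: "lin_indep_AE M F"
    unfolding lin_indep_AE_def
  proof (intro allI impI ballI)
    fix c g assume c: "AE x in M. (\<Sum>f\<in>F. c f * f x) = 0" and g: "g \<in> F"
    \<comment> \<open>The relation is extended to \<open>insert f F\<close> with coefficient 0 at
      \<open>f\<close>.\<close>
    have "(\<Sum>h\<in>insert f F. (if h = f then 0 else c h) * h x) = (\<Sum>h\<in>F. c h * h x)" for x
      using insert(1,2) by (auto intro!: sum.cong)
    then have "AE x in M. (\<Sum>h\<in>insert f F. (if h = f then 0 else c h) * h x) = 0" using c by simp
    then have "\<forall>h\<in>insert f F. (if h = f then 0 else c h) = 0"
      using spec[OF insert.prems(2)[unfolded lin_indep_AE_def], of "\<lambda>h. if h = f then 0 else c h"] by blast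
    then show "c g = 0" using g insert(2) by (metis insertCI)
  qed
  have sqF: "g \<in> F \<Longrightarrow> sq_int M g" for g using insert.prems by simp
  from insert.IH[OF sqF li] obtain e a where
    e: "\<And>i x. i < card F \<Longrightarrow> e i x = (\<Sum>f\<in>F. a i f * f x)" and
    o: "\<And>i j. i < card F \<Longrightarrow> j < card F \<Longrightarrow> (LINT x|M. e i x * e j x) = (if i = j then 1 else 0)"
    by blast
  let ?n = "card F"
  have sqf: "sq_int M f" using insert.prems by simp
  have esq: "sq_int M (e i)" if "i < ?n" for i
  proof -
    have "e i = (\<lambda>x. \<Sum>f\<in>F. a i f * f x)" using e that by auto
    then show ?thesis by (simp add: sq_int_sum sq_int_cmult sqF)
  qed
  define b where "b i = (LINT x|M. f x * e i x)" for i
  define r where "r x = f x - (\<Sum>i<?n. b i * e i x)" for x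
  have rsq: "sq_int M r"
    unfolding r_def using sqf esq by (intro sq_int_diff sq_int_sum sq_int_cmult) auto
  have ro: "(LINT x|M. r x * e j x) = 0" if j: "j < ?n" for j
  proof -
    have "(LINT x|M. r x * e j x) = (LINT x|M. f x * e j x - (\<Sum>i<?n. b i * (e i x * e j x)))"
      by (intro Bochner_Integration.integral_cong) (auto simp: r_def left_diff_distrib sum_distrib_right mult.assoc)
    also have "\<dots> = b j - (LINT x|M. (\<Sum>i<?n. b i * (e i x * e j x)))"
      unfolding b_def
      by (intro Bochner_Integration.integral_diff Bochner_Integration.integrable_sum integrable_mult_right sq_int_mult_integrable sqf esq j) auto
    also have "(LINT x|M. (\<Sum>i<?n. b i * (e i x * e j x))) = (\<Sum>i<?n. LINT x|M. b i * (e i x * e j x))"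
      by (intro Bochner_Integration.integral_sum integrable_mult_right sq_int_mult_integrable sqf esq j) auto
    also have "\<dots> = (\<Sum>i<?n. if i = j then b i else 0)"
      using o j by (intro sum.cong) auto
    also have "\<dots> = b j" using j by simp
    finally show ?thesis by simp
  qed
  \<comment> \<open>Coefficients of the residual \<open>r\<close> in the enlarged family. That of
    \<open>f\<close> is 1, so by independence \<open>r\<close> cannot vanish almost
    everywhere.\<close>
  define d where "d g = (if g = f then 1 else - (\<Sum>i<?n. b i * a i g))" for g
  have rd: "r x = (\<Sum>g\<in>insert f F. d g * g x)" for x
  proof -
    have "(\<Sum>i<?n. b i * e i x) = (\<Sum>i<?n. \<Sum>g\<in>F. b i * a i g * g x)"
      using e by (intro sum.cong) (auto simp: sum_distrib_left mult.assoc)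
    also have "\<dots> = (\<Sum>g\<in>F. (\<Sum>i<?n. b i * a i g) * g x)"
      by (subst sum.swap) (simp add: sum_distrib_right)
    finally have "r x = f x + (\<Sum>g\<in>F. - (\<Sum>i<?n. b i * a i g) * g x)"
      by (simp add: r_def sum_negf)
    also have "(\<Sum>g\<in>F. - (\<Sum>i<?n. b i * a i g) * g x) = (\<Sum>g\<in>F. d g * g x)"
      using insert(2) by (intro sum.cong) (auto simp: d_def)
    finally show ?thesis using insert(1,2) by (simp add: d_def)
  qed
  define N where "N = (LINT x|M. (r x)\<^sup>2)"
  have "N \<noteq> 0"
  proof
    assume "N = 0"
    then have "AE x in M. (r x)\<^sup>2 = 0"
      using integral_nonneg_eq_0_iff_AE[OF sq_int_integrable[OF rsq]] by (simp add: N_def)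
    then have "AE x in M. (\<Sum>g\<in>insert f F. d g * g x) = 0"
      by (simp only: rd) simp
    then have "d f = 0" using insert.prems(2) unfolding lin_indep_AE_def by blast
    then show False by (simp add: d_def)
  qed
  moreover have "N \<ge> 0" by (simp add: N_def)
  ultimately have N: "N > 0" by simp
  define e' where "e' i = (if i < ?n then e i else (\<lambda>x. r x / sqrt N))" for i
  define a' where "a' i = (if i < ?n then (\<lambda>g. if g = f then 0 else a i g) else (\<lambda>g. d g / sqrt N))" for i
  have e'1: "e' i x = (\<Sum>g\<in>insert f F. a' i g * g x)" for i x
  proof (cases "i < ?n")
    case True
    have "e i x = (\<Sum>g\<in>F. (if g = f then 0 else a i g) * g x)"
      unfolding e[OF True] using insert(2) by (intro sum.cong) auto
    then show ?thesis using insert(1,2) True by (simp add: e'_def a'_def)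
  next
    case False
    then show ?thesis by (simp add: e'_def a'_def rd sum_divide_distrib)
  qed
  have e'2: "(LINT x|M. e' i x * e' j x) = (if i = j then 1 else 0)" if "i < card (insert f F)" "j < card (insert f F)" for i j
  proof -
    have ij: "i \<le> ?n" "j \<le> ?n" using that insert(1,2) by auto
    have rr: "(LINT x|M. r x / sqrt N * (r x / sqrt N)) = 1"
    proof -
      have "(LINT x|M. r x / sqrt N * (r x / sqrt N)) = (LINT x|M. (r x)\<^sup>2 / N)"
        using N by (intro Bochner_Integration.integral_cong) (auto simp: power2_eq_square)
      then show ?thesis using N by (simp add: N_def[symmetric])
    qed
    have re: "(LINT x|M. r x / sqrt N * e k x) = 0" "(LINT x|M. e k x * (r x / sqrt N)) = 0" if "k < ?n" for k
      using ro[OF that] by (simp_all add: mult.commute)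
    consider "i < ?n" "j < ?n" | "i = ?n" "j < ?n" | "i < ?n" "j = ?n" | "i = ?n" "j = ?n"
      using ij by linarith
    then show ?thesis using o re rr by cases (auto simp: e'_def)
  qed
  show ?case using e'1 e'2 by blast
qed

text \<open>\<open>g\<close> is the orthogonal projection of \<open>f\<close>; the squared norm of
  \<open>f - g\<close> is the defect of the inequality.\<close>

lemma bessel:
  assumes "finite I" and e: "\<And>i. i \<in> I \<Longrightarrow> sq_int M (e i)"
    and o: "\<And>i j. i \<in> I \<Longrightarrow> j \<in> I \<Longrightarrow> (LINT x|M. e i x * e j x) = (if i = j then 1 else 0)"
    and f: "sq_int M f"
  shows "(\<Sum>i\<in>I. (LINT x|M. e i x * f x)\<^sup>2) \<le> (LINT x|M. (f x)\<^sup>2)"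
proof -
  define b where "b i = (LINT x|M. e i x * f x)" for i
  define g where "g x = (\<Sum>i\<in>I. b i * e i x)" for x
  have g: "sq_int M g" unfolding g_def by (intro sq_int_sum sq_int_cmult e)
  have gh: "(LINT x|M. g x * h x) = (\<Sum>i\<in>I. b i * (LINT x|M. e i x * h x))" if h: "sq_int M h" for h
  proof -
    have "(LINT x|M. g x * h x) = (LINT x|M. (\<Sum>i\<in>I. b i * (e i x * h x)))"
      by (simp add: g_def sum_distrib_right mult.assoc)
    also have "\<dots> = (\<Sum>i\<in>I. LINT x|M. b i * (e i x * h x))"
      by (intro Bochner_Integration.integral_sum integrable_mult_right sq_int_mult_integrable e h)
    finally show ?thesis by simp
  qed
  have gf: "(LINT x|M. g x * f x) = (\<Sum>i\<in>I. (b i)\<^sup>2)"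
    using gh[OF f] by (simp add: b_def[symmetric] power2_eq_square)
  have eg: "(LINT x|M. e i x * g x) = b i" if i: "i \<in> I" for i
  proof -
    have "(LINT x|M. e i x * g x) = (LINT x|M. g x * e i x)" by (simp add: mult.commute)
    also have "\<dots> = (\<Sum>j\<in>I. if i = j then b j else 0)"
      unfolding gh[OF e[OF i]] using o i by (intro sum.cong) auto
    also have "\<dots> = b i" using i \<open>finite I\<close> by simp
    finally show ?thesis .
  qed
  have gg: "(LINT x|M. g x * g x) = (\<Sum>i\<in>I. (b i)\<^sup>2)"
    using gh[OF g] eg by (simp add: power2_eq_square)
  have "0 \<le> (LINT x|M. (f x - g x)\<^sup>2)" by simp
  also have "\<dots> = (LINT x|M. (f x)\<^sup>2 - 2 * (g x * f x) + g x * g x)"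
    by (intro Bochner_Integration.integral_cong) (auto simp: power2_eq_square algebra_simps)
  also have "\<dots> = (LINT x|M. (f x)\<^sup>2) - 2 * (LINT x|M. g x * f x) + (LINT x|M. g x * g x)"
    using sq_int_integrable[OF f] sq_int_mult_integrable[OF g f] sq_int_mult_integrable[OF g g] by simp
  finally show ?thesis by (simp add: gf gg b_def)
qed

text \<open>Multiplicities are suprema over families that can be chosen independently for each
  eigenvalue, so a bound for every simultaneous choice bounds the finite sum of suprema. The term
  \<open>t\<close> carries the choices already made through the induction.\<close>

lemma sum_SUP_ennreal_le:
  fixes u :: "'a \<Rightarrow> 'b \<Rightarrow> ennreal"
  assumes "finite S" "\<And>c. c \<in> S \<Longrightarrow> A c \<noteq> {}"
    and "\<And>\<phi>. (\<And>c. c \<in> S \<Longrightarrow> \<phi> c \<in> A c) \<Longrightarrow> (\<Sum>c\<in>S. u c (\<phi> c)) + t \<le> T"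
  shows "(\<Sum>c\<in>S. SUP F\<in>A c. u c F) + t \<le> T"
  using assms
proof (induction S arbitrary: t rule: finite_induct)
  case empty
  then show ?case by auto
next
  case (insert c S)
  have "(\<Sum>c\<in>S. SUP F\<in>A c. u c F) + (u c F + t) \<le> T" if F: "F \<in> A c" for F
  proof (rule insert.IH)
    fix \<phi> assume \<phi>: "\<And>c. c \<in> S \<Longrightarrow> \<phi> c \<in> A c"
    have "(\<Sum>c'\<in>insert c S. u c' ((\<phi>(c := F)) c')) + t \<le> T"
      by (rule insert.prems) (use F \<phi> in auto)
    moreover have "(\<Sum>c'\<in>S. u c' ((\<phi>(c := F)) c')) = (\<Sum>c'\<in>S. u c' (\<phi> c'))"
      using insert(2) by (intro sum.cong) auto
    ultimately show "(\<Sum>c\<in>S. u c (\<phi> c)) + (u c F + t) \<le> T"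
      using insert(1,2) by (simp add: ac_simps)
  qed (use insert.prems in auto)
  then have "(SUP F\<in>A c. u c F + ((\<Sum>c\<in>S. SUP F\<in>A c. u c F) + t)) \<le> T"
    by (intro SUP_least) (simp add: ac_simps)
  then have "(SUP F\<in>A c. u c F) + ((\<Sum>c\<in>S. SUP F\<in>A c. u c F) + t) \<le> T"
    using insert.prems(1)[of c] by (subst (asm) ennreal_SUP_add_left) auto
  then show ?case
    using insert(1,2) by (simp add: add.assoc)
qed

section \<open>Integral operators with a square-integrable kernel\<close>

definition kernel_integral :: "'a measure \<Rightarrow> ('a \<Rightarrow> 'b \<Rightarrow> real) \<Rightarrow> ('a \<Rightarrow> real) \<Rightarrow> 'b \<Rightarrow> real" where
  "kernel_integral M q f z = (LINT x|M. f x * q x z)"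

text \<open>In the application \<open>M\<close> is the posterior, \<open>W\<close> the marginal law
  of the latent vector and \<open>q\<close> the density of the joint law relative to their product.
  With this normalization \<open>P\<close> and \<open>R\<close> are the two conditional
  expectations.\<close>

locale hs_kernel = M: finite_measure M + W: finite_measure W
  for M :: "'a measure" and W :: "'b measure" +
  fixes q :: "'a \<Rightarrow> 'b \<Rightarrow> real"
  assumes sq_int_q: "sq_int (M \<Otimes>\<^sub>M W) (\<lambda>(x, z). q x z)"
begin

sublocale pair_sigma_finite M W ..

abbreviation "P \<equiv> kernel_integral M q"
abbreviation "R \<equiv> kernel_integral W (\<lambda>z x. q x z)"

definition "T = (LINT z|W. LINT x|M. (q x z)\<^sup>2)"

lemma q_measurable[measurable]: "case_prod q \<in> borel_measurable (M \<Otimes>\<^sub>M W)"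
  using sq_int_q by (simp add: sq_int_def)

lemma q_measurable'[measurable (raw)]:
  "f \<in> measurable N M \<Longrightarrow> g \<in> measurable N W \<Longrightarrow> (\<lambda>x. q (f x) (g x)) \<in> borel_measurable N"
  using measurable_compose[OF measurable_Pair q_measurable, of f N g] by simp

text \<open>The hypothesis is symmetric in the two factors, so each fact about \<open>P\<close> is
  available for its adjoint \<open>R\<close>.\<close>

lemma swap: "hs_kernel W M (\<lambda>z x. q x z)"
proof
  have "integrable (W \<Otimes>\<^sub>M M) (\<lambda>(x, y). (case (y, x) of (x, z) \<Rightarrow> (q x z)\<^sup>2))"
    using sq_int_q integrable_product_swap[of "\<lambda>(x, z). (q x z)\<^sup>2"] by (simp add: sq_int_def case_prod_beta')
  then show "sq_int (W \<Otimes>\<^sub>M M) (\<lambda>(x, z). q z x)"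
    by (auto simp: sq_int_def case_prod_beta')
qed

lemma q2_integrable: "integrable (M \<Otimes>\<^sub>M W) (\<lambda>(x, z). (q x z)\<^sup>2)"
  using sq_int_q by (simp add: sq_int_def case_prod_beta')

lemma integrable_slice: "integrable W (\<lambda>z. LINT x|M. (q x z)\<^sup>2)"
  by (rule integrable_snd[OF q2_integrable])

lemma AE_sq_int_slice: "AE z in W. sq_int M (\<lambda>x. q x z)"
  using AE_integrable_snd[OF q2_integrable] AE_space
  by eventually_elim (auto simp: sq_int_def)

lemma P_measurable[measurable]:
  assumes [measurable]: "a \<in> borel_measurable M"
  shows "P a \<in> borel_measurable W"
  unfolding kernel_integral_def[abs_def] by measurable

text \<open>The bound depends on \<open>a\<close> only through its norm: one integrable function of
  \<open>z\<close> dominates the images of a whole bounded set, which is the source of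
  compactness.\<close>

lemma P_bound: "sq_int M a \<Longrightarrow> AE z in W. (P a z)\<^sup>2 \<le> (LINT x|M. (a x)\<^sup>2) * (LINT x|M. (q x z)\<^sup>2)"
  using AE_sq_int_slice
  by eventually_elim (auto simp: kernel_integral_def intro!: sq_int_CS)

lemma sq_int_P: assumes a: "sq_int M a"
  shows "sq_int W (P a)" "(LINT z|W. (P a z)\<^sup>2) \<le> (LINT x|M. (a x)\<^sup>2) * T"
proof -
  have [measurable]: "a \<in> borel_measurable M" using a by (simp add: sq_int_def)
  have i: "integrable W (\<lambda>z. (LINT x|M. (a x)\<^sup>2) * (LINT x|M. (q x z)\<^sup>2))"
    using integrable_slice by simp
  show "sq_int W (P a)" by (rule sq_int_bound[OF i _ P_bound[OF a]]) measurable
  have "(LINT z|W. (P a z)\<^sup>2) \<le> (LINT z|W. (LINT x|M. (a x)\<^sup>2) * (LINT x|M. (q x z)\<^sup>2))"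
    by (rule sq_int_bound[OF i _ P_bound[OF a]]) measurable
  then show "(LINT z|W. (P a z)\<^sup>2) \<le> (LINT x|M. (a x)\<^sup>2) * T"
    by (simp add: T_def)
qed

lemma integrable_prod:
  assumes a: "sq_int M a" and b: "sq_int W b"
  shows "integrable (M \<Otimes>\<^sub>M W) (\<lambda>(x, z). a x * b z * q x z)"
proof -
  have [measurable]: "a \<in> borel_measurable M" "b \<in> borel_measurable W" using a b by (auto simp: sq_int_def)
  have "integrable (M \<Otimes>\<^sub>M W) (\<lambda>(x, z). (a x)\<^sup>2 * (b z)\<^sup>2)"
    using sq_int_integrable[OF a] sq_int_integrable[OF b]
    by (intro Fubini_integrable) auto
  then have "sq_int (M \<Otimes>\<^sub>M W) (\<lambda>(x, z). a x * b z)"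
    by (simp add: sq_int_def case_prod_beta' power_mult_distrib)
  from sq_int_mult_integrable[OF this sq_int_q] show ?thesis
    by (simp add: case_prod_beta')
qed

lemma P_R_adjoint:
  assumes a: "sq_int M a" and b: "sq_int W b"
  shows "(LINT z|W. b z * P a z) = (LINT x|M. a x * R b x)"
proof -
  have "(LINT z|W. b z * P a z) = (LINT z|W. LINT x|M. a x * b z * q x z)"
    by (simp add: kernel_integral_def mult_ac flip: integral_mult_right_zero)
  also have "\<dots> = (LINT x|M. LINT z|W. a x * b z * q x z)"
    by (rule Fubini_integral[OF integrable_prod[OF a b]])
  also have "\<dots> = (LINT x|M. a x * R b x)"
    by (simp add: kernel_integral_def mult_ac flip: integral_mult_right_zero)
  finally show ?thesis .
qed

lemma AE_sq_int_slice': "AE x in M. sq_int W (q x)"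
  using hs_kernel.AE_sq_int_slice[OF swap] .

lemma R_measurable[measurable]: "b \<in> borel_measurable W \<Longrightarrow> R b \<in> borel_measurable M"
  using hs_kernel.P_measurable[OF swap] .

lemma T_swap: "hs_kernel.T W M (\<lambda>z x. q x z) = T"
  unfolding hs_kernel.T_def[OF swap] T_def
  using Fubini_integral[OF q2_integrable] by simp

lemma sq_int_R: assumes "sq_int W b"
  shows "sq_int M (R b)" "(LINT x|M. (R b x)\<^sup>2) \<le> (LINT z|W. (b z)\<^sup>2) * T"
  using hs_kernel.sq_int_P[OF swap assms] by (simp_all add: T_swap)

end

text \<open>Here \<open>K = R \<circ> P\<close> with \<open>R\<close> the adjoint of the Hilbert--Schmidt operator \<open>P\<close>, so that by Bessel's inequality the sum
  of the eigenvalues \<open>\<langle>e, K e\<rangle> = \<parallel>P e\<parallel>\<^sup>2\<close> is at most the squared Hilbert--Schmidt norm \<open>T\<close>.\<close>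

locale da_kernel = hs_kernel +
  fixes G K
  assumes marg_M: "AE z in W. (LINT x|M. q x z) = 1"
    and marg_W: "AE x in M. (LINT z|W. q x z) = 1"
    and gen: "sets M = sigma_sets (space M) G" "countable G" "G \<subseteq> Pow (space M)" "Int_stable G"
    and K_eq: "\<And>f x. f \<in> L2_zero M \<Longrightarrow> x \<in> space M \<Longrightarrow> K f x = (LINT x'|M. f x' * (LINT z|W. q x z * q x' z))"
begin

lemma K_measurable: assumes f: "f \<in> L2_zero M" shows "K f \<in> borel_measurable M"
proof -
  have [measurable]: "f \<in> borel_measurable M" using f by (simp add: L2_zero_def)
  have "(\<lambda>x. LINT x'|M. f x' * (LINT z|W. q x z * q x' z)) \<in> borel_measurable M" by measurable
  then show ?thesis using measurable_cong[of M "K f" "\<lambda>x. LINT x'|M. f x' * (LINT z|W. q x z * q x' z)"] K_eq[OF f] by blast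
qed

text \<open>Adjointness applied to the slice \<open>q x\<close> exchanges the two integrals. That
  slice is square-integrable only for almost every \<open>x\<close>, so the factorization holds
  almost everywhere.\<close>

lemma K_RP: assumes f: "f \<in> L2_zero M" shows "AE x in M. K f x = R (P f) x"
  using AE_sq_int_slice' AE_space
proof eventually_elim
  case (elim x)
  have sf: "sq_int M f" using f by (simp add: L2_zero_iff)
  have "K f x = (LINT x'|M. f x' * R (q x) x')"
    using K_eq[OF f elim(2)] by (simp add: kernel_integral_def)
  also have "\<dots> = (LINT z|W. q x z * P f z)"
    using P_R_adjoint[OF sf elim(1)] by simp
  finally show ?case by (simp add: kernel_integral_def mult.commute)
qed

lemma sq_int_K: assumes f: "f \<in> L2_zero M" shows "sq_int M (K f)"
proof -
  have "sq_int M (R (P f))" using f by (intro sq_int_R sq_int_P) (simp add: L2_zero_iff)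
  moreover have "integrable M (\<lambda>x. (K f x)\<^sup>2) = integrable M (\<lambda>x. (R (P f) x)\<^sup>2)"
    using K_RP[OF f] K_measurable[OF f] calculation by (intro integrable_cong_AE) (auto simp: sq_int_def)
  ultimately show ?thesis using K_measurable[OF f] by (simp add: sq_int_def)
qed

text \<open>Symmetry and positivity of \<open>K\<close> can both be read off from this form.\<close>

lemma inner_K:
  assumes f: "f \<in> L2_zero M" and g: "sq_int M g"
  shows "(LINT x|M. g x * K f x) = (LINT z|W. P g z * P f z)"
proof -
  have sf: "sq_int M f" using f by (simp add: L2_zero_iff)
  have "(LINT x|M. g x * K f x) = (LINT x|M. g x * R (P f) x)"
    using K_RP[OF f] K_measurable[OF f] g sq_int_R(1)[OF sq_int_P(1)[OF sf]]
    by (intro integral_cong_AE) (auto simp: sq_int_def)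
  also have "\<dots> = (LINT z|W. P f z * P g z)"
    using P_R_adjoint[OF g sq_int_P(1)[OF sf]] by simp
  finally show ?thesis by (simp add: mult.commute)
qed

text \<open>The marginal conditions say that \<open>P\<close> and \<open>R\<close> send 1 to 1
  almost everywhere; testing against 1 then shows that \<open>K\<close> preserves the mean.\<close>

lemma K_mean_zero: assumes f: "f \<in> L2_zero M" shows "(LINT x|M. K f x) = 0"
proof -
  have sf: "sq_int M f" using f by (simp add: L2_zero_iff)
  note s1 = sq_int_const[OF M.finite_measure_axioms, of 1] sq_int_const[OF W.finite_measure_axioms, of 1]
  have one: "AE z in W. P (\<lambda>_. 1) z = 1" "AE x in M. R (\<lambda>_. 1) x = 1"
    using marg_M marg_W by (simp_all add: kernel_integral_def)
  have "(LINT x|M. K f x) = (LINT z|W. P (\<lambda>_. 1) z * P f z)"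
    using inner_K[OF f s1(1)] by simp
  also have "\<dots> = (LINT z|W. 1 * P f z)"
    using one sq_int_P(1)[OF s1(1)] sq_int_P(1)[OF sf]
    by (intro integral_cong_AE) (auto simp: sq_int_def)
  also have "\<dots> = (LINT x|M. f x * R (\<lambda>_. 1) x)"
    by (rule P_R_adjoint[OF sf s1(2)])
  also have "\<dots> = (LINT x|M. f x)"
    using one sq_int_R(1)[OF s1(2)] sf
    by (intro integral_cong_AE) (auto simp: sq_int_def)
  finally show ?thesis using f by (simp add: L2_zero_iff)
qed

lemma K_L2_zero: "f \<in> L2_zero M \<Longrightarrow> K f \<in> L2_zero M"
  using sq_int_K K_mean_zero by (simp add: L2_zero_iff)

text \<open>\<open>P\<close> turns weak into strong convergence: almost every slice of
  \<open>q\<close> is a test function, so the images of a weakly convergent subsequence converge at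
  almost every \<open>z\<close>, and the norm bound supplies a dominating function. The bounded
  operator \<open>R\<close> carries the limit back to \<open>M\<close>.\<close>

lemma compact_K: "compact_operator M K"
  unfolding compact_operator_def
proof (intro conjI ballI allI impI)
  show "K f \<in> L2_zero M" if "f \<in> L2_zero M" for f using K_L2_zero[OF that] .
next
  fix F :: "nat \<Rightarrow> 'a \<Rightarrow> real" and B :: real
  assume FB: "\<forall>i. F i \<in> L2_zero M \<and> L2_norm M (F i) \<le> B"
  then have FL: "F i \<in> L2_zero M" for i by blast
  have F: "sq_int M (F i)" for i using FB by (auto simp: L2_zero_iff)
  have Fb: "(LINT x|M. (F i x)\<^sup>2) \<le> B\<^sup>2" for i using FB by (auto intro: L2_norm_leD)
  obtain r where r: "strict_mono r"
    "\<And>\<phi>. sq_int M \<phi> \<Longrightarrow> convergent (\<lambda>i. LINT x|M. \<phi> x * F (r i) x)"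
    using weakly_convergent_subseq[where F=F and b="B\<^sup>2", OF M.finite_measure_axioms gen F Fb] by blast
  define H where "H z = lim (\<lambda>i. P (F (r i)) z)" for z
  have conv: "AE z in W. (\<lambda>i. P (F (r i)) z) \<longlonglongrightarrow> H z"
    using AE_sq_int_slice
  proof eventually_elim
    case (elim z)
    have "convergent (\<lambda>i. P (F (r i)) z)"
      using r(2)[OF elim] by (simp add: kernel_integral_def mult.commute)
    then show ?case by (simp add: H_def convergent_LIMSEQ_iff)
  qed
  have Pm[measurable]: "P (F (r i)) \<in> borel_measurable W" for i
    using sq_int_P(1)[OF F] by (simp add: sq_int_def)
  have Hm[measurable]: "H \<in> borel_measurable W"
    unfolding H_def by measurable
  define c where "c = (\<lambda>z. LINT x|M. (q x z)\<^sup>2)"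
  have ci: "integrable W c" using integrable_slice by (simp add: c_def)
  have c0: "c z \<ge> 0" for z by (simp add: c_def)
  have Pb: "AE z in W. (P (F (r i)) z)\<^sup>2 \<le> B\<^sup>2 * c z" for i
    using P_bound[OF F[of "r i"]]
  proof eventually_elim
    case (elim z)
    also have "(LINT x|M. (F (r i) x)\<^sup>2) * (LINT x|M. (q x z)\<^sup>2) \<le> B\<^sup>2 * c z"
      unfolding c_def by (intro mult_right_mono Fb) simp
    finally show ?case .
  qed
  have Pb': "AE z in W. \<forall>i. (P (F (r i)) z)\<^sup>2 \<le> B\<^sup>2 * c z"
    using Pb by (simp add: AE_all_countable)
  have Hb: "AE z in W. (H z)\<^sup>2 \<le> B\<^sup>2 * c z"
    using conv Pb'
  proof eventually_elim
    case (elim z)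
    show ?case by (rule LIMSEQ_le_const2[OF tendsto_power[OF elim(1)]]) (use elim(2) in auto)
  qed
  have H: "sq_int W H"
    by (rule sq_int_bound[where g="\<lambda>z. B\<^sup>2 * c z"]) (use ci Hb in auto)
  have lim: "(\<lambda>i. LINT z|W. (P (F (r i)) z - H z)\<^sup>2) \<longlonglongrightarrow> (LINT z|W. 0)"
  proof (rule integral_dominated_convergence)
    \<comment> \<open>4 = 2 + 2, since the squares of the sequence and of its limit are both at most
      \<open>B\<^sup>2 * c z\<close>.\<close>
    show "integrable W (\<lambda>z. 4 * (B\<^sup>2 * c z))" using ci by simp
    show "AE z in W. (\<lambda>i. (P (F (r i)) z - H z)\<^sup>2) \<longlonglongrightarrow> 0"
      using conv
    proof eventually_elim
      case (elim z)
      from tendsto_power[OF tendsto_diff[OF elim tendsto_const[of "H z"]], of 2] show ?case by simp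
    qed
    show "AE z in W. norm ((P (F (r i)) z - H z)\<^sup>2) \<le> 4 * (B\<^sup>2 * c z)" for i
      using Pb[of i] Hb
    proof eventually_elim
      case (elim z)
      have "0 \<le> (P (F (r i)) z + H z)\<^sup>2" by simp
      moreover have "norm ((P (F (r i)) z - H z)\<^sup>2) = (P (F (r i)) z - H z)\<^sup>2" by simp
      ultimately show ?case using elim unfolding power2_sum power2_diff by linarith
    qed
  qed auto
  let ?g = "R H"
  have g: "sq_int M ?g" by (rule sq_int_R(1)[OF H])
  have KF: "sq_int M (K (F (r i)))" for i by (rule sq_int_K[OF FL])
  have diff: "(LINT x|M. (K (F (r i)) x - ?g x)\<^sup>2) \<le> (LINT z|W. (P (F (r i)) z - H z)\<^sup>2) * T" for i
  proof -
    note PF = sq_int_P(1)[OF F[of "r i"]]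
    have "AE x in M. (K (F (r i)) x - ?g x)\<^sup>2 = (R (\<lambda>z. P (F (r i)) z - H z) x)\<^sup>2"
      using K_RP[OF FL[of "r i"]] AE_sq_int_slice'
    proof eventually_elim
      case (elim x)
      have "R (\<lambda>z. P (F (r i)) z - H z) x = R (P (F (r i))) x - R H x"
        using sq_int_mult_integrable[OF PF elim(2)] sq_int_mult_integrable[OF H elim(2)]
        by (simp add: kernel_integral_def left_diff_distrib)
      with elim(1) show ?case by simp
    qed
    then have "(LINT x|M. (K (F (r i)) x - ?g x)\<^sup>2) = (LINT x|M. (R (\<lambda>z. P (F (r i)) z - H z) x)\<^sup>2)"
      by (intro integral_cong_AE borel_measurable_power borel_measurable_diff
        sq_int_measurable[OF KF] sq_int_measurable[OF g] sq_int_measurable[OF sq_int_R(1)[OF sq_int_diff[OF PF H]]])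
    then show ?thesis using sq_int_R(2)[OF sq_int_diff[OF PF H]] by simp
  qed
  have lim2: "(\<lambda>i. LINT x|M. (K (F (r i)) x - ?g x)\<^sup>2) \<longlonglongrightarrow> 0"
  proof (rule tendsto_sandwich[OF _ _ tendsto_const])
    show "(\<lambda>i. (LINT z|W. (P (F (r i)) z - H z)\<^sup>2) * T) \<longlonglongrightarrow> 0"
      using tendsto_mult[OF lim tendsto_const[of T]] by simp
  qed (use diff in auto)
  \<comment> \<open>By Cauchy--Schwarz against 1, the mean of the limit is controlled by its
    distance to the functions \<open>K (F (r i))\<close>, which have mean zero.\<close>
  have gz: "(LINT x|M. ?g x) = 0"
  proof -
    note s1 = sq_int_const[OF M.finite_measure_axioms, of 1]
    have "(LINT x|M. ?g x)\<^sup>2 \<le> measure M (space M) * (LINT x|M. (K (F (r i)) x - ?g x)\<^sup>2)" for i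
    proof -
      have "(LINT x|M. K (F (r i)) x - ?g x) = (LINT x|M. K (F (r i)) x) - (LINT x|M. ?g x)"
        by (intro Bochner_Integration.integral_diff sq_int_imp_integrable KF g M.finite_measure_axioms)
      then have "(LINT x|M. ?g x)\<^sup>2 = (LINT x|M. 1 * (K (F (r i)) x - ?g x))\<^sup>2"
        using K_mean_zero[OF FL] by simp
      also have "\<dots> \<le> (LINT x|M. 1\<^sup>2) * (LINT x|M. (K (F (r i)) x - ?g x)\<^sup>2)"
        by (rule sq_int_CS[OF s1 sq_int_diff[OF KF g]])
      finally show ?thesis by simp
    qed
    then have "(LINT x|M. ?g x)\<^sup>2 \<le> measure M (space M) * 0"
      by (intro LIMSEQ_le_const[OF tendsto_mult[OF tendsto_const lim2]]) auto
    then show ?thesis by simp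
  qed
  show "\<exists>g\<in>L2_zero M. \<exists>r. strict_mono r \<and> (\<lambda>i. L2_norm M (\<lambda>x. K (F (r i)) x - g x)) \<longlonglongrightarrow> 0"
  proof (intro bexI exI conjI)
    show "?g \<in> L2_zero M" using g gz by (simp add: L2_zero_iff)
    show "(\<lambda>i. L2_norm M (\<lambda>x. K (F (r i)) x - ?g x)) \<longlonglongrightarrow> 0"
      unfolding L2_norm_def using tendsto_real_sqrt[OF lim2] by simp
  qed (rule r(1))
qed

lemma sum_eigenvalues_le:
  assumes "finite I" and e: "\<And>i. i \<in> I \<Longrightarrow> e i \<in> L2_zero M"
    and o: "\<And>i j. i \<in> I \<Longrightarrow> j \<in> I \<Longrightarrow> (LINT x|M. e i x * e j x) = (if i = j then 1 else 0)"
    and ev: "\<And>i. i \<in> I \<Longrightarrow> AE x in M. K (e i) x = c i * e i x"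
  shows "(\<Sum>i\<in>I. \<bar>c i\<bar>) \<le> T"
proof -
  have es: "sq_int M (e i)" if "i \<in> I" for i using e[OF that] by (simp add: L2_zero_iff)
  \<comment> \<open>Pairing the eigenvalue equation with \<open>e i\<close> gives the squared norm
    of \<open>P (e i)\<close>; in particular \<open>c i\<close> is nonnegative and the absolute
    values disappear.\<close>
  have c: "c i = (LINT z|W. (P (e i) z)\<^sup>2)" if i: "i \<in> I" for i
  proof -
    have "c i = c i * (LINT x|M. e i x * e i x)" using o[OF i i] by simp
    also have "\<dots> = (LINT x|M. e i x * (c i * e i x))"
      by (simp add: mult_ac flip: integral_mult_right_zero)
    also have "\<dots> = (LINT x|M. e i x * K (e i) x)"
      using ev[OF i] es[OF i] K_measurable[OF e[OF i]] by (intro integral_cong_AE) (auto simp: sq_int_def)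
    also have "\<dots> = (LINT z|W. (P (e i) z)\<^sup>2)"
      using inner_K[OF e[OF i] es[OF i]] by (simp add: power2_eq_square)
    finally show ?thesis .
  qed
  have "(\<Sum>i\<in>I. \<bar>c i\<bar>) = (\<Sum>i\<in>I. LINT z|W. (P (e i) z)\<^sup>2)"
    using c by (intro sum.cong) auto
  also have "\<dots> = (LINT z|W. (\<Sum>i\<in>I. (P (e i) z)\<^sup>2))"
    by (intro Bochner_Integration.integral_sum[symmetric] sq_int_integrable sq_int_P es)
  \<comment> \<open>Bessel's inequality is applied for each \<open>z\<close> separately, to the
    slice of \<open>q\<close> at \<open>z\<close>.\<close>
  also have "\<dots> \<le> (LINT z|W. (LINT x|M. (q x z)\<^sup>2))"
  proof (rule integral_mono_AE[OF _ integrable_slice])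
    show "integrable W (\<lambda>z. \<Sum>i\<in>I. (P (e i) z)\<^sup>2)"
      by (intro Bochner_Integration.integrable_sum sq_int_integrable sq_int_P es)
    show "AE z in W. (\<Sum>i\<in>I. (P (e i) z)\<^sup>2) \<le> (LINT x|M. (q x z)\<^sup>2)"
      using AE_sq_int_slice
    proof eventually_elim
      case (elim z)
      from bessel[OF \<open>finite I\<close> es o elim] show ?case by (simp add: kernel_integral_def)
    qed
  qed
  finally show ?thesis by (simp add: T_def)
qed

lemma eigenvectors_orthogonal:
  assumes f: "f \<in> eigenspace M K c" and g: "g \<in> eigenspace M K d" and cd: "c \<noteq> d"
  shows "(LINT x|M. f x * g x) = 0"
proof -
  have fL: "f \<in> L2_zero M" and gL: "g \<in> L2_zero M" using f g by (auto simp: eigenspace_def)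
  then have fs: "sq_int M f" and gs: "sq_int M g" by (auto simp: L2_zero_iff)
  have "(LINT x|M. g x * K f x) = (LINT x|M. c * (f x * g x))"
    using f fs gs K_measurable[OF fL] by (intro integral_cong_AE) (auto simp: sq_int_def eigenspace_def)
  then have e1: "(LINT x|M. g x * K f x) = c * (LINT x|M. f x * g x)" by (metis integral_mult_right_zero)
  have "(LINT x|M. f x * K g x) = (LINT x|M. d * (f x * g x))"
    using g fs gs K_measurable[OF gL] by (intro integral_cong_AE) (auto simp: sq_int_def eigenspace_def)
  then have e2: "(LINT x|M. f x * K g x) = d * (LINT x|M. f x * g x)" by (metis integral_mult_right_zero)
  have e3: "(LINT x|M. g x * K f x) = (LINT x|M. f x * K g x)"
    using inner_K[OF fL gs] inner_K[OF gL fs] by (simp add: mult.commute)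
  from e1 e2 e3 have "c * (LINT x|M. f x * g x) = d * (LINT x|M. f x * g x)" by metis
  then have "(c - d) * (LINT x|M. f x * g x) = 0" unfolding left_diff_distrib by linarith
  with cd show ?thesis by simp
qed

text \<open>Linearity of \<open>K\<close> has to be derived and holds only up to null sets, because
  the integrals split only where the slices of \<open>q\<close> are square-integrable; hence the
  passage through \<open>P\<close> and \<open>R\<close>.\<close>

lemma K_linear_combination:
  assumes "finite F" "\<And>f. f \<in> F \<Longrightarrow> f \<in> eigenspace M K c"
  shows "(\<lambda>x. \<Sum>f\<in>F. a f * f x) \<in> eigenspace M K c"
proof -
  let ?h = "\<lambda>x. \<Sum>f\<in>F. a f * f x"
  have FL: "f \<in> L2_zero M" if "f \<in> F" for f using assms(2)[OF that] by (simp add: eigenspace_def)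
  have Fs: "sq_int M f" if "f \<in> F" for f using FL[OF that] by (simp add: L2_zero_iff)
  have hs: "sq_int M ?h" by (intro sq_int_sum sq_int_cmult Fs)
  have "(LINT x|M. ?h x) = (\<Sum>f\<in>F. LINT x|M. a f * f x)"
    by (intro Bochner_Integration.integral_sum integrable_mult_right sq_int_imp_integrable Fs M.finite_measure_axioms)
  also have "\<dots> = 0" using FL by (simp add: L2_zero_iff)
  finally have hL: "?h \<in> L2_zero M" using hs by (simp add: L2_zero_iff)
  have Pl: "AE z in W. P ?h z = (\<Sum>f\<in>F. a f * P f z)"
    using AE_sq_int_slice
  proof eventually_elim
    case (elim z)
    have "P ?h z = (LINT x|M. (\<Sum>f\<in>F. a f * (f x * q x z)))"
      by (simp add: kernel_integral_def sum_distrib_right mult.assoc)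
    also have "\<dots> = (\<Sum>f\<in>F. LINT x|M. a f * (f x * q x z))"
      by (intro Bochner_Integration.integral_sum integrable_mult_right sq_int_mult_integrable Fs elim)
    finally show ?case by (simp add: kernel_integral_def)
  qed
  have RP: "R (P ?h) x = R (\<lambda>z. \<Sum>f\<in>F. a f * P f z) x" if x: "x \<in> space M" for x
    unfolding kernel_integral_def[of W]
  proof (rule integral_cong_AE)
    have [measurable]: "?h \<in> borel_measurable M" using hs by (simp add: sq_int_def)
    have [measurable]: "f \<in> F \<Longrightarrow> f \<in> borel_measurable M" for f using Fs by (simp add: sq_int_def)
    have qm[measurable]: "(\<lambda>z. q x z) \<in> borel_measurable W" using x by measurable
    have "P ?h \<in> borel_measurable W" by (rule P_measurable) measurable
    then show "(\<lambda>z. P ?h z * q x z) \<in> borel_measurable W" by measurable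
    have "(\<lambda>z. \<Sum>f\<in>F. a f * P f z) \<in> borel_measurable W"
      by (intro borel_measurable_sum borel_measurable_times P_measurable) auto
    then show "(\<lambda>z. (\<Sum>f\<in>F. a f * P f z) * q x z) \<in> borel_measurable W" by measurable
    show "AE z in W. P ?h z * q x z = (\<Sum>f\<in>F. a f * P f z) * q x z"
      using Pl by eventually_elim simp
  qed
  have ae: "AE x in M. \<forall>f\<in>F. K f x = R (P f) x \<and> K f x = c * f x"
  proof (rule AE_finite_allI[OF assms(1)])
    fix f assume "f \<in> F"
    with K_RP[OF FL] assms(2)[of f] show "AE x in M. K f x = R (P f) x \<and> K f x = c * f x"
      by (auto simp: eigenspace_def)
  qed
  have "AE x in M. K ?h x = c * ?h x"
    using K_RP[OF hL] ae AE_sq_int_slice' AE_space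
  proof eventually_elim
    case (elim x)
    have "K ?h x = (LINT z|W. (\<Sum>f\<in>F. a f * (P f z * q x z)))"
      unfolding elim(1) RP[OF elim(4)] by (simp add: kernel_integral_def[of W] sum_distrib_right mult.assoc)
    also have "\<dots> = (\<Sum>f\<in>F. LINT z|W. a f * (P f z * q x z))"
      by (intro Bochner_Integration.integral_sum integrable_mult_right sq_int_mult_integrable sq_int_P Fs elim)
    also have "\<dots> = (\<Sum>f\<in>F. a f * R (P f) x)" by (simp add: kernel_integral_def[of W])
    also have "\<dots> = (\<Sum>f\<in>F. a f * (c * f x))" using elim(2) by (intro sum.cong) auto
    finally show ?case by (simp add: sum_distrib_left mult_ac)
  qed
  with hL show ?thesis by (simp add: eigenspace_def)
qed

theorem trace_class_K: "trace_class M K"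
proof -
  have main: "(\<Sum>c\<in>S. of_nat (card (\<phi> c)) * ennreal \<bar>c\<bar>) \<le> ennreal T"
    if S: "finite S" and \<phi>: "\<And>c. c \<in> S \<Longrightarrow> finite (\<phi> c) \<and> \<phi> c \<subseteq> eigenspace M K c \<and> lin_indep_AE M (\<phi> c)"
    for S \<phi>
  proof -
    have "\<forall>c\<in>S. \<exists>e. \<forall>i<card (\<phi> c). e i \<in> eigenspace M K c \<and>
      (\<forall>j<card (\<phi> c). (LINT x|M. e i x * e j x) = (if i = j then 1 else 0))"
    proof
      fix c assume c: "c \<in> S"
      have sq: "sq_int M f" if "f \<in> \<phi> c" for f
        using \<phi>[OF c] that by (auto simp: eigenspace_def L2_zero_iff)
      from gram_schmidt_AE[of "\<phi> c" M, OF _ sq] \<phi>[OF c] obtain e a where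
        ea: "\<forall>i<card (\<phi> c). (\<forall>x. e i x = (\<Sum>f\<in>\<phi> c. a i f * f x)) \<and>
          (\<forall>j<card (\<phi> c). (LINT x|M. e i x * e j x) = (if i = j then 1 else 0))" by blast
      have "e i \<in> eigenspace M K c" if "i < card (\<phi> c)" for i
      proof -
        have "e i = (\<lambda>x. \<Sum>f\<in>\<phi> c. a i f * f x)" using ea that by auto
        then show ?thesis using K_linear_combination[of "\<phi> c" c "a i"] \<phi>[OF c] by auto
      qed
      with ea show "\<exists>e. \<forall>i<card (\<phi> c). e i \<in> eigenspace M K c \<and>
        (\<forall>j<card (\<phi> c). (LINT x|M. e i x * e j x) = (if i = j then 1 else 0))" by blast
    qed
    then obtain e where e: "\<And>c i. c \<in> S \<Longrightarrow> i < card (\<phi> c) \<Longrightarrow> e c i \<in> eigenspace M K c"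
      "\<And>c i j. c \<in> S \<Longrightarrow> i < card (\<phi> c) \<Longrightarrow> j < card (\<phi> c) \<Longrightarrow>
        (LINT x|M. e c i x * e c j x) = (if i = j then 1 else 0)"
      by (auto dest!: bchoice)
    \<comment> \<open>Pairs of an eigenvalue and the number of a basis function. Eigenspaces of
      distinct eigenvalues are orthogonal, so the combined family is orthonormal.\<close>
    define I where "I = Sigma S (\<lambda>c. {..<card (\<phi> c)})"
    have "(\<Sum>k\<in>I. \<bar>fst k\<bar>) \<le> T"
    proof (rule sum_eigenvalues_le[where e="\<lambda>(c, i). e c i"])
      show "finite I" using S by (auto simp: I_def)
      show "(case k of (c, i) \<Rightarrow> e c i) \<in> L2_zero M" if "k \<in> I" for k
        using that e(1) by (auto simp: I_def eigenspace_def)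
      show "AE x in M. K (case k of (c, i) \<Rightarrow> e c i) x = fst k * (case k of (c, i) \<Rightarrow> e c i) x" if "k \<in> I" for k
        using that e(1) by (auto simp: I_def eigenspace_def)
      show "(LINT x|M. (case k of (c, i) \<Rightarrow> e c i) x * (case l of (c, i) \<Rightarrow> e c i) x) = (if k = l then 1 else 0)"
        if "k \<in> I" "l \<in> I" for k l
      proof -
        obtain c i d j where kl: "k = (c, i)" "l = (d, j)" by (cases k, cases l)
        show ?thesis
        proof (cases "c = d")
          case True
          then show ?thesis using e(2)[of c i j] that by (simp add: kl I_def)
        next
          case False
          then show ?thesis
            using eigenvectors_orthogonal[of "e c i" c "e d j" d] e(1)[of c i] e(1)[of d j] that
            by (simp add: kl I_def)
        qed
      qed
    qed
    moreover have "(\<Sum>k\<in>I. \<bar>fst k\<bar>) = (\<Sum>c\<in>S. real (card (\<phi> c)) * \<bar>c\<bar>)"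
      unfolding I_def using S sum.Sigma[of S "\<lambda>c. {..<card (\<phi> c)}" "\<lambda>c i. \<bar>c\<bar>"]
      by (simp add: case_prod_beta')
    ultimately have "ennreal (\<Sum>c\<in>S. real (card (\<phi> c)) * \<bar>c\<bar>) \<le> ennreal T"
      by (intro ennreal_leI) simp
    then show ?thesis
      by (simp add: ennreal_mult ennreal_of_nat_eq_real_of_nat flip: sum_ennreal)
  qed
  have "(\<Sum>c\<in>S. eigen_multiplicity M K c * ennreal \<bar>c\<bar>) \<le> ennreal T" if S: "finite S" for S
  proof -
    let ?A = "\<lambda>c. {F. finite F \<and> F \<subseteq> eigenspace M K c \<and> lin_indep_AE M F}"
    have "(\<Sum>c\<in>S. SUP F\<in>?A c. of_nat (card F) * ennreal \<bar>c\<bar>) + 0 \<le> ennreal T"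
    proof (rule sum_SUP_ennreal_le[OF S])
      show "?A c \<noteq> {}" for c
        using finite.emptyI by (auto simp: lin_indep_AE_def intro!: exI[of _ "{}"])
      show "(\<Sum>c\<in>S. of_nat (card (\<phi> c)) * ennreal \<bar>c\<bar>) + 0 \<le> ennreal T"
        if "\<And>c. c \<in> S \<Longrightarrow> \<phi> c \<in> ?A c" for \<phi>
        using main[OF S, of \<phi>] that by simp
    qed
    moreover have "(SUP F\<in>?A c. of_nat (card F) * ennreal \<bar>c\<bar>) = eigen_multiplicity M K c * ennreal \<bar>c\<bar>" for c
      unfolding eigen_multiplicity_def by (rule SUP_mult_right_ennreal[symmetric])
    ultimately show ?thesis by simp
  qed
  then have "(\<Sum>\<^sub>\<infinity>c\<in>eigenvalues M K. eigen_multiplicity M K c * ennreal \<bar>c\<bar>) \<le> ennreal T"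
    by (subst nonneg_infsum_complete) (auto intro!: SUP_least)
  also have "\<dots> < \<infinity>" by simp
  finally show ?thesis using compact_K by (simp add: trace_class_def)
qed

end

section \<open>Gaussian integrals over matrices\<close>

text \<open>On each line parallel to \<open>b\<close> the shift \<open>\<phi>\<close> is constant,
  so the substitution is a translation there; the other coordinates are integrated outside.\<close>

lemma nn_integral_lborel_shear1:
  fixes b :: "'a::euclidean_space" and f :: "'a \<Rightarrow> ennreal"
  assumes b: "b \<in> Basis" and [measurable]: "\<phi> \<in> borel_measurable borel" "f \<in> borel_measurable borel"
    and inv: "\<And>x t. \<phi> (x + t *\<^sub>R b) = \<phi> x"
  shows "(\<integral>\<^sup>+x. f (x + \<phi> x *\<^sub>R b) \<partial>lborel) = (\<integral>\<^sup>+x. f x \<partial>lborel)"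
proof -
  interpret product_sigma_finite "\<lambda>_::'a. lborel :: real measure" ..
  define B where "B = Basis - {b}"
  have B: "finite B" "b \<notin> B" "Basis = insert b B" using b by (auto simp: B_def)
  define e where "e s = (\<Sum>c\<in>Basis. s c *\<^sub>R c)" for s :: "'a \<Rightarrow> real"
  define w where "w s = (\<Sum>c\<in>B. s c *\<^sub>R c)" for s :: "'a \<Rightarrow> real"
  have [measurable]: "e \<in> borel_measurable (Pi\<^sub>M (insert b B) (\<lambda>_. lborel))"
    unfolding e_def B(3) by measurable
  have ew: "e (s(b := y)) = w s + y *\<^sub>R b" for s y
  proof -
    have "e (s(b := y)) = y *\<^sub>R b + (\<Sum>c\<in>B. (s(b := y)) c *\<^sub>R c)"
      unfolding e_def B(3) using B(1,2) by simp
    also have "(\<Sum>c\<in>B. (s(b := y)) c *\<^sub>R c) = w s"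
      unfolding w_def using B(2) by (intro sum.cong) auto
    finally show ?thesis by (simp add: fun_upd_def add.commute)
  qed
  have split: "(\<integral>\<^sup>+x. g x \<partial>lborel) = (\<integral>\<^sup>+s. \<integral>\<^sup>+y. g (w s + y *\<^sub>R b) \<partial>lborel \<partial>Pi\<^sub>M B (\<lambda>_. lborel))"
    if [measurable]: "g \<in> borel_measurable borel" for g :: "'a \<Rightarrow> ennreal"
  proof -
    have "(\<integral>\<^sup>+x. g x \<partial>lborel) = (\<integral>\<^sup>+s. g (e s) \<partial>Pi\<^sub>M (insert b B) (\<lambda>_. lborel))"
      by (subst lborel_eq, subst nn_integral_distr) (auto simp: e_def B(3)[symmetric] space_PiM)
    also have "\<dots> = (\<integral>\<^sup>+s. \<integral>\<^sup>+y. g (e (s(b := y))) \<partial>lborel \<partial>Pi\<^sub>M B (\<lambda>_. lborel))"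
      by (rule product_nn_integral_insert[OF B(1,2)]) measurable
    finally show ?thesis by (simp add: ew)
  qed
  have "(\<integral>\<^sup>+x. f (x + \<phi> x *\<^sub>R b) \<partial>lborel) =
      (\<integral>\<^sup>+s. \<integral>\<^sup>+y. f (w s + (\<phi> (w s) + 1 * y) *\<^sub>R b) \<partial>lborel \<partial>Pi\<^sub>M B (\<lambda>_. lborel))"
    by (subst split) (auto simp: inv algebra_simps)
  also have "\<dots> = (\<integral>\<^sup>+s. \<integral>\<^sup>+y. f (w s + y *\<^sub>R b) \<partial>lborel \<partial>Pi\<^sub>M B (\<lambda>_. lborel))"
  proof (rule nn_integral_cong)
    fix s :: "'a \<Rightarrow> real"
    have [measurable]: "(\<lambda>y. f (w s + y *\<^sub>R b)) \<in> borel_measurable borel" by measurable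
    show "(\<integral>\<^sup>+y. f (w s + (\<phi> (w s) + 1 * y) *\<^sub>R b) \<partial>lborel) = (\<integral>\<^sup>+y. f (w s + y *\<^sub>R b) \<partial>lborel)"
      using nn_integral_real_affine[of "\<lambda>y. f (w s + y *\<^sub>R b)" 1 "\<phi> (w s)"] by simp
  qed
  also have "\<dots> = (\<integral>\<^sup>+x. f x \<partial>lborel)" by (rule split[symmetric]) measurable
  finally show ?thesis .
qed

text \<open>Each coefficient is constant along all directions of \<open>D\<close>, so one shear does
  not disturb the coefficients of the others and the simultaneous shift is a composition of single
  shears.\<close>

lemma nn_integral_lborel_shear:
  fixes f :: "'a::euclidean_space \<Rightarrow> ennreal"
  assumes "finite D" "D \<subseteq> Basis" and \<phi>: "\<And>b. b \<in> D \<Longrightarrow> \<phi> b \<in> borel_measurable borel"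
    and f: "f \<in> borel_measurable borel"
    and inv: "\<And>b c x t. b \<in> D \<Longrightarrow> c \<in> D \<Longrightarrow> \<phi> b (x + t *\<^sub>R c) = \<phi> b x"
  shows "(\<integral>\<^sup>+x. f (x + (\<Sum>b\<in>D. \<phi> b x *\<^sub>R b)) \<partial>lborel) = (\<integral>\<^sup>+x. f x \<partial>lborel)"
  using assms
proof (induction D arbitrary: f rule: finite_induct)
  case empty
  then show ?case by simp
next
  case (insert d D)
  note [measurable] = insert.prems(3)
  have [measurable]: "\<phi> d \<in> borel_measurable borel" using insert.prems(2) by simp
  have inv_sum: "\<phi> d (x + (\<Sum>b\<in>D'. g b *\<^sub>R b)) = \<phi> d x" if "finite D'" "D' \<subseteq> D" for D' g x
    using that
  proof (induction D' arbitrary: x rule: finite_induct)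
    case (insert c D')
    then have "c \<in> D" by simp
    have "\<phi> d (x + (\<Sum>b\<in>insert c D'. g b *\<^sub>R b)) = \<phi> d ((x + g c *\<^sub>R c) + (\<Sum>b\<in>D'. g b *\<^sub>R b))"
      using insert.hyps by (simp add: add.assoc)
    also have "\<dots> = \<phi> d (x + g c *\<^sub>R c)" using insert by blast
    also have "\<dots> = \<phi> d x" by (rule \<open>\<And>b c x t. b \<in> insert d D \<Longrightarrow> c \<in> insert d D \<Longrightarrow> \<phi> b (x + t *\<^sub>R c) = \<phi> b x\<close>) (use \<open>c \<in> D\<close> in auto)
    finally show ?case .
  qed simp
  have "(\<integral>\<^sup>+x. f (x + (\<Sum>b\<in>insert d D. \<phi> b x *\<^sub>R b)) \<partial>lborel)
      = (\<integral>\<^sup>+x. f ((x + (\<Sum>b\<in>D. \<phi> b x *\<^sub>R b)) + \<phi> d (x + (\<Sum>b\<in>D. \<phi> b x *\<^sub>R b)) *\<^sub>R d) \<partial>lborel)"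
    using insert.hyps by (simp add: inv_sum ac_simps)
  also have "\<dots> = (\<integral>\<^sup>+x. f (x + \<phi> d x *\<^sub>R d) \<partial>lborel)"
    by (rule insert.IH) (use insert.prems in auto)
  also have "\<dots> = (\<integral>\<^sup>+x. f x \<partial>lborel)"
    by (rule nn_integral_lborel_shear1) (use insert.prems in auto)
  finally show ?case .
qed

section \<open>Shear matrices and symmetric elimination\<close>

definition shear_mat :: "'n \<Rightarrow> real^'n \<Rightarrow> real^'n^'n" where
  "shear_mat k r = (\<chi> i j. (if i = j then 1 else 0) + (if i = k then r $ j else 0))"

lemma inner_transpose_mult:
  fixes A :: "real^'n^'m"
  shows "v \<bullet> (transpose A *v w) = (A *v v) \<bullet> w"
  unfolding transpose_matrix_vector by (metis dot_lmul_matrix inner_commute)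

text \<open>\<open>shear_mat k r\<close> is the identity with \<open>r\<close> added to row
  \<open>k\<close>. When \<open>r $ k = 0\<close>, what is added is a combination of the other rows,
  and the determinant does not change.\<close>

lemma det_shear_mat:
  fixes r :: "real^'n"
  assumes "r $ k = 0" shows "det (shear_mat k r) = 1"
proof -
  let ?I = "mat 1 :: real^'n^'n"
  have "r = (\<Sum>j\<in>UNIV. r $ j *\<^sub>R axis j 1)"
    by (subst basis_expansion[symmetric]) (simp add: scalar_mult_eq_scaleR)
  also have "\<dots> = (\<Sum>j\<in>UNIV - {k}. r $ j *\<^sub>R axis j 1)"
    using assms by (intro sum.mono_neutral_right) auto
  also have "\<dots> \<in> vec.span {row j ?I |j. j \<noteq> k}"
  proof (rule vec.span_sum)
    fix j assume "j \<in> UNIV - {k}"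
    moreover have "row j ?I = axis j 1" by (simp add: row_def mat_def axis_def vec_eq_iff)
    ultimately have "r $ j *s axis j 1 \<in> vec.span {row j ?I |j. j \<noteq> k}"
      by (intro vec.span_scale vec.span_base) (auto intro: exI[of _ j])
    then show "r $ j *\<^sub>R axis j 1 \<in> vec.span {row j ?I |j. j \<noteq> k}" by (simp add: scalar_mult_eq_scaleR)
  qed
  finally have "det (\<chi> i. if i = k then row k ?I + r else row i ?I) = det ?I"
    by (rule det_row_span[where A="?I" and i=k])
  moreover have "(\<chi> i. if i = k then row k ?I + r else row i ?I) = shear_mat k r"
    by (auto simp: shear_mat_def row_def mat_def vec_eq_iff)
  ultimately show ?thesis by simp
qed

lemma shear_mat_mult:
  fixes A :: "real^'m^'n"
  shows "(shear_mat k r ** A) $ i $ j = A $ i $ j + (if i = k then (\<Sum>l\<in>UNIV. r $ l * A $ l $ j) else 0)"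
  by (simp add: shear_mat_def matrix_matrix_mult_def distrib_right sum.distrib if_distrib[of "\<lambda>x. x * _"] cong: if_cong)

lemma mult_shear_mat:
  fixes A :: "real^'n^'m"
  shows "(A ** shear_mat k r) $ i $ j = A $ i $ j + A $ i $ k * r $ j"
  by (simp add: shear_mat_def matrix_matrix_mult_def distrib_left sum.distrib if_distrib[of "\<lambda>x. _ * x"] cong: if_cong)

lemma axis_axis_nth: "axis i (axis j (1::real)) $ a $ b = (if a = i \<and> b = j then 1 else 0)"
  by (auto simp: axis_def)

text \<open>Left multiplication shifts only row \<open>k\<close>, by a combination of rows in which
  row \<open>k\<close> itself has coefficient 0; the coordinate directions of that row therefore
  satisfy the invariance required of a shear.\<close>

lemma nn_integral_shear_mat_left:
  fixes f :: "real^'d^'p \<Rightarrow> ennreal"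
  assumes r: "r $ k = 0" and [measurable]: "f \<in> borel_measurable borel"
  shows "(\<integral>\<^sup>+\<beta>. f (shear_mat k r ** \<beta>) \<partial>lborel) = (\<integral>\<^sup>+\<beta>. f \<beta> \<partial>lborel)"
proof -
  let ?D = "range (\<lambda>j::'d. axis k (axis j (1::real))) :: (real^'d^'p) set"
  define \<phi> where "\<phi> b \<beta> = (\<Sum>l\<in>UNIV. r $ l *\<^sub>R \<beta> $ l) \<bullet> (b $ k)" for b \<beta> :: "real^'d^'p"
  have inj: "inj (\<lambda>j::'d. axis k (axis j (1::real)) :: real^'d^'p)"
    by (auto simp: inj_on_def axis_eq_axis)
  have eq: "shear_mat k r ** \<beta> = \<beta> + (\<Sum>b\<in>?D. \<phi> b \<beta> *\<^sub>R b)" for \<beta> :: "real^'d^'p"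
  proof -
    have "(\<Sum>b\<in>?D. \<phi> b \<beta> *\<^sub>R b) $ a $ c = (if a = k then (\<Sum>l\<in>UNIV. r $ l * \<beta> $ l $ c) else 0)" for a c
    proof -
      have "(\<Sum>b\<in>?D. \<phi> b \<beta> *\<^sub>R b) $ a $ c = (\<Sum>j\<in>UNIV. \<phi> (axis k (axis j 1)) \<beta> * (if a = k \<and> c = j then 1 else 0))"
        by (subst sum.reindex[OF inj]) (auto simp: axis_axis_nth o_def intro!: sum.cong)
      also have "\<dots> = (if a = k then \<phi> (axis k (axis c 1)) \<beta> else 0)"
        by (cases "a = k") (simp_all add: if_distrib[of "\<lambda>x. _ * x"] cong: if_cong)
      also have "\<phi> (axis k (axis c 1)) \<beta> = (\<Sum>l\<in>UNIV. r $ l * \<beta> $ l $ c)"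
        by (simp add: \<phi>_def inner_axis)
      finally show ?thesis .
    qed
    then show ?thesis by (simp add: vec_eq_iff shear_mat_mult)
  qed
  have "(\<integral>\<^sup>+\<beta>. f (\<beta> + (\<Sum>b\<in>?D. \<phi> b \<beta> *\<^sub>R b)) \<partial>lborel) = (\<integral>\<^sup>+\<beta>. f \<beta> \<partial>lborel)"
  proof (rule nn_integral_lborel_shear)
    show "?D \<subseteq> Basis" by (auto simp: Basis_vec_def)
    show "\<phi> b \<in> borel_measurable borel" for b
      unfolding \<phi>_def[abs_def] by (intro borel_measurable_continuous_onI continuous_intros)
    show "\<phi> b (x + t *\<^sub>R c) = \<phi> b x" if "c \<in> ?D" for b c x t
    proof -
      from that obtain j where c: "c = axis k (axis j 1)" by auto
      have "r $ l *\<^sub>R (x + t *\<^sub>R c) $ l = r $ l *\<^sub>R x $ l" for l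
        using r by (cases "l = k") (auto simp: c axis_def)
      then show ?thesis by (simp only: \<phi>_def)
    qed
  qed auto
  then show ?thesis by (simp only: eq)
qed

text \<open>The same with columns: because of the transpose, column \<open>k\<close> is the only one
  that is shifted, by a combination of the others.\<close>

lemma nn_integral_shear_mat_right:
  fixes f :: "real^'d^'p \<Rightarrow> ennreal"
  assumes r: "r $ k = 0" and [measurable]: "f \<in> borel_measurable borel"
  shows "(\<integral>\<^sup>+\<beta>. f (\<beta> ** transpose (shear_mat k r)) \<partial>lborel) = (\<integral>\<^sup>+\<beta>. f \<beta> \<partial>lborel)"
proof -
  let ?D = "range (\<lambda>i::'p. axis i (axis k (1::real))) :: (real^'d^'p) set"
  define \<phi> where "\<phi> b \<beta> = (\<Sum>i\<in>UNIV. (r \<bullet> \<beta> $ i) * (b $ i $ k))" for b \<beta> :: "real^'d^'p"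
  have inj: "inj (\<lambda>i::'p. axis i (axis k (1::real)) :: real^'d^'p)"
    by (auto simp: inj_on_def axis_eq_axis)
  have eq: "\<beta> ** transpose (shear_mat k r) = \<beta> + (\<Sum>b\<in>?D. \<phi> b \<beta> *\<^sub>R b)" for \<beta> :: "real^'d^'p"
  proof -
    have "(\<Sum>b\<in>?D. \<phi> b \<beta> *\<^sub>R b) $ a $ c = (if c = k then r \<bullet> \<beta> $ a else 0)" for a c
    proof -
      have "(\<Sum>b\<in>?D. \<phi> b \<beta> *\<^sub>R b) $ a $ c = (\<Sum>i\<in>UNIV. \<phi> (axis i (axis k 1)) \<beta> * (if a = i \<and> c = k then 1 else 0))"
        by (subst sum.reindex[OF inj]) (auto simp: axis_axis_nth o_def intro!: sum.cong)
      also have "\<dots> = (if c = k then \<phi> (axis a (axis k 1)) \<beta> else 0)"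
        by (cases "c = k") (simp_all add: if_distrib[of "\<lambda>x. _ * x"] cong: if_cong)
      also have "\<phi> (axis a (axis k 1)) \<beta> = r \<bullet> \<beta> $ a"
        by (simp add: \<phi>_def axis_axis_nth if_distrib[of "\<lambda>x. _ * x"] cong: if_cong)
      finally show ?thesis .
    qed
    moreover have "(\<beta> ** transpose (shear_mat k r)) $ a $ c = \<beta> $ a $ c + (if c = k then r \<bullet> \<beta> $ a else 0)" for a c
      by (simp add: shear_mat_def matrix_matrix_mult_def transpose_def distrib_left sum.distrib inner_vec_def
            if_distrib[of "\<lambda>x. _ * x"] mult.commute cong: if_cong)
    ultimately show ?thesis by (simp add: vec_eq_iff)
  qed
  have "(\<integral>\<^sup>+\<beta>. f (\<beta> + (\<Sum>b\<in>?D. \<phi> b \<beta> *\<^sub>R b)) \<partial>lborel) = (\<integral>\<^sup>+\<beta>. f \<beta> \<partial>lborel)"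
  proof (rule nn_integral_lborel_shear)
    show "?D \<subseteq> Basis" by (auto simp: Basis_vec_def)
    show "\<phi> b \<in> borel_measurable borel" for b
      unfolding \<phi>_def[abs_def] by (intro borel_measurable_continuous_onI continuous_intros)
    show "\<phi> b (x + t *\<^sub>R c) = \<phi> b x" if "c \<in> ?D" for b c x t
    proof -
      from that obtain j where c: "c = axis j (axis k 1)" by auto
      have "r \<bullet> (x + t *\<^sub>R c) $ l = r \<bullet> x $ l" for l
      proof -
        have "c $ l = (if l = j then axis k 1 else 0)" by (simp add: c axis_def)
        then show ?thesis using r by (simp add: inner_add_right inner_axis)
      qed
      then show ?thesis by (simp only: \<phi>_def)
    qed
  qed auto
  then show ?thesis by (simp only: eq)
qed

lemma pos_def_diag_pos: assumes "pos_def P" shows "P $ i $ i > 0"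
proof -
  have "axis i 1 \<bullet> (P *v axis i 1) > 0"
    using assms by (simp add: pos_def_def axis_eq_0_iff)
  then show ?thesis by (simp add: inner_axis' matrix_vector_mult_basis column_def)
qed

text \<open>Symmetric Gaussian elimination: clearing one row and column at a time by congruence with a shear,
  which changes neither determinants nor Lebesgue measure, reduces a positive definite matrix to a diagonal one.\<close>

lemma pos_def_shear_induct:
  fixes P :: "real^'n^'n"
  assumes P: "pos_def P"
    and diag: "\<And>P. pos_def P \<Longrightarrow> (\<And>i j. i \<noteq> j \<Longrightarrow> P $ i $ j = 0) \<Longrightarrow> Q P"
    and step: "\<And>P k r. pos_def P \<Longrightarrow> r $ k = 0 \<Longrightarrow>
      Q (transpose (shear_mat k r) ** P ** shear_mat k r) \<Longrightarrow> Q P"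
  shows "Q P"
proof -
  \<comment> \<open>\<open>U\<close> holds the indices whose rows may still have off-diagonal
    entries.\<close>
  have "\<forall>P. pos_def P \<longrightarrow> (\<forall>i j. i \<notin> U \<longrightarrow> i \<noteq> j \<longrightarrow> P $ i $ j = 0) \<longrightarrow> Q P" if "finite U" for U
    using that
  proof (induction U rule: finite_induct)
    case empty
    then show ?case using diag by auto
  next
    case (insert k U)
    show ?case
    proof (intro allI impI)
      fix P :: "real^'n^'n" assume P: "pos_def P" and cl: "\<forall>i j. i \<notin> insert k U \<longrightarrow> i \<noteq> j \<longrightarrow> P $ i $ j = 0"
      have sym: "P $ i $ j = P $ j $ i" for i j
        using P unfolding pos_def_def by (metis transpose_def vec_lambda_beta)
      have "axis k 1 \<bullet> (P *v axis k 1) > 0"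
        using P by (simp add: pos_def_def axis_eq_0_iff)
      then have pk: "P $ k $ k > 0"
        by (simp add: inner_axis' matrix_vector_mult_basis column_def)
      \<comment> \<open>\<open>r\<close> solves \<open>P $ k $ j + P $ k $ k * r $ j = 0\<close> for
        \<open>j\<close> different from \<open>k\<close>; the pivot is positive. Rows that are
        already cleared have \<open>r\<close> equal to 0 there and stay cleared.\<close>
      define r where "r = (\<chi> j. if j = k then 0 else - P $ k $ j / P $ k $ k)"
      have rk: "r $ k = 0" by (simp add: r_def)
      let ?E = "shear_mat k r"
      let ?P = "transpose ?E ** P ** ?E"
      have entry: "?P $ i $ j = P $ i $ j + P $ k $ j * r $ i + (P $ i $ k + P $ k $ k * r $ i) * r $ j" for i j
      proof -
        have "(transpose ?E ** P) $ i $ j = P $ i $ j + P $ k $ j * r $ i" for i j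
          using mult_shear_mat[of "transpose P" k r j i]
          by (metis (no_types, lifting) matrix_transpose_mul sym transpose_def transpose_transpose vec_lambda_beta)
        then show ?thesis by (simp add: mult_shear_mat)
      qed
      have inj: "?E *v v \<noteq> 0" if "v \<noteq> 0" for v
        using det_shear_mat[OF rk] that by (metis invertible_det_nz invertible_def matrix_vector_mul_assoc
          matrix_vector_mul_lid matrix_vector_mult_0_right zero_neq_one)
      have pos: "pos_def ?P"
        unfolding pos_def_def
      proof (intro conjI allI impI)
        show "transpose ?P = ?P" using P by (simp add: matrix_transpose_mul matrix_mul_assoc pos_def_def)
        fix v :: "real^'n" assume "v \<noteq> 0"
        have "v \<bullet> (?P *v v) = (?E *v v) \<bullet> (P *v (?E *v v))"
          by (simp add: matrix_vector_mul_assoc[symmetric] inner_transpose_mult del: transpose_matrix_vector)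
        then show "v \<bullet> (?P *v v) > 0" using P inj[OF \<open>v \<noteq> 0\<close>] by (simp add: pos_def_def)
      qed
      have "Q ?P"
      proof (rule insert.IH[rule_format, OF pos])
        fix i j assume ij: "i \<notin> U" "i \<noteq> j"
        show "?P $ i $ j = 0"
        proof (cases "i = k")
          case True
          then show ?thesis unfolding entry using ij pk by (simp add: r_def sym)
        next
          case False
          then have "P $ i $ j = 0" "P $ i $ k = 0" using cl ij by auto
          then show ?thesis unfolding entry using sym[of i k] False by (simp add: r_def)
        qed
      qed
      then show "Q P" by (rule step[OF P rk])
    qed
  qed
  from this[of UNIV] P show ?thesis by simp
qed

section \<open>Gaussian integrals of positive definite forms\<close>

lemma nn_integral_gaussian_real:
  assumes c: "c > 0"
  shows "(\<integral>\<^sup>+x. ennreal (exp (- (c / 2) * x\<^sup>2)) \<partial>lborel) = ennreal (sqrt (2 * pi / c))"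
proof -
  define \<sigma> where "\<sigma> = sqrt (1 / c)"
  have \<sigma>: "\<sigma> > 0" "\<sigma>\<^sup>2 = 1 / c" using c by (auto simp: \<sigma>_def)
  have eq: "exp (- (c / 2) * x\<^sup>2) = sqrt (2 * pi / c) * normal_density 0 \<sigma> x" for x
    using c by (simp add: normal_density_def \<sigma>(2) field_simps)
  have "(\<integral>\<^sup>+x. ennreal (exp (- (c / 2) * x\<^sup>2)) \<partial>lborel) = ennreal (sqrt (2 * pi / c)) * (\<integral>\<^sup>+x. ennreal (normal_density 0 \<sigma> x) \<partial>lborel)"
    unfolding eq using c by (subst nn_integral_cmult[symmetric]) (auto simp: ennreal_mult)
  also have "(\<integral>\<^sup>+x. ennreal (normal_density 0 \<sigma> x) \<partial>lborel) = 1"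
    using \<sigma>(1) by (subst nn_integral_eq_integral) auto
  finally show ?thesis by simp
qed

lemma trace_diagonal_form:
  fixes P :: "real^'p^'p" and B :: "real^'d^'d" and \<beta> :: "real^'d^'p"
  assumes P: "\<And>i j. i \<noteq> j \<Longrightarrow> P $ i $ j = 0" and B: "\<And>i j. i \<noteq> j \<Longrightarrow> B $ i $ j = 0"
  shows "trace (P ** \<beta> ** B ** transpose \<beta>) = (\<Sum>i\<in>UNIV. \<Sum>j\<in>UNIV. P $ i $ i * B $ j $ j * (\<beta> $ i $ j)\<^sup>2)"
proof -
  have 1: "(P ** \<beta>) $ i $ l = P $ i $ i * \<beta> $ i $ l" for i l
  proof -
    have "(P ** \<beta>) $ i $ l = (\<Sum>k\<in>UNIV. if k = i then P $ i $ k * \<beta> $ k $ l else 0)"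
      unfolding matrix_matrix_mult_def vec_lambda_beta using P by (intro sum.cong) auto
    then show ?thesis by simp
  qed
  have 2: "(P ** \<beta> ** B) $ i $ j = P $ i $ i * \<beta> $ i $ j * B $ j $ j" for i j
  proof -
    have "(P ** \<beta> ** B) $ i $ j = (\<Sum>l\<in>UNIV. if l = j then (P ** \<beta>) $ i $ l * B $ l $ j else 0)"
      unfolding matrix_matrix_mult_def[of "P ** \<beta>"] vec_lambda_beta using B by (intro sum.cong) auto
    then show ?thesis by (simp add: 1)
  qed
  show ?thesis
    unfolding trace_def
    by (intro sum.cong refl) (simp add: matrix_matrix_mult_def[of "P ** \<beta> ** B"] 2 transpose_def power2_eq_square mult_ac)
qed

lemma Basis_matrix_prod:
  fixes g :: "real^'d^'p \<Rightarrow> 'c::comm_monoid_mult"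
  shows "(\<Prod>b\<in>Basis. g b) = (\<Prod>i\<in>UNIV. \<Prod>j\<in>UNIV. g (axis i (axis j 1)))"
proof -
  have B: "Basis = (\<lambda>(i, j). axis i (axis j (1::real)) :: real^'d^'p) ` (UNIV \<times> UNIV)"
    by (auto simp: Basis_vec_def image_iff)
  have inj: "inj_on (\<lambda>(i, j). axis i (axis j (1::real)) :: real^'d^'p) (UNIV \<times> UNIV)"
    by (auto simp: inj_on_def axis_eq_axis)
  show ?thesis
    unfolding B by (subst prod.reindex[OF inj]) (simp add: prod.cartesian_product case_prod_beta' o_def)
qed

lemma nn_integral_matrix_gaussian_diag:
  fixes P :: "real^'p^'p" and B :: "real^'d^'d"
  assumes P: "\<And>i j. i \<noteq> j \<Longrightarrow> P $ i $ j = 0" and B: "\<And>i j. i \<noteq> j \<Longrightarrow> B $ i $ j = 0"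
    and Pp: "\<And>i. P $ i $ i > 0" and Bp: "\<And>j. B $ j $ j > 0"
  shows "(\<integral>\<^sup>+\<beta>. ennreal (exp (- (1 / 2) * trace (P ** \<beta> ** B ** transpose \<beta>))) \<partial>lborel)
     = ennreal (\<Prod>i\<in>UNIV. \<Prod>j\<in>UNIV. sqrt (2 * pi / (P $ i $ i * B $ j $ j)))"
proof -
  \<comment> \<open>The coefficient of a coordinate is written as a linear function of its basis
    matrix, so that it can be evaluated on \<open>Basis\<close> without recovering the pair of
    indices.\<close>
  define c where "c b = (\<Sum>i\<in>UNIV. \<Sum>j\<in>UNIV. P $ i $ i * B $ j $ j * b $ i $ j)" for b :: "real^'d^'p"
  have c: "c (axis i (axis j 1)) = P $ i $ i * B $ j $ j" for i j
  proof -
    have "c (axis i (axis j 1)) = (\<Sum>i'\<in>UNIV. \<Sum>j'\<in>UNIV. if i' = i then (if j' = j then P $ i' $ i' * B $ j' $ j' else 0) else 0)"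
      unfolding c_def by (intro sum.cong) (auto simp: axis_axis_nth)
    also have "\<dots> = (\<Sum>i'\<in>UNIV. if i' = i then P $ i' $ i' * B $ j $ j else 0)"
      by (intro sum.cong) auto
    finally show ?thesis by simp
  qed
  have cp: "c b > 0" if "b \<in> Basis" for b
    using that Pp Bp by (auto simp: Basis_vec_def c)
  define f where "f b x = exp (- (c b / 2) * x\<^sup>2)" for b :: "real^'d^'p" and x :: real
  have "ennreal (exp (- (1 / 2) * trace (P ** \<beta> ** B ** transpose \<beta>))) = (\<Prod>b\<in>Basis. ennreal (f b (\<beta> \<bullet> b)))" for \<beta> :: "real^'d^'p"
  proof -
    have "(\<Prod>b\<in>Basis. f b (\<beta> \<bullet> b)) = (\<Prod>i\<in>UNIV. \<Prod>j\<in>UNIV. exp (- (P $ i $ i * B $ j $ j / 2) * (\<beta> $ i $ j)\<^sup>2))"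
      by (subst Basis_matrix_prod) (simp add: f_def c inner_axis)
    also have "\<dots> = exp (\<Sum>i\<in>UNIV. \<Sum>j\<in>UNIV. - (P $ i $ i * B $ j $ j / 2) * (\<beta> $ i $ j)\<^sup>2)"
      by (simp add: exp_sum)
    also have "(\<Sum>i\<in>UNIV. \<Sum>j\<in>UNIV. - (P $ i $ i * B $ j $ j / 2) * (\<beta> $ i $ j)\<^sup>2) = - (1 / 2) * trace (P ** \<beta> ** B ** transpose \<beta>)"
    proof -
      have "trace (P ** \<beta> ** B ** transpose \<beta>) = (\<Sum>i\<in>UNIV. \<Sum>j\<in>UNIV. P $ i $ i * B $ j $ j * (\<beta> $ i $ j)\<^sup>2)"
        by (rule trace_diagonal_form[OF P B])
      then show ?thesis by (simp add: sum_distrib_left)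
    qed
    finally have "exp (- (1 / 2) * trace (P ** \<beta> ** B ** transpose \<beta>)) = (\<Prod>b\<in>Basis. f b (\<beta> \<bullet> b))" by simp
    then show ?thesis by (simp add: prod_ennreal f_def)
  qed
  then have "(\<integral>\<^sup>+\<beta>. ennreal (exp (- (1 / 2) * trace (P ** \<beta> ** B ** transpose \<beta>))) \<partial>lborel)
     = (\<integral>\<^sup>+\<beta>. (\<Prod>b\<in>Basis. ennreal (f b (\<beta> \<bullet> b))) \<partial>lborel)" by simp
  also have "\<dots> = (\<Prod>b\<in>Basis. \<integral>\<^sup>+x. ennreal (f b x) \<partial>lborel)"
    by (rule nn_integral_lborel_prod) (auto simp: f_def)
  also have "\<dots> = (\<Prod>b\<in>Basis. ennreal (sqrt (2 * pi / c b)))"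
    unfolding f_def using cp by (intro prod.cong refl nn_integral_gaussian_real)
  also have "\<dots> = ennreal (\<Prod>b\<in>Basis. sqrt (2 * pi / c b))"
    using cp by (intro prod_ennreal) (simp add: less_imp_le)
  finally show ?thesis by (simp add: Basis_matrix_prod c)
qed

lemma prod_powr: "finite I \<Longrightarrow> (\<And>i. i \<in> I \<Longrightarrow> f i > 0) \<Longrightarrow> (\<Prod>i\<in>I. f i powr a) = (\<Prod>i\<in>I. f i :: real) powr a"
  by (induction I rule: finite_induct) (auto simp: powr_mult prod_nonneg less_imp_le)

lemma borel_measurable_gaussian_kernel[measurable]:
  "(\<lambda>\<beta>::real^'d^'p. trace (P ** \<beta> ** B ** transpose \<beta>)) \<in> borel_measurable borel"
  unfolding trace_def matrix_matrix_mult_def transpose_def vec_lambda_beta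
  by (intro borel_measurable_continuous_onI continuous_on_sum continuous_on_mult continuous_on_const
      continuous_on_component continuous_on_id)

text \<open>A shear congruence of \<open>P\<close> amounts, by cyclicity of the trace, to
  multiplying \<beta> by the shear from the left; one of \<open>B\<close> amounts to multiplying
  \<beta> by the transposed shear from the right. Both preserve Lebesgue measure and determinants,
  so both matrices may be taken diagonal, and then the integral factors over the entries.\<close>

theorem nn_integral_matrix_gaussian:
  fixes P :: "real^'p^'p" and B :: "real^'d^'d"
  assumes P: "pos_def P" and B: "pos_def B"
  shows "(\<integral>\<^sup>+\<beta>. ennreal (exp (- (1 / 2) * trace (P ** \<beta> ** B ** transpose \<beta>))) \<partial>lborel)
     = ennreal ((2 * pi) powr (real CARD('p) * real CARD('d) / 2) * det P powr (- real CARD('d) / 2) * det B powr (- real CARD('p) / 2))"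
    (is "?G P B = ?R P B")
  using P
proof (rule pos_def_shear_induct)
  fix P :: "real^'p^'p" and k r
  assume rk: "r $ k = 0" and IH: "?G (transpose (shear_mat k r) ** P ** shear_mat k r) B = ?R (transpose (shear_mat k r) ** P ** shear_mat k r) B"
  let ?E = "shear_mat k r"
  have "trace (transpose ?E ** P ** ?E ** \<beta> ** B ** transpose \<beta>) = trace (P ** (?E ** \<beta>) ** B ** transpose (?E ** \<beta>))" for \<beta> :: "real^'d^'p"
    using trace_mul_sym[of "transpose ?E" "P ** ?E ** \<beta> ** B ** transpose \<beta>"]
    by (simp add: matrix_mul_assoc matrix_transpose_mul)
  then have "?G (transpose ?E ** P ** ?E) B = ?G P B"
    using nn_integral_shear_mat_left[OF rk, of "\<lambda>\<beta>. ennreal (exp (- (1 / 2) * trace (P ** \<beta> ** B ** transpose \<beta>)))"] by simp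
  moreover have "det (transpose ?E ** P ** ?E) = det P"
    by (simp add: det_mul det_shear_mat[OF rk])
  ultimately show "?G P B = ?R P B" using IH by simp
next
  fix P :: "real^'p^'p" assume P: "pos_def P" and Pd: "\<And>i j. i \<noteq> j \<Longrightarrow> P $ i $ j = 0"
  show "?G P B = ?R P B"
    using B
  proof (rule pos_def_shear_induct)
    fix B :: "real^'d^'d" and k r
    assume rk: "r $ k = 0" and IH: "?G P (transpose (shear_mat k r) ** B ** shear_mat k r) = ?R P (transpose (shear_mat k r) ** B ** shear_mat k r)"
    let ?E = "shear_mat k r"
    have "P ** \<beta> ** (transpose ?E ** B ** ?E) ** transpose \<beta> = P ** (\<beta> ** transpose ?E) ** B ** transpose (\<beta> ** transpose ?E)" for \<beta> :: "real^'d^'p"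
      by (simp add: matrix_mul_assoc matrix_transpose_mul)
    then have "?G P (transpose ?E ** B ** ?E) = ?G P B"
      using nn_integral_shear_mat_right[OF rk, of "\<lambda>\<beta>. ennreal (exp (- (1 / 2) * trace (P ** \<beta> ** B ** transpose \<beta>)))"] by simp
    moreover have "det (transpose ?E ** B ** ?E) = det B"
      by (simp add: det_mul det_shear_mat[OF rk])
    ultimately show "?G P B = ?R P B" using IH by simp
  next
    fix B :: "real^'d^'d" assume B: "pos_def B" and Bd: "\<And>i j. i \<noteq> j \<Longrightarrow> B $ i $ j = 0"
    note p = pos_def_diag_pos[OF P] and b = pos_def_diag_pos[OF B]
    have dP: "det P = (\<Prod>i\<in>UNIV. P $ i $ i)" and dB: "det B = (\<Prod>i\<in>UNIV. B $ i $ i)"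
      by (simp_all add: det_diagonal Pd Bd)
    have s: "sqrt (2 * pi / (x * y)) = (2 * pi) powr (1/2) * x powr (-1/2) * y powr (-1/2)" if "x > 0" "y > 0" for x y :: real
      using that by (simp add: powr_half_sqrt[symmetric] powr_divide powr_mult powr_minus field_simps)
    have "(\<Prod>i\<in>UNIV. \<Prod>j\<in>UNIV. sqrt (2 * pi / (P $ i $ i * B $ j $ j)))
      = (\<Prod>i\<in>(UNIV::'p set). \<Prod>j\<in>(UNIV::'d set). (2 * pi) powr (1/2)) * (\<Prod>i\<in>UNIV. \<Prod>j\<in>(UNIV::'d set). P $ i $ i powr (-1/2))
        * (\<Prod>i\<in>(UNIV::'p set). \<Prod>j\<in>UNIV. B $ j $ j powr (-1/2))"
      using p b by (simp add: s prod.distrib del: prod_constant)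
    also have "(\<Prod>i\<in>(UNIV::'p set). \<Prod>j\<in>(UNIV::'d set). (2 * pi) powr (1/2)) = (2 * pi) powr (real CARD('p) * real CARD('d) / 2)"
      by (simp add: powr_power mult.commute)
    also have "(\<Prod>i\<in>UNIV. \<Prod>j\<in>(UNIV::'d set). P $ i $ i powr (-1/2)) = det P powr (- real CARD('d) / 2)"
      using p by (simp add: powr_power prod_powr dP less_imp_neq[THEN not_sym])
    also have "(\<Prod>i\<in>(UNIV::'p set). \<Prod>j\<in>UNIV. B $ j $ j powr (-1/2)) = det B powr (- real CARD('p) / 2)"
      using b by (simp add: powr_power prod_powr dB less_imp_neq[THEN not_sym] prod_pos)
    finally show "?G P B = ?R P B" using nn_integral_matrix_gaussian_diag[OF Pd Bd p b] by simp
  qed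
qed

section \<open>Lebesgue measure on symmetric matrices\<close>

definition sym_index :: "'d::finite set set" where
  "sym_index = {{i, j} | i j. True}"

abbreviation sym_of :: "('d set \<Rightarrow> real) \<Rightarrow> real^'d^'d" where
  "sym_of s \<equiv> (\<chi> i j. s {i, j})"

lemma finite_sym_index: "finite (sym_index :: 'd::finite set set)"
  by (rule finite_subset[of _ "Pow UNIV"]) auto

lemma pair_in_sym_index: "{i, j} \<in> sym_index"
  by (auto simp: sym_index_def)

lemma singleton_in_sym_index: "{i} \<in> sym_index"
  using pair_in_sym_index[of i i] by simp

lemma sym_of_measurable[measurable]:
  "sym_of \<in> measurable (PiM sym_index (\<lambda>_. lborel)) (borel :: (real^'d^'d) measure)"
  unfolding sym_index_def by (rule sym_lborel_map_measurable)

lemma sym_lborel_eq: "sym_lborel = distr (PiM sym_index (\<lambda>_. lborel)) borel sym_of"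
  by (simp add: sym_lborel_def sym_index_def)

lemma sets_sym_lborel[simp, measurable_cong]: "sets sym_lborel = sets borel"
  by (simp add: sym_lborel_def)

lemma space_sym_lborel[simp]: "space sym_lborel = UNIV"
  by (simp add: sym_lborel_def)

text \<open>Verified on boxes, where every coordinate contributes one factor
  \<open>c\<close>.\<close>

lemma PiM_lborel_scale:
  assumes I: "finite I" and c: "c > (0::real)"
  shows "PiM I (\<lambda>_. lborel) = density (distr (PiM I (\<lambda>_. lborel)) (PiM I (\<lambda>_. lborel)) (\<lambda>s. \<lambda>i\<in>I. c * s i)) (\<lambda>_. ennreal (c ^ card I))"
    (is "?P = density (distr ?P ?P ?T) _")
proof (rule sym)
  interpret product_sigma_finite "\<lambda>_::'a. lborel :: real measure" ..
  have [measurable]: "?T \<in> measurable ?P ?P"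
    by (rule measurable_restrict) measurable
  have one: "emeasure lborel A = ennreal c * emeasure lborel ((\<lambda>y. c * y) -` A)" if [measurable]: "A \<in> sets borel" for A :: "real set"
    using c by (subst lborel_real_affine[of c 0]) (auto simp: emeasure_density emeasure_distr nn_integral_distr nn_integral_cmult vimage_def)
  show "density (distr ?P ?P ?T) (\<lambda>_. ennreal (c ^ card I)) = ?P"
  proof (rule PiM_eqI[OF I])
    fix A :: "'a \<Rightarrow> real set" assume A: "\<And>i. i \<in> I \<Longrightarrow> A i \<in> sets lborel"
    then have AM: "Pi\<^sub>E I A \<in> sets ?P" by (intro sets_PiM_I_finite I) auto
    have vm: "(\<lambda>y. c * y) -` A i \<in> sets lborel" if "i \<in> I" for i
    proof -
      have "(\<lambda>y::real. c * y) -` A i \<inter> space lborel \<in> sets lborel"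
        using A[OF that] by (intro measurable_sets[where A=borel]) auto
      then show ?thesis by simp
    qed
    have "emeasure (density (distr ?P ?P ?T) (\<lambda>_. ennreal (c ^ card I))) (Pi\<^sub>E I A) = ennreal (c ^ card I) * emeasure ?P (?T -` (Pi\<^sub>E I A) \<inter> space ?P)"
      using AM by (simp add: emeasure_density nn_integral_cmult_indicator emeasure_distr)
    also have "?T -` (Pi\<^sub>E I A) \<inter> space ?P = Pi\<^sub>E I (\<lambda>i. (\<lambda>y. c * y) -` A i)"
      by (auto simp: space_PiM PiE_iff Pi_iff)
    also have "emeasure ?P (Pi\<^sub>E I (\<lambda>i. (\<lambda>y. c * y) -` A i)) = (\<Prod>i\<in>I. emeasure lborel ((\<lambda>y. c * y) -` A i))"
      using vm by (intro emeasure_PiM I) auto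
    also have "ennreal (c ^ card I) * \<dots> = (\<Prod>i\<in>I. ennreal c * emeasure lborel ((\<lambda>y. c * y) -` A i))"
      using c by (simp add: prod.distrib ennreal_power)
    also have "\<dots> = (\<Prod>i\<in>I. emeasure lborel (A i))"
      using A by (intro prod.cong refl one[symmetric]) auto
    finally show "emeasure (density (distr ?P ?P ?T) (\<lambda>_. ennreal (c ^ card I))) (Pi\<^sub>E I A) = (\<Prod>i\<in>I. emeasure lborel (A i))" .
  qed simp
qed

text \<open>The Jacobian has one factor \<open>c\<close> per free entry, hence the cardinality of
  \<open>sym_index\<close> rather than the square of the matrix size.\<close>

lemma nn_integral_sym_lborel_scale:
  fixes f :: "real^'d^'d \<Rightarrow> ennreal"
  assumes c: "c > 0" and [measurable]: "f \<in> borel_measurable borel"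
  shows "(\<integral>\<^sup>+S. f S \<partial>sym_lborel) = ennreal (c ^ card (sym_index :: 'd set set)) * (\<integral>\<^sup>+S. f (c *\<^sub>R S) \<partial>sym_lborel)"
proof -
  let ?J = "sym_index :: 'd set set" and ?P = "PiM (sym_index :: 'd set set) (\<lambda>_. lborel :: real measure)"
  let ?T = "\<lambda>s. \<lambda>i\<in>?J. c * s i"
  have [measurable]: "?T \<in> measurable ?P ?P"
    by (rule measurable_restrict) measurable
  have fm[measurable]: "(\<lambda>s. f (sym_of s)) \<in> borel_measurable ?P" by measurable
  have fc[measurable]: "(\<lambda>s. f (c *\<^sub>R s)) \<in> borel_measurable borel" by measurable
  have T: "sym_of (?T s) = c *\<^sub>R sym_of s" for s
    by (simp add: vec_eq_iff pair_in_sym_index singleton_in_sym_index)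
  have "(\<integral>\<^sup>+S. f S \<partial>sym_lborel) = (\<integral>\<^sup>+s. f (sym_of s) \<partial>?P)"
    unfolding sym_lborel_eq by (intro nn_integral_distr) measurable
  also have "\<dots> = (\<integral>\<^sup>+s. f (sym_of s) \<partial>density (distr ?P ?P ?T) (\<lambda>_. ennreal (c ^ card ?J)))"
    by (subst PiM_lborel_scale[OF finite_sym_index c]) (rule refl)
  also have "\<dots> = ennreal (c ^ card ?J) * (\<integral>\<^sup>+s. f (sym_of (?T s)) \<partial>?P)"
    by (simp add: nn_integral_density nn_integral_distr nn_integral_cmult)
  also have "(\<integral>\<^sup>+s. f (sym_of (?T s)) \<partial>?P) = (\<integral>\<^sup>+S. f (c *\<^sub>R S) \<partial>sym_lborel)"
    unfolding sym_lborel_eq T by (intro nn_integral_distr[symmetric]) measurable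
  finally show ?thesis .
qed

text \<open>The minimum of the form on the compact unit sphere, extended to all vectors by
  homogeneity.\<close>

lemma pos_def_lower_bound:
  fixes S :: "real^'n^'n"
  assumes "pos_def S"
  obtains c where "c > 0" "\<And>v. c * (v \<bullet> v) \<le> v \<bullet> (S *v v)"
proof -
  have "continuous_on (sphere 0 1) (\<lambda>v. v \<bullet> (S *v v))"
    by (intro continuous_intros linear_continuous_on linear_linear[THEN iffD2] matrix_vector_mul_linear)
  moreover have "axis undefined 1 \<in> sphere (0::real^'n) 1" by simp
  ultimately obtain w where w: "w \<in> sphere 0 1" "\<And>v. v \<in> sphere 0 1 \<Longrightarrow> w \<bullet> (S *v w) \<le> v \<bullet> (S *v v)"
    using continuous_attains_inf[of "sphere (0::real^'n) 1" "\<lambda>v. v \<bullet> (S *v v)"] by fastforce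
  have "w \<noteq> 0" using w(1) by auto
  then have pos: "w \<bullet> (S *v w) > 0" using assms by (simp add: pos_def_def)
  have "w \<bullet> (S *v w) * (v \<bullet> v) \<le> v \<bullet> (S *v v)" for v
  proof (cases "v = 0")
    case False
    have "w \<bullet> (S *v w) \<le> (inverse (norm v) *\<^sub>R v) \<bullet> (S *v (inverse (norm v) *\<^sub>R v))"
      using False by (intro w(2)) simp
    also have "\<dots> = (v \<bullet> (S *v v)) / (v \<bullet> v)"
      using False by (simp add: matrix_vector_mult_scaleR dot_square_norm power2_eq_square divide_inverse)
    finally show ?thesis using False by (simp add: pos_le_divide_eq)
  qed simp
  with pos show ?thesis by (rule that)
qed

text \<open>The uniform lower bounds \<open>1 / real (Suc n)\<close> replace strict positivity at
  uncountably many vectors by a countable union of closed conditions.\<close>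

lemma pos_def_measurable[measurable]: "{S. pos_def S} \<in> sets (borel :: (real^'d^'d) measure)"
proof -
  let ?C = "\<lambda>n::nat. {S :: real^'d^'d. \<forall>v. (1 / real (Suc n)) * (v \<bullet> v) \<le> v \<bullet> (S *v v)}"
  have "{S :: real^'d^'d. pos_def S} = {S. transpose S = S} \<inter> (\<Union>n. ?C n)"
  proof (intro equalityI subsetI)
    fix S :: "real^'d^'d" assume S: "S \<in> {S. pos_def S}"
    then obtain c where c: "c > 0" "\<And>v. c * (v \<bullet> v) \<le> v \<bullet> (S *v v)"
      using pos_def_lower_bound[of S] by auto
    obtain n where n: "1 / real (Suc n) < c" using c(1) by (metis nat_approx_posE)
    have "(1 / real (Suc n)) * (v \<bullet> v) \<le> v \<bullet> (S *v v)" for v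
      using mult_right_mono[of "1 / real (Suc n)" c "v \<bullet> v"] n c(2)[of v] by simp
    then show "S \<in> {S. transpose S = S} \<inter> (\<Union>n. ?C n)" using S by (auto simp: pos_def_def)
  next
    fix S :: "real^'d^'d" assume "S \<in> {S. transpose S = S} \<inter> (\<Union>n. ?C n)"
    then obtain n where n: "transpose S = S" "\<And>v. (1 / real (Suc n)) * (v \<bullet> v) \<le> v \<bullet> (S *v v)" by auto
    have "v \<bullet> (S *v v) > 0" if "v \<noteq> 0" for v
    proof -
      have "0 < (1 / real (Suc n)) * (v \<bullet> v)" using that by (intro mult_pos_pos) auto
      then show ?thesis using n(2)[of v] by linarith
    qed
    with n(1) show "S \<in> {S. pos_def S}" by (simp add: pos_def_def)
  qed
  moreover have "closed {S :: real^'d^'d. transpose S = S}"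
    unfolding transpose_def by (intro closed_Collect_eq continuous_on_vec_lambda continuous_on_component continuous_on_id)
  moreover have "closed (?C n)" for n
  proof -
    have "continuous_on UNIV (\<lambda>S::real^'d^'d. v \<bullet> (S *v v))" for v
      unfolding matrix_vector_mult_def inner_vec_def vec_lambda_beta
      by (intro continuous_intros)
    then show ?thesis by (intro closed_Collect_all closed_Collect_le continuous_on_const)
  qed
  ultimately show ?thesis by auto
qed

text \<open>Image measures of sigma-finite measures need not be sigma-finite, so an exhaustion is
  exhibited: the preimage of \<open>C n\<close> lies in a cube of side 2n.\<close>

lemma sigma_finite_sym_lborel: "sigma_finite_measure (sym_lborel :: (real^'d^'d) measure)"
proof
  interpret product_sigma_finite "\<lambda>_::'d set. lborel :: real measure" ..
  let ?P = "PiM (sym_index :: 'd set set) (\<lambda>_. lborel :: real measure)"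
  define C where "C n = {S :: real^'d^'d. \<forall>i j. \<bar>S $ i $ j\<bar> \<le> real n}" for n :: nat
  have cl: "closed (C n)" for n
    unfolding C_def by (intro closed_Collect_all closed_Collect_le continuous_intros continuous_on_component)
  then have [measurable]: "C n \<in> sets borel" for n by simp
  have U: "(\<Union>n. C n) = UNIV"
  proof -
    have "\<exists>n. S \<in> C n" for S
    proof -
      obtain n where "norm S < real n" using reals_Archimedean2 by blast
      moreover have "\<bar>S $ i $ j\<bar> \<le> norm S" for i j
        by (rule order_trans[OF component_le_norm_cart Finite_Cartesian_Product.norm_nth_le])
      ultimately have "S \<in> C n" unfolding C_def by (auto intro: less_imp_le order_trans) (meson less_imp_le order_trans)
      then show ?thesis ..
    qed
    then show ?thesis by auto
  qed
  have fin: "emeasure sym_lborel (C n) \<noteq> \<infinity>" for n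
  proof -
    have "emeasure sym_lborel (C n) = emeasure ?P (sym_of -` C n \<inter> space ?P)"
      unfolding sym_lborel_eq by (rule emeasure_distr) measurable
    also have "\<dots> \<le> emeasure ?P (Pi\<^sub>E sym_index (\<lambda>_. {- real n..real n}))"
    proof (rule emeasure_mono)
      show "sym_of -` C n \<inter> space ?P \<subseteq> Pi\<^sub>E sym_index (\<lambda>_. {- real n..real n})"
        by (auto simp: C_def space_PiM PiE_iff sym_index_def abs_le_iff) (smt (verit))+
    qed (auto intro!: sets_PiM_I_finite finite_sym_index)
    also have "\<dots> = (\<Prod>i\<in>(sym_index :: 'd set set). emeasure lborel {- real n..real n})"
      by (intro emeasure_PiM finite_sym_index) auto
    also have "\<dots> < \<infinity>" by (simp add: power_less_top_ennreal)
    finally show ?thesis by simp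
  qed
  show "\<exists>A. countable A \<and> A \<subseteq> sets sym_lborel \<and> \<Union>A = space (sym_lborel :: (real^'d^'d) measure) \<and> (\<forall>a\<in>A. emeasure sym_lborel a \<noteq> \<infinity>)"
    by (intro exI[of _ "range C"]) (use U fin in auto)
qed

lemma sigma_finite_posdef_lborel: "sigma_finite_measure (posdef_lborel :: (real^'d^'d) measure)"
  unfolding posdef_lborel_def
  by (intro sigma_finite_measure_restrict_space sigma_finite_sym_lborel) simp

lemma space_posdef_lborel[simp]: "space posdef_lborel = {S. pos_def S}"
  by (simp add: posdef_lborel_def space_restrict_space)

lemma nn_integral_posdef_lborel:
  "(\<integral>\<^sup>+S. f S \<partial>posdef_lborel) = (\<integral>\<^sup>+S. f S * indicator {S. pos_def S} S \<partial>sym_lborel)"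
  unfolding posdef_lborel_def by (rule nn_integral_restrict_space) simp

lemma measurable_posdef_lborel[measurable (raw)]: "f \<in> borel_measurable borel \<Longrightarrow> f \<in> borel_measurable posdef_lborel"
  unfolding posdef_lborel_def by (intro measurable_restrict_space1) (simp add: measurable_cong_sets[OF sets_sym_lborel refl])

lemma pos_def_scaleR:
  assumes "c > 0" "pos_def S" shows "pos_def (c *\<^sub>R S)"
  using assms by (simp add: pos_def_def transpose_def vec_eq_iff scaleR_matrix_vector_assoc[symmetric])

lemma pos_def_scaleR_iff: "c > 0 \<Longrightarrow> pos_def (c *\<^sub>R S) \<longleftrightarrow> pos_def S"
  using pos_def_scaleR[of c S] pos_def_scaleR[of "1 / c" "c *\<^sub>R S"] by auto

text \<open>The positive definite matrices form a cone, so restriction to them is compatible with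
  scaling.\<close>

lemma nn_integral_posdef_lborel_scale:
  fixes f :: "real^'d^'d \<Rightarrow> ennreal"
  assumes c: "c > 0" and f: "(\<lambda>S. f S * indicator {S. pos_def S} S) \<in> borel_measurable borel"
  shows "(\<integral>\<^sup>+S. f S \<partial>posdef_lborel) = ennreal (c ^ card (sym_index :: 'd set set)) * (\<integral>\<^sup>+S. f (c *\<^sub>R S) \<partial>posdef_lborel)"
  unfolding nn_integral_posdef_lborel
  using nn_integral_sym_lborel_scale[OF c f] by (simp add: indicator_def pos_def_scaleR_iff[OF c])

section \<open>Generalized least squares\<close>

lemma matrix_inv_works:
  fixes A :: "real^'n^'n"
  assumes "invertible A"
  shows "A ** matrix_inv A = mat 1" "matrix_inv A ** A = mat 1"
proof -
  have "A ** matrix_inv A = mat 1 \<and> matrix_inv A ** A = mat 1"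
    unfolding matrix_inv_def using assms unfolding invertible_def by (rule someI_ex)
  then show "A ** matrix_inv A = mat 1" "matrix_inv A ** A = mat 1" by auto
qed

lemma matrix_inv_eqI:
  fixes A B :: "real^'n^'n"
  assumes "A ** B = mat 1" shows "matrix_inv A = B"
proof -
  have BA: "B ** A = mat 1" using assms by (simp add: matrix_left_right_inverse)
  then have "invertible A" using assms by (auto simp: invertible_def)
  then have "matrix_inv A = matrix_inv A ** (A ** B)" by (simp add: assms)
  also have "\<dots> = B" using matrix_inv_works[OF \<open>invertible A\<close>] by (simp add: matrix_mul_assoc)
  finally show ?thesis .
qed

lemma pos_def_invertible:
  fixes A :: "real^'n^'n"
  assumes "pos_def A" shows "invertible A"
proof -
  have "A *v v \<noteq> 0" if "v \<noteq> 0" for v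
    using assms that unfolding pos_def_def by (metis inner_zero_right less_irrefl)
  then have "\<exists>B. B ** A = mat 1" unfolding matrix_left_invertible_ker by blast
  then show ?thesis by (auto simp: invertible_def matrix_left_right_inverse)
qed

lemma pos_def_det_pos: "pos_def P \<Longrightarrow> det P > 0"
proof (erule pos_def_shear_induct)
  show "det P > 0" if "pos_def P" "\<And>i j. i \<noteq> j \<Longrightarrow> P $ i $ j = 0" for P :: "real^'a^'a"
    using that by (subst det_diagonal) (auto intro!: prod_pos pos_def_diag_pos)
  show "det P > 0" if "r $ k = 0" "det (transpose (shear_mat k r) ** P ** shear_mat k r) > 0" for P :: "real^'a^'a" and k r
    using that by (simp add: det_mul det_shear_mat)
qed

lemma matrix_inv_pos_def:
  fixes A :: "real^'n^'n"
  assumes A: "pos_def A"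
  shows "pos_def (matrix_inv A)" "matrix_inv (matrix_inv A) = A" "det (matrix_inv A) = inverse (det A)"
proof -
  note inv = matrix_inv_works[OF pos_def_invertible[OF A]]
  have sym: "transpose A = A" using A by (simp add: pos_def_def)
  show "matrix_inv (matrix_inv A) = A" by (rule matrix_inv_eqI) (rule inv)
  have "transpose (matrix_inv A) = matrix_inv A"
    by (rule matrix_inv_eqI[symmetric]) (metis inv(2) matrix_transpose_mul sym transpose_mat)
  moreover have "v \<bullet> (matrix_inv A *v v) > 0" if "v \<noteq> 0" for v
  proof -
    let ?w = "matrix_inv A *v v"
    have v: "A *v ?w = v" by (simp add: matrix_vector_mul_assoc inv)
    then have "?w \<noteq> 0" using that by auto
    then have "?w \<bullet> (A *v ?w) > 0" using A unfolding pos_def_def by blast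
    then show ?thesis by (simp add: v inner_commute)
  qed
  ultimately show "pos_def (matrix_inv A)" by (simp add: pos_def_def)
  have "det A * det (matrix_inv A) = 1" using arg_cong[OF inv(1), of det] by (simp add: det_mul)
  then show "det (matrix_inv A) = inverse (det A)" by (metis inverse_unique)
qed

definition diag_mat :: "real^'n \<Rightarrow> real^'n^'n" where
  "diag_mat z = (\<chi> i j. if i = j then z $ i else 0)"

lemma diag_mat_mult: "(diag_mat z ** A) $ i $ j = z $ i * A $ i $ j"
  by (simp add: diag_mat_def matrix_matrix_mult_def if_distrib[of "\<lambda>x. x * _"] cong: if_cong)

lemma diag_mat_vec: "(diag_mat z *v v) $ i = z $ i * v $ i"
  by (simp add: diag_mat_def matrix_vector_mult_def if_distrib[of "\<lambda>x. x * _"] cong: if_cong)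

lemma transpose_diag_mat[simp]: "transpose (diag_mat z) = diag_mat z"
  by (simp add: diag_mat_def transpose_def vec_eq_iff)

lemma matrix_inv_Q_mat:
  fixes z :: "real^'n"
  assumes "\<And>i. z $ i > 0" shows "matrix_inv (Q_mat z) = diag_mat z"
proof (rule matrix_inv_eqI)
  have q: "Q_mat z = diag_mat (\<chi> i. inverse (z $ i))" by (simp add: Q_mat_def diag_mat_def vec_eq_iff)
  have "(diag_mat (\<chi> i. inverse (z $ i)) ** diag_mat z) $ i $ j = (mat 1 :: real^'n^'n) $ i $ j" for i j
    unfolding diag_mat_mult using assms[of j] by (cases "i = j") (simp_all add: diag_mat_def mat_def)
  then show "Q_mat z ** diag_mat z = mat 1" unfolding q vec_eq_iff by blast
qed

lemma matrix_diff_ldistrib: "(A :: real^'m^'k) ** (B - C) = A ** B - A ** C"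
  by (simp add: matrix_matrix_mult_def vec_eq_iff right_diff_distrib sum_subtractf)

lemma matrix_diff_rdistrib: "(A - B) ** (C :: real^'m^'k) = A ** C - B ** C"
  by (simp add: matrix_matrix_mult_def vec_eq_iff left_diff_distrib sum_subtractf)

lemma matrix_plus_rdistrib: "(A + B) ** (C :: real^'m^'k) = A ** C + B ** C"
  by (simp add: matrix_matrix_mult_def vec_eq_iff distrib_right sum.distrib)

text \<open>Collects the weighted sum over observations in one trace, so that the square can be
  completed by matrix algebra.\<close>

lemma trace_quadratic_rows:
  fixes R :: "real^'d^'n" and B :: "real^'d^'d"
  shows "trace (transpose R ** diag_mat z ** R ** B) = (\<Sum>i\<in>UNIV. z $ i * (R $ i \<bullet> (B *v R $ i)))"
proof -
  have entry: "(R ** B ** transpose R) $ i $ i = R $ i \<bullet> (B *v R $ i)" for i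
    by (simp add: matrix_mul_assoc[symmetric]) (simp add: matrix_matrix_mult_def[of R] inner_vec_def matrix_matrix_mult_def[of B]
          matrix_vector_mult_def transpose_def)
  have "trace (transpose R ** diag_mat z ** R ** B) = trace (diag_mat z ** (R ** B ** transpose R))"
    using trace_mul_sym[of "transpose R" "diag_mat z ** R ** B"] by (simp add: matrix_mul_assoc)
  also have "\<dots> = (\<Sum>i\<in>UNIV. z $ i * (R ** B ** transpose R) $ i $ i)"
    unfolding trace_def diag_mat_mult ..
  finally show ?thesis unfolding entry .
qed

locale regression =
  fixes X :: "real^'p^'n" and y :: "real^'d^'n"
  assumes rank: "rank (concat_cols X y) = CARD('p) + CARD('d)"
begin

text \<open>The full rank is used in two halves: independence of the columns of \<open>X\<close>
  makes \<open>A\<close> positive definite, and independence of those of \<open>y\<close> modulo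
  them does the same for \<open>S\<close>.\<close>

lemma independent_columns:
  assumes "X *v a + y *v b = 0" shows "a = 0" "b = 0"
proof -
  have inj: "inj ((*v) (concat_cols X y))"
    using rank full_rank_injective[of "concat_cols X y"] by simp
  let ?v = "\<chi> j. case j of Inl k \<Rightarrow> a $ k | Inr l \<Rightarrow> b $ l"
  have "concat_cols X y *v ?v = X *v a + y *v b"
    by (simp add: concat_cols_def matrix_vector_mult_def vec_eq_iff UNIV_Plus_UNIV[symmetric] sum.Plus del: UNIV_Plus_UNIV)
  also have "\<dots> = concat_cols X y *v 0" using assms by simp
  finally have v: "?v = 0" using inj by (simp only: inj_eq)
  have "?v $ Inl k = 0" "?v $ Inr l = 0" for k l by (simp_all only: v zero_index)
  then show "a = 0" "b = 0" by (simp_all add: vec_eq_iff)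
qed

definition "A z = transpose X ** diag_mat z ** X"
definition "\<mu> z = matrix_inv (A z) ** transpose X ** diag_mat z ** y"
text \<open>The residual form makes positive definiteness visible; \<open>S_eq\<close> identifies it
  with the difference that defines the inverse Wishart parameter.\<close>

definition "S z = transpose (y - X ** \<mu> z) ** diag_mat z ** (y - X ** \<mu> z)"

lemma quadratic_diag_pos:
  assumes "\<And>i. z $ i > 0" "w \<noteq> 0" shows "w \<bullet> (diag_mat z *v w) > 0"
proof -
  have eq: "w \<bullet> (diag_mat z *v w) = (\<Sum>i\<in>UNIV. z $ i * (w $ i)\<^sup>2)"
    by (simp add: inner_vec_def diag_mat_vec power2_eq_square mult_ac)
  obtain i where "w $ i \<noteq> 0" using assms(2) by (auto simp: vec_eq_iff)
  then have "0 < z $ i * (w $ i)\<^sup>2" using assms(1)[of i] by simp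
  moreover have "0 \<le> z $ j * (w $ j)\<^sup>2" for j using assms(1)[of j] by simp
  ultimately show ?thesis unfolding eq by (intro sum_pos2[of _ i]) auto
qed

lemma pos_def_congruence:
  fixes R :: "real^'k^'m"
  assumes z: "\<And>i. z $ i > 0" and R: "\<And>v. v \<noteq> 0 \<Longrightarrow> R *v v \<noteq> 0"
  shows "pos_def (transpose R ** diag_mat z ** R)"
  unfolding pos_def_def
proof (intro conjI allI impI)
  show "transpose (transpose R ** diag_mat z ** R) = transpose R ** diag_mat z ** R"
    by (simp add: matrix_transpose_mul matrix_mul_assoc)
  fix v :: "real^'k" assume "v \<noteq> 0"
  have "v \<bullet> (transpose R ** diag_mat z ** R *v v) = (R *v v) \<bullet> (diag_mat z *v (R *v v))"
    by (simp add: matrix_vector_mul_assoc[symmetric] inner_transpose_mult del: transpose_matrix_vector)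
  then show "v \<bullet> (transpose R ** diag_mat z ** R *v v) > 0"
    using quadratic_diag_pos[OF z R[OF \<open>v \<noteq> 0\<close>]] by simp
qed

lemma pos_def_A: assumes "\<And>i. z $ i > 0" shows "pos_def (A z)"
  unfolding A_def
proof (rule pos_def_congruence[OF assms])
  show "X *v v \<noteq> 0" if "v \<noteq> 0" for v
    using independent_columns(1)[of v 0] that by auto
qed

text \<open>A kernel vector \<open>v\<close> of the residual matrix would give a linear relation
  among the columns of \<open>X\<close> and \<open>y\<close> in which \<open>y\<close> has
  coefficient \<open>v\<close>.\<close>

lemma pos_def_S: assumes "\<And>i. z $ i > 0" shows "pos_def (S z)"
  unfolding S_def
proof (rule pos_def_congruence[OF assms])
  fix v :: "real^'d" assume "v \<noteq> 0"
  have "(y - X ** \<mu> z) *v v = X *v (- (\<mu> z *v v)) + y *v v"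
    by (simp add: matrix_vector_mult_diff_rdistrib matrix_vector_mul_assoc[symmetric] vec.neg)
  then show "(y - X ** \<mu> z) *v v \<noteq> 0"
    using independent_columns(2)[of "- (\<mu> z *v v)" v] \<open>v \<noteq> 0\<close> by auto
qed

lemma A_mu: assumes "\<And>i. z $ i > 0" shows "A z ** \<mu> z = transpose X ** diag_mat z ** y"
  unfolding \<mu>_def using matrix_inv_works(1)[OF pos_def_invertible[OF pos_def_A[OF assms]]]
  by (simp add: matrix_mul_assoc)

lemma normal_equations:
  assumes "\<And>i. z $ i > 0" shows "transpose X ** diag_mat z ** (y - X ** \<mu> z) = 0"
proof -
  have "transpose X ** diag_mat z ** (y - X ** \<mu> z) = transpose X ** diag_mat z ** y - A z ** \<mu> z"
    unfolding A_def by (simp add: matrix_diff_ldistrib matrix_mul_assoc)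
  then show ?thesis by (simp add: A_mu[OF assms])
qed

text \<open>The normal equations and their transpose remove both cross terms.\<close>

lemma complete_square:
  assumes z: "\<And>i. z $ i > 0"
  shows "transpose (y - X ** \<beta>) ** diag_mat z ** (y - X ** \<beta>) = S z + transpose (\<beta> - \<mu> z) ** A z ** (\<beta> - \<mu> z)"
proof -
  let ?R = "y - X ** \<mu> z" and ?d = "\<beta> - \<mu> z" and ?Z = "diag_mat z"
  have R: "y - X ** \<beta> = ?R - X ** ?d" by (simp add: matrix_diff_ldistrib)
  have 1: "transpose X ** ?Z ** ?R = 0" by (rule normal_equations[OF z])
  then have "transpose (transpose X ** ?Z ** ?R) = 0" by (simp add: transpose_def vec_eq_iff)
  then have 2: "transpose ?R ** ?Z ** X = 0" by (simp add: matrix_transpose_mul matrix_mul_assoc)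
  have tr: "transpose (P - Q) = transpose P - transpose Q" for P Q :: "real^'d^'n"
    by (simp add: transpose_def vec_eq_iff)
  have "transpose (y - X ** \<beta>) ** ?Z ** (y - X ** \<beta>)
    = transpose ?R ** ?Z ** ?R - transpose ?R ** ?Z ** X ** ?d - transpose ?d ** (transpose X ** ?Z ** ?R) + transpose ?d ** A z ** ?d"
    unfolding R tr[of ?R "X ** ?d"] A_def matrix_transpose_mul
    by (simp add: matrix_diff_ldistrib matrix_diff_rdistrib matrix_mul_assoc)
  also have "\<dots> = S z + transpose ?d ** A z ** ?d"
    unfolding 1 2 S_def by simp
  finally show ?thesis .
qed

text \<open>The completed square at \<beta> = 0, solved for \<open>S\<close>.\<close>

lemma S_eq: assumes z: "\<And>i. z $ i > 0"
  shows "S z = transpose y ** diag_mat z ** y - transpose (\<mu> z) ** A z ** \<mu> z"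
  using complete_square[OF z, of 0] by (simp add: transpose_def matrix_matrix_mult_def sum_negf)

text \<open>Separates the exponent into a part that is Gaussian in \<beta> and a part that is
  inverse Wishart in \<Sigma>.\<close>

lemma sum_mahalanobis:
  assumes z: "\<And>i. z $ i > 0"
  shows "(\<Sum>i\<in>UNIV. z $ i * mahalanobis X y \<beta> \<Sigma> i)
    = trace (A z ** (\<beta> - \<mu> z) ** matrix_inv \<Sigma> ** transpose (\<beta> - \<mu> z)) + trace (S z ** matrix_inv \<Sigma>)"
proof -
  let ?B = "matrix_inv \<Sigma>" and ?d = "\<beta> - \<mu> z"
  have r: "y $ i - transpose \<beta> *v X $ i = (y - X ** \<beta>) $ i" for i
    by (simp add: vec_eq_iff matrix_vector_mult_def matrix_matrix_mult_def transpose_def mult.commute del: transpose_matrix_vector)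
  have "(\<Sum>i\<in>UNIV. z $ i * mahalanobis X y \<beta> \<Sigma> i) = trace (transpose (y - X ** \<beta>) ** diag_mat z ** (y - X ** \<beta>) ** ?B)"
    unfolding trace_quadratic_rows mahalanobis_def Let_def r ..
  also have "\<dots> = trace (S z ** ?B) + trace (transpose ?d ** A z ** ?d ** ?B)"
    unfolding complete_square[OF z] by (simp add: matrix_plus_rdistrib trace_add)
  also have "trace (transpose ?d ** A z ** ?d ** ?B) = trace (A z ** ?d ** ?B ** transpose ?d)"
    using trace_mul_sym[of "transpose ?d" "A z ** ?d ** ?B"] by (simp add: matrix_mul_assoc)
  finally show ?thesis by simp
qed

end

section \<open>Mixing densities\<close>

locale mixing =
  fixes h :: "real \<Rightarrow> real" and k \<rho> \<tau> \<eta> :: real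
  assumes mixing_density: "mixing_density h" and k: "k \<ge> 0"
    and moment: "set_integrable lborel {0<..} (\<lambda>u. u powr k * h u)"
    and \<rho>: "\<rho> > 0" and \<eta>: "\<eta> > 0" and mono: "mono_on {0<..<\<eta>} (\<lambda>u. h u / g_fun \<rho> \<tau> u)"
begin

text \<open>The extension by 0: nothing is known about \<open>h\<close> on the nonpositive
  half-line, not even measurability.\<close>

definition "H u = indicator {0<..} u * h u"

lemma H_measurable[measurable]: "H \<in> borel_measurable borel"
proof -
  have "integrable lborel (\<lambda>u. indicator {0<..} u *\<^sub>R h u)"
    using mixing_density by (simp add: mixing_density_def set_integrable_def)
  from borel_measurable_integrable[OF this] show ?thesis by (simp add: H_def[abs_def])
qed

lemma H_nonneg: "H u \<ge> 0"
  using mixing_density by (auto simp: H_def mixing_density_def indicator_def)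

lemma H_pos_eq: "u > 0 \<Longrightarrow> H u = h u"
  by (simp add: H_def)

lemma H_nonpos: "u \<le> 0 \<Longrightarrow> H u = 0"
  by (simp add: H_def)

lemma moment_integrable: "integrable lborel (\<lambda>u. u powr k * H u)"
  using moment unfolding set_integrable_def H_def
  by (rule back_subst[where P="integrable lborel"]) (auto simp: fun_eq_iff)

lemma moment_finite: "(\<integral>\<^sup>+u. ennreal (u powr k * H u) \<partial>lborel) < \<infinity>"
  using moment_integrable H_nonneg by (subst nn_integral_eq_integral) (auto intro!: AE_I2 mult_nonneg_nonneg)

lemma g_pos: "g_fun \<rho> \<tau> u > 0"
  by (simp add: g_fun_def)

lemma H_ratio:
  assumes "0 < u" "u \<le> v" "v < \<eta>"
  shows "H u * (g_fun \<rho> \<tau> v / g_fun \<rho> \<tau> u) \<le> H v"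
proof -
  have "h u / g_fun \<rho> \<tau> u \<le> h v / g_fun \<rho> \<tau> v"
    by (rule mono_onD[OF mono]) (use assms in auto)
  then have "h u / g_fun \<rho> \<tau> u * g_fun \<rho> \<tau> v \<le> h v / g_fun \<rho> \<tau> v * g_fun \<rho> \<tau> v"
    using g_pos[of v] by (intro mult_right_mono) auto
  then show ?thesis using g_pos[of v] assms by (simp add: H_pos_eq)
qed

text \<open>The reciprocal of the normalizing constant \<open>b(s)\<close> of the density \<psi>(u;
  s), taken as an extended integral so that restricting the domain gives lower bounds
  directly.\<close>

definition "\<Psi> s = (\<integral>\<^sup>+v. ennreal (v powr k * exp (- s * v / 2) * H v) \<partial>lborel)"

lemma \<Psi>_finite: assumes "s \<ge> 0" shows "\<Psi> s < \<infinity>"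
proof -
  have "v powr k * exp (- s * v / 2) * H v \<le> v powr k * H v" for v
  proof (cases "v > 0")
    case True
    then have "v powr k * exp (- s * v / 2) * H v \<le> v powr k * 1 * H v"
      using assms H_nonneg mult_nonneg_nonneg[OF assms, of v] by (intro mult_mono) (simp_all add: H_nonneg)
    then show ?thesis by simp
  qed (simp add: H_nonpos)
  then have "\<Psi> s \<le> (\<integral>\<^sup>+u. ennreal (u powr k * H u) \<partial>lborel)"
    unfolding \<Psi>_def by (intro nn_integral_mono ennreal_leI)
  then show ?thesis using moment_finite by (rule le_less_trans)
qed

lemma not_AE_H_zero: "\<not> (AE u in lborel. H u = 0)"
proof
  assume "AE u in lborel. H u = 0"
  then have "(LINT u|lborel. H u) = 0" using integral_cong_AE[of H lborel "\<lambda>_. 0"] by simp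
  moreover have "(LINT u|lborel. H u) = 1"
    using mixing_density by (simp add: mixing_density_def set_lebesgue_integral_def H_def)
  ultimately show False by simp
qed

lemma \<Psi>_pos: "\<Psi> s > 0"
proof -
  have "\<Psi> s \<noteq> 0"
  proof
    assume "\<Psi> s = 0"
    then have "AE v in lborel. ennreal (v powr k * exp (- s * v / 2) * H v) = 0"
      unfolding \<Psi>_def by (subst (asm) nn_integral_0_iff_AE) auto
    then have "AE v in lborel. H v = 0"
    proof eventually_elim
      case (elim v)
      show ?case
      proof (cases "v > 0")
        case True
        then have p: "v powr k * exp (- s * v / 2) > 0" by simp
        have "v powr k * exp (- s * v / 2) * H v \<le> 0" using elim by (simp only: ennreal_eq_0_iff)
        then have "\<not> H v > 0" using mult_pos_pos[OF p, of "H v"] by linarith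
        then show ?thesis using H_nonneg[of v] by linarith
      qed (simp add: H_nonpos)
    qed
    with not_AE_H_zero show False ..
  qed
  then show ?thesis by (simp add: zero_less_iff_neq_zero)
qed

text \<open>With l = ln (v / u), the logarithm of the quotient is -2 \<rho> l ln u - \<rho> l^2 +
  \<tau> l. Only the first term is unbounded as u tends to 0, and since ln u <= 0 it is smallest at
  l = ln (5/4); the other two are controlled by l <= ln (3/2).\<close>

lemma g_ratio:
  assumes u: "0 < u" "u \<le> 1" and v: "5/4 * u \<le> v" "v \<le> 3/2 * u"
  shows "exp (- \<rho> * (ln (3/2))\<^sup>2 - \<bar>\<tau>\<bar> * ln (3/2)) * u powr (- 2 * \<rho> * ln (5/4)) \<le> g_fun \<rho> \<tau> v / g_fun \<rho> \<tau> u"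
proof -
  define l where "l = ln (v / u)"
  have v0: "v > 0" using u v by linarith
  have lv: "ln v = ln u + l" using u v0 by (simp add: l_def ln_div)
  have l1: "ln (5/4) \<le> l" and l2: "l \<le> ln (3/2)"
    using u v v0 by (auto simp: l_def field_simps)
  have l0: "l \<ge> 0" using l1 by (rule order_trans[rotated]) simp
  have L: "ln u \<le> 0" using u by simp
  have "l\<^sup>2 \<le> (ln (3/2))\<^sup>2" using l0 l2 by (intro power_mono)
  then have a: "\<rho> * l\<^sup>2 \<le> \<rho> * (ln (3/2))\<^sup>2" using \<rho> by (intro mult_left_mono) auto
  have "- (\<tau> * l) \<le> \<bar>\<tau>\<bar> * l" using l0 by (metis abs_ge_minus_self mult_minus_left mult_right_mono)
  also have "\<dots> \<le> \<bar>\<tau>\<bar> * ln (3/2)" using l2 by (intro mult_left_mono) auto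
  finally have b: "- (\<tau> * l) \<le> \<bar>\<tau>\<bar> * ln (3/2)" .
  have "(2 * \<rho> * ln u) * l \<le> (2 * \<rho> * ln u) * ln (5/4)"
    using L \<rho> l1 by (intro mult_left_mono_neg) (auto simp: mult_nonneg_nonpos)
  then have c: "2 * \<rho> * ln u * l \<le> 2 * \<rho> * ln u * ln (5/4)" .
  have "g_fun \<rho> \<tau> v / g_fun \<rho> \<tau> u = exp (- 2 * \<rho> * ln u * l - \<rho> * l\<^sup>2 + \<tau> * l)"
    unfolding g_fun_def lv exp_diff[symmetric] by (simp add: algebra_simps power2_eq_square)
  moreover have "exp (- \<rho> * (ln (3/2))\<^sup>2 - \<bar>\<tau>\<bar> * ln (3/2)) * u powr (- 2 * \<rho> * ln (5/4))
      = exp (- \<rho> * (ln (3/2))\<^sup>2 - \<bar>\<tau>\<bar> * ln (3/2) + (- 2 * \<rho> * ln (5/4)) * ln u)"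
    using u by (simp add: powr_def exp_add[symmetric])
  moreover have "- \<rho> * (ln (3/2))\<^sup>2 - \<bar>\<tau>\<bar> * ln (3/2) + (- 2 * \<rho> * ln (5/4)) * ln u \<le> - 2 * \<rho> * ln u * l - \<rho> * l\<^sup>2 + \<tau> * l"
    using a b c by (simp add: mult_ac)
  ultimately show ?thesis by simp
qed

text \<open>Small enough that 3u/2 stays in the interval of monotonicity and that ln u <= 0 whenever
  0 < u < \<delta>.\<close>

definition "\<delta> = min (\<eta> / 2) 1"
definition "\<epsilon> = 2 * \<rho> * ln (5/4)"
text \<open>The constant of \<open>g_ratio\<close>, from the worst sign of \<tau> and the largest
  l.\<close>

definition "cg = exp (- \<rho> * (ln (3/2))\<^sup>2 - \<bar>\<tau>\<bar> * ln (3/2))"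

lemma \<delta>: "0 < \<delta>" "\<delta> \<le> 1" "3/2 * \<delta> < \<eta>"
  using \<eta> by (auto simp: \<delta>_def min_def)

lemma \<epsilon>: "\<epsilon> > 0" using \<rho> by (simp add: \<epsilon>_def)

lemma cg: "cg > 0" by (simp add: cg_def)

text \<open>On an interval of length u / 4 to the right of u the integrand of \<open>\<Psi>\<close>
  is at least \<open>m\<close>. The length costs a factor 4 / u, the exponential at the right end
  costs exp (s u / 4), and the quotient of the values of \<open>g\<close> returns u powr
  \<epsilon>.\<close>

lemma small_bound:
  assumes s: "s \<ge> 0" and u: "0 < u" "u < \<delta>"
  shows "ennreal (u powr k * exp (- s * u / 2) * H u)
     \<le> ennreal (4 / cg * u powr (\<epsilon> - 1)) * ennreal (exp (s * u / 4)) * \<Psi> s"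
proof -
  let ?I = "{5/4 * u..3/2 * u}"
  \<comment> \<open>Each factor is bounded below separately: the power by its value at u, the
    exponential by its value at 3u/2, and \<open>H\<close> through the monotone quotient.\<close>
  define m where "m = u powr k * exp (- s * (3/2 * u) / 2) * (H u * (cg * u powr (- \<epsilon>)))"
  have m0: "m \<ge> 0" unfolding m_def using H_nonneg cg by (intro mult_nonneg_nonneg) auto
  have "m \<le> v powr k * exp (- s * v / 2) * H v" if v: "v \<in> ?I" for v
    unfolding m_def
  proof (intro mult_mono)
    show "u powr k \<le> v powr k" using v u k by (intro powr_mono2) auto
    show "exp (- s * (3/2 * u) / 2) \<le> exp (- s * v / 2)"
      using v s mult_left_mono[of v "3/2*u" s] by simp
    have "H u * (cg * u powr (- \<epsilon>)) \<le> H u * (g_fun \<rho> \<tau> v / g_fun \<rho> \<tau> u)"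
      using g_ratio[of u v] v u \<delta> H_nonneg by (intro mult_left_mono) (auto simp: cg_def \<epsilon>_def)
    also have "\<dots> \<le> H v" using v u \<delta> by (intro H_ratio) auto
    finally show "H u * (cg * u powr (- \<epsilon>)) \<le> H v" .
  qed (use H_nonneg cg in auto)
  then have "ennreal m * indicator ?I v \<le> ennreal (v powr k * exp (- s * v / 2) * H v)" for v
    by (auto simp: indicator_def intro!: ennreal_leI)
  then have "(\<integral>\<^sup>+v. ennreal m * indicator ?I v \<partial>lborel) \<le> \<Psi> s"
    unfolding \<Psi>_def by (intro nn_integral_mono)
  moreover have "(\<integral>\<^sup>+v. ennreal m * indicator ?I v \<partial>lborel) = ennreal (m * (u / 4))"
    using u m0 by (subst nn_integral_cmult_indicator) (auto simp: ennreal_mult[symmetric])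
  ultimately have \<Psi>: "ennreal (m * (u / 4)) \<le> \<Psi> s" by simp
  have e1: "exp (s * u / 4) * exp (- s * (3/2 * u) / 2) = exp (- s * u / 2)"
    by (simp add: exp_add[symmetric])
  have e2: "u powr (\<epsilon> - 1) * u powr (- \<epsilon>) * u = 1"
  proof -
    have "u powr (\<epsilon> - 1) * u powr (- \<epsilon>) = u powr (-1)" by (simp add: powr_add[symmetric])
    then show ?thesis using u by (simp add: powr_minus)
  qed
  have "4 / cg * u powr (\<epsilon> - 1) * exp (s * u / 4) * (m * (u / 4))
    = u powr k * (exp (s * u / 4) * exp (- s * (3/2 * u) / 2)) * H u * (u powr (\<epsilon> - 1) * u powr (- \<epsilon>) * u)"
    using cg by (simp add: m_def)
  also have "\<dots> = u powr k * exp (- s * u / 2) * H u" unfolding e1 e2 by simp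
  finally have "ennreal (u powr k * exp (- s * u / 2) * H u) = ennreal (4 / cg * u powr (\<epsilon> - 1)) * ennreal (exp (s * u / 4)) * ennreal (m * (u / 4))"
    using cg m0 u by (simp add: ennreal_mult[symmetric])
  also have "\<dots> \<le> ennreal (4 / cg * u powr (\<epsilon> - 1)) * ennreal (exp (s * u / 4)) * \<Psi> s"
    by (intro mult_left_mono \<Psi>) auto
  finally show ?thesis .
qed

section \<open>Truncated moments and the range away from 0\<close>

definition "lower_moment t = (\<integral>\<^sup>+v. ennreal (v powr k * H v) * indicator {0<..<t} v \<partial>lborel)"

lemma lower_moment_mono: "s \<le> t \<Longrightarrow> lower_moment s \<le> lower_moment t"
  unfolding lower_moment_def by (intro nn_integral_mono) (auto simp: indicator_def)

lemma lower_moment_zero_AE: "lower_moment t = 0 \<Longrightarrow> AE v in lborel. v < t \<longrightarrow> H v = 0"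
proof -
  assume N: "lower_moment t = 0"
  have m: "(\<lambda>v. ennreal (v powr k * H v) * indicator {0<..<t} v) \<in> borel_measurable lborel" by measurable
  have "AE v in lborel. ennreal (v powr k * H v) * indicator {0<..<t} v = 0"
    using nn_integral_0_iff_AE[OF m] N unfolding lower_moment_def by blast
  then show "AE v in lborel. v < t \<longrightarrow> H v = 0"
  proof eventually_elim
    case (elim v)
    show ?case
    proof (cases "v > 0")
      case True
      show ?thesis
      proof
        assume "v < t"
        with elim True have "v powr k * H v \<le> 0" by (simp add: ennreal_eq_0_iff)
        moreover have "v powr k > 0" using True by simp
        ultimately show "H v = 0" using H_nonneg[of v] by (simp add: mult_le_0_iff)
      qed
    qed (simp add: H_nonpos)
  qed
qed

text \<open>The left end of the essential support of \<open>h\<close>: below it \<open>h\<close>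
  vanishes almost everywhere, and (0, t) carries mass for every t > \<open>c0\<close>.\<close>

definition "c0 = Inf {t. 0 < t \<and> lower_moment t > 0}"
definition "c1 = max \<delta> c0"

lemma lower_moment_pos_ex: "\<exists>t>0. lower_moment t > 0"
proof (rule ccontr)
  assume "\<not> (\<exists>t>0. lower_moment t > 0)"
  then have "lower_moment (real (Suc n)) = 0" for n by (metis not_gr_zero of_nat_0_less_iff zero_less_Suc)
  then have "AE v in lborel. v < real (Suc n) \<longrightarrow> H v = 0" for n by (rule lower_moment_zero_AE)
  then have "AE v in lborel. \<forall>n. v < real (Suc n) \<longrightarrow> H v = 0" unfolding AE_all_countable by blast
  then have "AE v in lborel. H v = 0"
  proof eventually_elim
    case (elim v)
    obtain n where "v < real n" using reals_Archimedean2 by blast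
    then have "v < real (Suc n)" by simp
    with elim show ?case by blast
  qed
  with not_AE_H_zero show False ..
qed

text \<open>The factor 3/2 exceeds 1, so \<open>3/2 * c1\<close> lies strictly beyond the left end
  of the support even when \<open>c1 = c0\<close>.\<close>

lemma lower_moment_c1_pos: "lower_moment (3/2 * c1) > 0"
proof -
  have "c0 < 3/2 * c1" using \<delta>(1) by (auto simp: c1_def max_def)
  then obtain t where "t \<in> {t. 0 < t \<and> lower_moment t > 0}" "t < 3/2 * c1"
    unfolding c0_def using lower_moment_pos_ex by (subst (asm) cInf_less_iff) (auto intro: bdd_belowI[of _ 0])
  then show ?thesis using lower_moment_mono[of t "3/2 * c1"] by (auto intro: less_le_trans)
qed

lemma AE_H_zero_c0: "AE v in lborel. v < c0 \<longrightarrow> H v = 0"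
proof -
  have N0: "lower_moment t = 0" if "t < c0" for t
  proof (rule ccontr)
    assume nz: "lower_moment t \<noteq> 0"
    have "t > 0"
    proof (rule ccontr)
      assume "\<not> t > 0"
      then have "lower_moment t = 0" by (simp add: lower_moment_def)
      with nz show False ..
    qed
    then have "c0 \<le> t" unfolding c0_def using nz
      by (intro cInf_lower) (auto intro: bdd_belowI[of _ 0] simp: zero_less_iff_neq_zero)
    with that show False by simp
  qed
  have "AE v in lborel. v < c0 - 1 / real (Suc n) \<longrightarrow> H v = 0" for n
    by (rule lower_moment_zero_AE, rule N0) simp
  then have "AE v in lborel. \<forall>n. v < c0 - 1 / real (Suc n) \<longrightarrow> H v = 0" unfolding AE_all_countable by blast
  then show ?thesis
  proof eventually_elim
    case (elim v)
    show ?case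
    proof
      assume "v < c0"
      then obtain n where "1 / real (Suc n) < c0 - v" by (metis diff_gt_0_iff_gt nat_approx_posE)
      then have "v < c0 - 1 / real (Suc n)" by simp
      with elim show "H v = 0" by blast
    qed
  qed
qed

text \<open>For u >= \<open>c1\<close> the truncated mass lies at v < 3u/2, where the exponential is
  at least exp (-3 s u / 4). The loss is exp (s u / 4) as near 0, and the denominator depends
  neither on u nor on s.\<close>

lemma large_bound:
  assumes s: "s \<ge> 0" and u: "c1 \<le> u"
  shows "ennreal (u powr k * exp (- s * u / 2) * H u)
     \<le> ennreal (u powr k * H u) / lower_moment (3/2 * c1) * ennreal (exp (s * u / 4)) * \<Psi> s"
proof -
  have u0: "u > 0" using u \<delta> by (simp add: c1_def)
  let ?N = "lower_moment (3/2 * c1)"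
  have Nfin: "?N < \<infinity>"
  proof -
    have "?N \<le> (\<integral>\<^sup>+u. ennreal (u powr k * H u) \<partial>lborel)"
      unfolding lower_moment_def by (intro nn_integral_mono) (auto simp: indicator_def)
    then show ?thesis using moment_finite by (rule le_less_trans)
  qed
  have "ennreal (exp (- 3/4 * s * u)) * ?N \<le> \<Psi> s"
  proof -
    have "ennreal (exp (- 3/4 * s * u)) * (ennreal (v powr k * H v) * indicator {0<..<3/2 * c1} v)
        \<le> ennreal (v powr k * exp (- s * v / 2) * H v)" for v
    proof (cases "0 < v \<and> v < 3/2 * c1")
      case True
      then have "s * v \<le> s * (3/2 * u)" using s u by (intro mult_left_mono) auto
      then have "exp (- 3/4 * s * u) \<le> exp (- s * v / 2)" by simp
      then have "exp (- 3/4 * s * u) * (v powr k * H v) \<le> exp (- s * v / 2) * (v powr k * H v)"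
        using H_nonneg by (intro mult_right_mono) auto
      then have "ennreal (exp (- 3/4 * s * u) * (v powr k * H v)) \<le> ennreal (v powr k * exp (- s * v / 2) * H v)"
        by (intro ennreal_leI) (simp add: mult_ac)
      then show ?thesis using True by (simp add: ennreal_mult' H_nonneg)
    qed (auto simp: indicator_def)
    then show ?thesis unfolding lower_moment_def \<Psi>_def
      by (subst nn_integral_cmult[symmetric]) (auto intro!: nn_integral_mono)
  qed
  then have "ennreal (u powr k * H u) / ?N * ennreal (exp (s * u / 4)) * (ennreal (exp (- 3/4 * s * u)) * ?N)
    \<le> ennreal (u powr k * H u) / ?N * ennreal (exp (s * u / 4)) * \<Psi> s"
    by (intro mult_left_mono) auto
  moreover have "ennreal (u powr k * H u) / ?N * ennreal (exp (s * u / 4)) * (ennreal (exp (- 3/4 * s * u)) * ?N)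
    = (ennreal (u powr k * H u) * (ennreal (exp (s * u / 4)) * ennreal (exp (- 3/4 * s * u)))) * (?N / ?N)"
    by (simp add: ennreal_times_divide ennreal_divide_times mult_ac divide_ennreal_def)
  moreover have "?N / ?N = 1" using Nfin lower_moment_c1_pos by (simp add: ennreal_divide_self less_top[symmetric])
  moreover have "exp (s * u / 4) * exp (- 3/4 * s * u) = exp (- s * u / 2)"
    by (simp add: exp_add[symmetric])
  then have "ennreal (exp (s * u / 4)) * ennreal (exp (- 3/4 * s * u)) = ennreal (exp (- s * u / 2))"
    by (simp add: ennreal_mult[symmetric])
  moreover have "ennreal (u powr k * exp (- s * u / 2) * H u) = ennreal (u powr k * H u) * ennreal (exp (- s * u / 2))"
    using H_nonneg by (simp add: ennreal_mult[symmetric] mult_ac)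
  ultimately show ?thesis by simp
qed

text \<open>On \<open>[\<delta>, c\<^sub>0)\<close> the density \<open>h\<close> vanishes almost everywhere; the value \<open>\<infinity>\<close> makes the pointwise bound hold
  on the exceptional null set as well.\<close>

definition majorant :: "real \<Rightarrow> ennreal" where
  "majorant u = (if u \<le> 0 then 0 else if u < \<delta> then ennreal (4 / cg * u powr (\<epsilon> - 1))
    else if u < c1 then (if H u = 0 then 0 else \<infinity>)
    else ennreal (u powr k * H u) / lower_moment (3/2 * c1))"

lemma majorant_measurable[measurable]: "majorant \<in> borel_measurable borel"
proof -
  have [measurable]: "(\<lambda>u. if H u = 0 then 0 else (\<infinity>::ennreal)) \<in> borel_measurable borel"
    by (intro measurable_If) (simp_all add: pred_def[symmetric])
  show ?thesis unfolding majorant_def[abs_def] by measurable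
qed

lemma majorant_bound:
  assumes "s \<ge> 0"
  shows "ennreal (u powr k * exp (- s * u / 2) * H u) \<le> majorant u * ennreal (exp (s * u / 4)) * \<Psi> s"
proof -
  consider "u \<le> 0" | "0 < u" "u < \<delta>" | "\<delta> \<le> u" "u < c1" | "c1 \<le> u" "\<delta> \<le> u"
    by (auto simp: c1_def) linarith
  then show ?thesis
  proof cases
    \<comment> \<open>Where \<open>H\<close> is not 0 the bound is \<infinity>, because
      \<open>\<Psi>\<close> and the exponential are positive and the product does not collapse to
      0.\<close>
    case 3
    then have "0 < u" using \<delta> by simp
    with 3 \<Psi>_pos[of s] show ?thesis by (simp add: majorant_def ennreal_top_mult)
  next
    case 4
    then have "0 < u" using \<delta> by simp
    with 4 large_bound[OF assms 4(1)] show ?thesis by (simp add: majorant_def)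
  qed (use small_bound[OF assms] in \<open>auto simp: majorant_def H_nonpos\<close>)
qed

text \<open>Near 0 the exponent \<epsilon> - 1 exceeds -1; in the middle range the function vanishes
  almost everywhere; beyond \<open>c1\<close> it is a multiple of the integrand of a finite
  moment.\<close>

lemma majorant_finite: "(\<integral>\<^sup>+u. majorant u \<partial>lborel) < \<infinity>"
proof -
  let ?F = "\<lambda>u. ennreal (4 / cg) * (ennreal (u powr (\<epsilon> - 1)) * indicator {0..1} u) + ennreal (u powr k * H u) / lower_moment (3/2 * c1)"
  have ae: "AE u in lborel. majorant u \<le> ?F u"
    using AE_H_zero_c0
  proof eventually_elim
    case (elim u)
    consider "u \<le> 0" | "0 < u" "u < \<delta>" | "0 < u" "\<delta> \<le> u" "u < c1" | "0 < u" "c1 \<le> u" "\<delta> \<le> u"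
      using \<delta>(1) not_le by blast
    then show ?case
    proof cases
      case 2
      then have "majorant u = ennreal (4 / cg) * (ennreal (u powr (\<epsilon> - 1)) * indicator {0..1} u)"
        using \<delta> cg unfolding majorant_def by (subst ennreal_mult) auto
      then show ?thesis by simp
    next
      case 3
      then have "H u = 0" using elim by (auto simp: c1_def)
      with 3 show ?thesis by (simp add: majorant_def)
    qed (auto simp: majorant_def)
  qed
  have "(\<integral>\<^sup>+u. majorant u \<partial>lborel) \<le> (\<integral>\<^sup>+u. ?F u \<partial>lborel)" by (rule nn_integral_mono_AE[OF ae])
  also have "\<dots> = ennreal (4 / cg) * (\<integral>\<^sup>+u. ennreal (u powr (\<epsilon> - 1)) * indicator {0..1} u \<partial>lborel) + (\<integral>\<^sup>+u. ennreal (u powr k * H u) \<partial>lborel) / lower_moment (3/2 * c1)"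
    by (simp add: nn_integral_add nn_integral_cmult nn_integral_divide)
  also have "\<dots> < \<infinity>"
  proof -
    have "((\<lambda>u. u powr (\<epsilon> - 1)) has_integral (1 powr (\<epsilon> - 1 + 1) / (\<epsilon> - 1 + 1))) {0..1}"
      by (rule has_integral_powr_from_0) (use \<epsilon> in auto)
    then have "((\<lambda>u. u powr (\<epsilon> - 1)) has_integral (1 / \<epsilon>)) {0..1}" by simp
    from nn_integral_has_integral_lborel[OF _ _ this[unfolded has_integral_restrict_UNIV[symmetric, of _ _ "{0..1}"]]]
    have "(\<integral>\<^sup>+u. ennreal (if u \<in> {0..1} then u powr (\<epsilon> - 1) else 0) \<partial>lborel) = ennreal (1 / \<epsilon>)"
      by auto
    also have "(\<lambda>u. ennreal (if u \<in> {0..1} then u powr (\<epsilon> - 1) else 0)) = (\<lambda>u. ennreal (u powr (\<epsilon> - 1)) * indicator {0..1} u)"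
      by (auto simp: indicator_def)
    finally have "(\<integral>\<^sup>+u. ennreal (u powr (\<epsilon> - 1)) * indicator {0..1} u \<partial>lborel) < \<infinity>" by simp
    moreover have "(\<integral>\<^sup>+u. ennreal (u powr k * H u) \<partial>lborel) / lower_moment (3/2 * c1) < \<infinity>"
      using moment_finite lower_moment_c1_pos unfolding zero_less_iff_neq_zero
        by (simp add: ennreal_divide_eq_top_iff less_top[symmetric])
    ultimately show ?thesis by (simp add: ennreal_mult_less_top)
  qed
  finally show ?thesis .
qed

text \<open>Near 0 \<open>h\<close> is at most a multiple of \<open>g\<close>, which decays faster
  than every power. Negative powers of u come from the behaviour of \<open>G\<close> near the
  boundary of the orthant and enter the total mass of the posterior.\<close>

lemma negative_moment_finite:
  assumes \<kappa>: "\<kappa> \<le> 0"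
  shows "(\<integral>\<^sup>+u. ennreal (u powr k * H u * max 1 (u powr \<kappa>)) \<partial>lborel) < \<infinity>"
proof -
  define C where "C = H \<delta> / g_fun \<rho> \<tau> \<delta> * exp ((\<tau> + k + \<kappa>)\<^sup>2 / (4 * \<rho>))"
  have C: "C \<ge> 0" using H_nonneg g_pos[of \<delta>] by (simp add: C_def)
  have le: "u powr k * H u * max 1 (u powr \<kappa>) \<le> (1 + \<delta> powr \<kappa>) * (u powr k * H u) + C * indicator {0..1} u" for u
  proof -
    have kH: "u powr k * H u \<ge> 0" using H_nonneg by simp
    consider "u \<le> 0" | "0 < u" "u < \<delta>" | "\<delta> \<le> u" by linarith
    then show ?thesis
    proof cases
      case 1
      then show ?thesis using C by (simp add: H_nonpos)
    next
      case 2
      have "H u * (g_fun \<rho> \<tau> \<delta> / g_fun \<rho> \<tau> u) \<le> H \<delta>"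
        using 2 \<delta> by (intro H_ratio) auto
      then have "H u \<le> H \<delta> / g_fun \<rho> \<tau> \<delta> * g_fun \<rho> \<tau> u"
        using g_pos[of u] g_pos[of \<delta>] by (simp add: field_simps)
      then have "u powr k * H u * u powr \<kappa> \<le> u powr k * (H \<delta> / g_fun \<rho> \<tau> \<delta> * g_fun \<rho> \<tau> u) * u powr \<kappa>"
        by (intro mult_right_mono mult_left_mono) auto
      also have "\<dots> = H \<delta> / g_fun \<rho> \<tau> \<delta> * (u powr k * g_fun \<rho> \<tau> u * u powr \<kappa>)" by simp
      also have "u powr k * g_fun \<rho> \<tau> u * u powr \<kappa> = exp (- \<rho> * (ln u)\<^sup>2 + (\<tau> + k + \<kappa>) * ln u)"
        using 2 by (simp add: g_fun_def powr_def exp_add[symmetric]) (simp add: algebra_simps)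
      also have "H \<delta> / g_fun \<rho> \<tau> \<delta> * exp (- \<rho> * (ln u)\<^sup>2 + (\<tau> + k + \<kappa>) * ln u) \<le> C"
      proof -
        let ?b = "\<tau> + k + \<kappa>" and ?L = "ln u"
        \<comment> \<open>The quadratic -\<rho> L^2 + b L in L = ln u has its maximum b^2 / (4
          \<rho>) at L = t; this is the origin of the exponential in \<open>C\<close>.\<close>
        define t where "t = ?b / (2 * \<rho>)"
        have b: "?b = 2 * \<rho> * t" using \<rho> by (simp add: t_def)
        have "?b\<^sup>2 / (4 * \<rho>) = \<rho> * t\<^sup>2" unfolding b using \<rho> by (simp add: power2_eq_square)
        moreover have "- \<rho> * ?L\<^sup>2 + ?b * ?L = \<rho> * t\<^sup>2 - \<rho> * (?L - t)\<^sup>2"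
          unfolding b by (simp add: power2_eq_square algebra_simps)
        moreover have "0 \<le> \<rho> * (?L - t)\<^sup>2" using \<rho> by simp
        ultimately have "- \<rho> * ?L\<^sup>2 + ?b * ?L \<le> ?b\<^sup>2 / (4 * \<rho>)" by linarith
        then show ?thesis
          unfolding C_def using H_nonneg g_pos[of \<delta>] by (intro mult_left_mono) auto
      qed
      finally have "u powr k * H u * u powr \<kappa> \<le> C" .
      moreover have "0 \<le> \<delta> powr \<kappa> * (u powr k * H u)" using kH by simp
      moreover have "u powr k * H u * max 1 (u powr \<kappa>) \<le> u powr k * H u + u powr k * H u * u powr \<kappa>"
        using kH by (auto simp: max_def mult_nonneg_nonneg)
      ultimately show ?thesis using 2 \<delta> by (simp add: distrib_right)
    next
      case 3
      then have "u powr \<kappa> \<le> \<delta> powr \<kappa>" using \<delta> \<kappa> by (intro powr_mono2') auto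
      then have "max 1 (u powr \<kappa>) \<le> 1 + \<delta> powr \<kappa>" by auto
      then have "u powr k * H u * max 1 (u powr \<kappa>) \<le> u powr k * H u * (1 + \<delta> powr \<kappa>)"
        using kH by (intro mult_left_mono)
      then show ?thesis using C by (simp add: mult.commute indicator_def)
    qed
  qed
  have "(\<integral>\<^sup>+u. ennreal (u powr k * H u * max 1 (u powr \<kappa>)) \<partial>lborel)
    \<le> (\<integral>\<^sup>+u. ennreal (1 + \<delta> powr \<kappa>) * ennreal (u powr k * H u) + ennreal C * indicator {0..1} u \<partial>lborel)"
  proof (rule nn_integral_mono)
    fix u
    have "ennreal (u powr k * H u * max 1 (u powr \<kappa>)) \<le> ennreal ((1 + \<delta> powr \<kappa>) * (u powr k * H u) + C * indicator {0..1} u)"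
      by (rule ennreal_leI[OF le])
    also have "\<dots> = ennreal (1 + \<delta> powr \<kappa>) * ennreal (u powr k * H u) + ennreal C * indicator {0..1} u"
      using H_nonneg C by (subst ennreal_plus) (auto simp: ennreal_mult indicator_def)
    finally show "ennreal (u powr k * H u * max 1 (u powr \<kappa>)) \<le> ennreal (1 + \<delta> powr \<kappa>) * ennreal (u powr k * H u) + ennreal C * indicator {0..1} u" .
  qed
  also have "\<dots> = ennreal (1 + \<delta> powr \<kappa>) * (\<integral>\<^sup>+u. ennreal (u powr k * H u) \<partial>lborel) + ennreal C"
    by (simp add: nn_integral_add nn_integral_cmult nn_integral_cmult_indicator)
  also have "\<dots> < \<infinity>" using moment_finite by (simp add: ennreal_mult_less_top)
  finally show ?thesis .
qed

end

section \<open>The data augmentation chain\<close>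

lemma borel_measurable_matrixI:
  fixes f :: "'a \<Rightarrow> real^'m^'n"
  assumes "\<And>i j. (\<lambda>x. f x $ i $ j) \<in> borel_measurable M"
  shows "f \<in> borel_measurable M"
  by (intro borel_measurable_euclidean_space[THEN iffD2]) (use assms in \<open>auto simp: Basis_vec_def inner_axis\<close>)

lemma borel_measurable_entry[measurable (raw)]:
  fixes f :: "'a \<Rightarrow> real^'m^'n"
  assumes [measurable]: "f \<in> borel_measurable M" shows "(\<lambda>x. f x $ i $ j) \<in> borel_measurable M"
proof -
  have "(\<lambda>A::real^'m^'n. A $ i $ j) \<in> borel_measurable borel"
    by (intro borel_measurable_continuous_onI continuous_on_component continuous_on_id)
  then show ?thesis by measurable
qed

lemma borel_measurable_coordinate[measurable (raw)]:
  fixes f :: "'a \<Rightarrow> real^'n"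
  assumes [measurable]: "f \<in> borel_measurable M" shows "(\<lambda>x. f x $ i) \<in> borel_measurable M"
proof -
  have "(\<lambda>A::real^'n. A $ i) \<in> borel_measurable borel"
    by (intro borel_measurable_continuous_onI continuous_on_component continuous_on_id)
  then show ?thesis by measurable
qed

lemma borel_measurable_det[measurable (raw)]:
  fixes f :: "'a \<Rightarrow> real^'n^'n"
  assumes [measurable]: "f \<in> borel_measurable M" shows "(\<lambda>x. det (f x)) \<in> borel_measurable M"
  unfolding det_def by measurable

text \<open>Makes the entries of the inverse quotients of determinants, hence measurable on positive
  definite matrices.\<close>

lemma matrix_inv_cramer:
  fixes A :: "real^'n^'n"
  assumes "det A \<noteq> 0"
  shows "matrix_inv A $ k $ j = det (\<chi> i l. if l = k then axis j 1 $ i else A $ i $ l) / det A"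
proof -
  have inv: "A ** matrix_inv A = mat 1" using assms by (simp add: matrix_inv_works invertible_det_nz)
  have "A *v (matrix_inv A *v axis j 1) = axis j 1"
    by (simp add: matrix_vector_mul_assoc inv)
  then have "matrix_inv A *v axis j 1 = (\<chi> k. det (\<chi> i l. if l = k then axis j 1 $ i else A $ i $ l) / det A)"
    using cramer[OF assms] by blast
  then have "(matrix_inv A *v axis j 1) $ k = det (\<chi> i l. if l = k then axis j 1 $ i else A $ i $ l) / det A"
    by simp
  then show ?thesis by (simp add: matrix_vector_mult_basis column_def)
qed

lemma measurable_posdef_borel[measurable]: "(\<lambda>S. S) \<in> measurable posdef_lborel borel"
  by (rule measurable_posdef_lborel) measurable

lemma borel_measurable_matrix_inv[measurable]: "(matrix_inv :: real^'d^'d \<Rightarrow> _) \<in> borel_measurable posdef_lborel"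
proof (rule borel_measurable_matrixI)
  fix k j :: 'd
  have [measurable]: "(\<lambda>S. (\<chi> i l. if l = k then axis j 1 $ i else S $ i $ l) :: real^'d^'d) \<in> borel_measurable posdef_lborel"
    by (rule borel_measurable_matrixI) simp
  have "(\<lambda>S::real^'d^'d. det (\<chi> i l. if l = k then axis j 1 $ i else S $ i $ l) / det S) \<in> borel_measurable posdef_lborel"
    by measurable
  then show "(\<lambda>S::real^'d^'d. matrix_inv S $ k $ j) \<in> borel_measurable posdef_lborel"
    by (rule measurable_cong[THEN iffD1, rotated])
       (use pos_def_det_pos in \<open>fastforce simp: matrix_inv_cramer[OF less_imp_neq[THEN not_sym]]\<close>)
qed

text \<open>The coordinate form, from which measurability and the scaling in \<Sigma> are read
  off.\<close>

lemma mahalanobis_sum: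
  "mahalanobis X y \<beta> \<Sigma> i = (\<Sum>k\<in>UNIV. \<Sum>l\<in>UNIV. (y $ i $ k - (\<Sum>j\<in>UNIV. \<beta> $ j $ k * X $ i $ j)) *
    (matrix_inv \<Sigma> $ k $ l * (y $ i $ l - (\<Sum>j\<in>UNIV. \<beta> $ j $ l * X $ i $ j))))"
  unfolding mahalanobis_def Let_def inner_vec_def
  by (simp add: matrix_vector_mult_def transpose_def sum_distrib_left del: transpose_matrix_vector)

lemma sets_state_measure: "sets state_measure = sets (borel \<Otimes>\<^sub>M posdef_lborel)"
  unfolding state_measure_def by (rule sets_pair_measure_cong) simp_all

lemma space_state_measure: "space state_measure = UNIV \<times> {S. pos_def S}"
  by (simp add: state_measure_def space_pair_measure)

lemma fst_state_measurable[measurable]: "fst \<in> measurable state_measure borel"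
  unfolding state_measure_def by (rule measurable_compose[OF measurable_fst]) simp

lemma snd_state_measurable'[measurable]: "snd \<in> measurable state_measure posdef_lborel"
  unfolding state_measure_def by (rule measurable_snd)

lemma snd_state_measurable[measurable]: "snd \<in> measurable state_measure borel"
  by (rule measurable_compose[OF snd_state_measurable' measurable_posdef_borel])

lemma det_scaleR: "det (c *\<^sub>R A :: real^'n^'n) = c ^ CARD('n) * det A"
proof -
  have "c *\<^sub>R A = (\<chi> i. c *s A $ i)" by (simp add: vec_eq_iff scalar_mult_eq_scaleR)
  then show ?thesis using det_rows_mul[of "\<lambda>_. c" "\<lambda>i. A $ i"] by simp
qed

lemma matrix_inv_scaleR:
  assumes "pos_def S" "c \<noteq> 0" shows "matrix_inv (c *\<^sub>R S) = (1 / c) *\<^sub>R matrix_inv S"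
proof (rule matrix_inv_eqI)
  have "(c *\<^sub>R S) ** ((1 / c) *\<^sub>R matrix_inv S) = S ** matrix_inv S"
    using assms(2) by (simp add: matrix_scalar_ac scalar_matrix_assoc scalar_mult_eq_scaleR[symmetric] matrix_matrix_mult_def vec_eq_iff)
  then show "(c *\<^sub>R S) ** ((1 / c) *\<^sub>R matrix_inv S) = mat 1"
    using matrix_inv_works[OF pos_def_invertible[OF assms(1)]] by simp
qed

lemma mahalanobis_nonneg:
  assumes "pos_def \<Sigma>" shows "mahalanobis X y \<beta> \<Sigma> i \<ge> 0"
proof -
  have "w \<bullet> (matrix_inv \<Sigma> *v w) \<ge> 0" for w
    using matrix_inv_pos_def(1)[OF assms] by (cases "w = 0") (auto simp: pos_def_def less_imp_le)
  then show ?thesis by (simp add: mahalanobis_def Let_def)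
qed

lemma mahalanobis_scaleR:
  assumes "pos_def \<Sigma>" "c \<noteq> 0"
  shows "mahalanobis X y \<beta> (c *\<^sub>R \<Sigma>) i = mahalanobis X y \<beta> \<Sigma> i / c"
  by (simp add: mahalanobis_sum matrix_inv_scaleR[OF assms] sum_divide_distrib mult_ac)

section \<open>The unnormalized joint density and its homogeneity\<close>

locale da_chain = regression X y + mixing h "real CARD('d) / 2" \<rho> \<tau> \<eta>
  for X :: "real^'p^'n" and y :: "real^'d^'n" and h \<rho> \<tau> \<eta> +
  fixes a :: real
begin

abbreviation "D \<equiv> (state_measure :: ((real^'d^'p) \<times> (real^'d^'d)) measure)"

definition posZ :: "(real^'n) set" where "posZ = {z. \<forall>i. 0 < z $ i}"

definition E :: "(real^'d^'p) \<times> (real^'d^'d) \<Rightarrow> real^'n \<Rightarrow> real" where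
  "E x z = (\<Sum>i\<in>UNIV. z $ i * mahalanobis X y (fst x) (snd x) i)"

definition \<phi> :: "(real^'d^'p) \<times> (real^'d^'d) \<Rightarrow> real^'n \<Rightarrow> real" where
  "\<phi> x z = det (snd x) powr (- (real CARD('n) / 2 + a)) * exp (- E x z / 2)"

definition G :: "real^'n \<Rightarrow> ennreal" where "G z = (\<integral>\<^sup>+x. ennreal (\<phi> x z) \<partial>D)"

lemma sigma_finite_D: "sigma_finite_measure D"
proof -
  interpret pair_sigma_finite "lborel :: (real^'d^'p) measure" "posdef_lborel :: (real^'d^'d) measure"
    by (intro pair_sigma_finite.intro sigma_finite_posdef_lborel lborel.sigma_finite_measure_axioms)
  show ?thesis unfolding state_measure_def by (rule P.sigma_finite_measure_axioms)
qed

lemma pair_sigma_finite_D: "pair_sigma_finite (lborel :: (real^'d^'p) measure) (posdef_lborel :: (real^'d^'d) measure)"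
  by (intro pair_sigma_finite.intro sigma_finite_posdef_lborel lborel.sigma_finite_measure_axioms)

lemma posZ_measurable[measurable]: "posZ \<in> sets borel"
  unfolding posZ_def by measurable

lemma mahalanobis_measurable[measurable]:
  "(\<lambda>x. mahalanobis X y (fst x) (snd x) i) \<in> borel_measurable D"
proof -
  have [measurable]: "(\<lambda>x. matrix_inv (snd x)) \<in> borel_measurable D"
    by (rule measurable_compose[OF snd_state_measurable' borel_measurable_matrix_inv])
  show ?thesis unfolding mahalanobis_sum by measurable
qed

lemma E_measurable[measurable]: "(\<lambda>(x, z). E x z) \<in> borel_measurable (D \<Otimes>\<^sub>M borel)"
  unfolding E_def by measurable

lemma \<phi>_measurable[measurable]: "(\<lambda>(x, z). \<phi> x z) \<in> borel_measurable (D \<Otimes>\<^sub>M borel)"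
  unfolding \<phi>_def by measurable

lemma \<phi>_measurable1[measurable]: "(\<lambda>x. \<phi> x z) \<in> borel_measurable D"
  using measurable_compose[OF measurable_Pair2' \<phi>_measurable] by simp

lemma \<phi>_measurable2[measurable]: "x \<in> space D \<Longrightarrow> (\<lambda>z. \<phi> x z) \<in> borel_measurable borel"
  using measurable_compose[OF measurable_Pair1' \<phi>_measurable] by simp

lemma G_measurable[measurable]: "G \<in> borel_measurable borel"
proof -
  interpret sigma_finite_measure D by (rule sigma_finite_D)
  have "(\<lambda>(z, x). ennreal (\<phi> x z)) \<in> borel_measurable (borel \<Otimes>\<^sub>M D)"
    using measurable_compose[OF measurable_pair_swap' measurable_compose[OF \<phi>_measurable measurable_ennreal]]
    by (simp add: case_prod_beta')
  then show ?thesis unfolding G_def[abs_def] by (rule borel_measurable_nn_integral)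
qed

lemma \<phi>_pos: "x \<in> space D \<Longrightarrow> \<phi> x z > 0"
  using pos_def_det_pos[of "snd x"] by (auto simp: \<phi>_def space_state_measure)

lemma \<phi>_antimono:
  assumes x: "x \<in> space D" and le: "\<And>i. z $ i \<le> z' $ i" shows "\<phi> x z' \<le> \<phi> x z"
proof -
  have "E x z \<le> E x z'"
    unfolding E_def using x le by (intro sum_mono mult_right_mono mahalanobis_nonneg) (auto simp: space_state_measure)
  then show ?thesis unfolding \<phi>_def by (intro mult_left_mono) auto
qed

lemma G_antimono: "(\<And>i. z $ i \<le> z' $ i) \<Longrightarrow> G z' \<le> G z"
  unfolding G_def by (intro nn_integral_mono ennreal_leI \<phi>_antimono)

text \<open>The first term is the Jacobian exponent of scaling \<Sigma>; the second comes from the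
  power of the determinant in \<open>\<phi>\<close>.\<close>

definition \<kappa> :: real where
  "\<kappa> = real (card (sym_index :: 'd set set)) - real CARD('d) * (real CARD('n) / 2 + a)"

lemma nn_integral_D:
  assumes [measurable]: "f \<in> borel_measurable D"
  shows "(\<integral>\<^sup>+x. f x \<partial>D) = (\<integral>\<^sup>+\<Sigma>. \<integral>\<^sup>+\<beta>. f (\<beta>, \<Sigma>) \<partial>lborel \<partial>posdef_lborel)"
  using pair_sigma_finite.nn_integral_snd[OF pair_sigma_finite_D, of f] assms by (simp add: state_measure_def)

text \<open>Multiplying z by t has the same effect on \<open>E\<close> as dividing \<Sigma> by t;
  only the determinant changes, by a factor t to the power d.\<close>

lemma \<phi>_scale:
  assumes t: "t > 0" and \<Sigma>: "pos_def \<Sigma>"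
  shows "\<phi> (\<beta>, \<Sigma>) (t *\<^sub>R z) = t powr (- real CARD('d) * (real CARD('n) / 2 + a)) * \<phi> (\<beta>, (1 / t) *\<^sub>R \<Sigma>) z"
proof -
  have "E (\<beta>, (1 / t) *\<^sub>R \<Sigma>) z = E (\<beta>, \<Sigma>) (t *\<^sub>R z)"
    using t by (simp add: E_def mahalanobis_scaleR[OF \<Sigma>] mult_ac)
  moreover have "det \<Sigma> powr b = (t powr real CARD('d)) powr b * det ((1 / t) *\<^sub>R \<Sigma>) powr b" for b
  proof -
    have "det \<Sigma> = t powr real CARD('d) * det ((1 / t) *\<^sub>R \<Sigma>)"
      using t by (simp add: det_scaleR powr_realpow power_one_over)
    then show ?thesis using t pos_def_det_pos[OF pos_def_scaleR[OF _ \<Sigma>], of "1 / t"]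
      by (metis less_imp_le powr_mult powr_ge_zero zero_less_divide_1_iff)
  qed
  ultimately show ?thesis
    unfolding \<phi>_def fst_conv snd_conv by (simp only: powr_powr mult_minus_right mult_minus_left mult.assoc)
qed

lemma G_scale:
  assumes t: "t > 0"
  shows "G (t *\<^sub>R z) = ennreal (t powr \<kappa>) * G z"
proof -
  interpret pair_sigma_finite "lborel :: (real^'d^'p) measure" "posdef_lborel :: (real^'d^'d) measure"
    by (rule pair_sigma_finite_D)
  let ?b = "- real CARD('d) * (real CARD('n) / 2 + a)" and ?N = "card (sym_index :: 'd set set)"
  define g where "g \<Sigma> = (\<integral>\<^sup>+\<beta>. ennreal (\<phi> (\<beta>, \<Sigma>) z) \<partial>lborel)" for \<Sigma>
  have [measurable]: "(\<lambda>p. ennreal (\<phi> p z)) \<in> borel_measurable (lborel \<Otimes>\<^sub>M posdef_lborel)"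
    using \<phi>_measurable1[of z] unfolding state_measure_def by measurable
  have gm: "g \<in> borel_measurable posdef_lborel"
    unfolding g_def[abs_def] by measurable
  have m1: "(\<lambda>\<beta>. \<phi> (\<beta>, \<Sigma>) z) \<in> borel_measurable lborel" if "pos_def \<Sigma>" for \<Sigma> z
  proof -
    have "(\<lambda>\<beta>. (\<beta>, \<Sigma>)) \<in> measurable lborel D"
      unfolding state_measure_def using that by (intro measurable_Pair) auto
    from measurable_compose[OF this \<phi>_measurable1[of z]] show ?thesis .
  qed
  have gm': "(\<lambda>\<Sigma>. g \<Sigma> * indicator {S. pos_def S} \<Sigma>) \<in> borel_measurable borel"
    using gm unfolding posdef_lborel_def
    by (subst (asm) borel_measurable_restrict_space_iff_ennreal) (simp_all add: measurable_cong_sets[OF sets_sym_lborel refl])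
  have "G (t *\<^sub>R z) = (\<integral>\<^sup>+\<Sigma>. \<integral>\<^sup>+\<beta>. ennreal (\<phi> (\<beta>, \<Sigma>) (t *\<^sub>R z)) \<partial>lborel \<partial>posdef_lborel)"
    unfolding G_def by (rule nn_integral_D) measurable
  also have "\<dots> = (\<integral>\<^sup>+\<Sigma>. ennreal (t powr ?b) * g ((1 / t) *\<^sub>R \<Sigma>) \<partial>posdef_lborel)"
  proof (rule nn_integral_cong)
    fix \<Sigma> assume "\<Sigma> \<in> space (posdef_lborel :: (real^'d^'d) measure)"
    then have \<Sigma>: "pos_def \<Sigma>" by simp
    have "pos_def ((1 / t) *\<^sub>R \<Sigma>)" using t \<Sigma> by (simp add: pos_def_scaleR)
    from m1[OF this, of z] have [measurable]: "(\<lambda>\<beta>. \<phi> (\<beta>, (1 / t) *\<^sub>R \<Sigma>) z) \<in> borel_measurable lborel" .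
    have "\<phi> (\<beta>, (1 / t) *\<^sub>R \<Sigma>) z \<ge> 0" for \<beta> by (simp add: \<phi>_def)
    then have "(\<integral>\<^sup>+\<beta>. ennreal (\<phi> (\<beta>, \<Sigma>) (t *\<^sub>R z)) \<partial>lborel) = (\<integral>\<^sup>+\<beta>. ennreal (t powr ?b) * ennreal (\<phi> (\<beta>, (1 / t) *\<^sub>R \<Sigma>) z) \<partial>lborel)"
      unfolding \<phi>_scale[OF t \<Sigma>] by (simp add: ennreal_mult)
    then show "(\<integral>\<^sup>+\<beta>. ennreal (\<phi> (\<beta>, \<Sigma>) (t *\<^sub>R z)) \<partial>lborel) = ennreal (t powr ?b) * g ((1 / t) *\<^sub>R \<Sigma>)"
      unfolding g_def by (subst (asm) nn_integral_cmult) auto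
  qed
  also have "\<dots> = ennreal (t powr ?b) * (\<integral>\<^sup>+\<Sigma>. g ((1 / t) *\<^sub>R \<Sigma>) \<partial>posdef_lborel)"
  proof (rule nn_integral_cmult)
    have "(\<lambda>\<Sigma>::real^'d^'d. (1 / t) *\<^sub>R \<Sigma>) \<in> measurable posdef_lborel posdef_lborel"
      unfolding posdef_lborel_def using t
      by (intro measurable_restrict_space3) (auto simp: pos_def_scaleR measurable_cong_sets[OF sets_sym_lborel sets_sym_lborel])
    from measurable_compose[OF this gm] show "(\<lambda>\<Sigma>. g ((1 / t) *\<^sub>R \<Sigma>)) \<in> borel_measurable posdef_lborel" .
  qed
  \<comment> \<open>The change of variables with factor 1 / t is multiplied through by the inverse
    of its Jacobian.\<close>
  also have "(\<integral>\<^sup>+\<Sigma>. g ((1 / t) *\<^sub>R \<Sigma>) \<partial>posdef_lborel) = ennreal (t ^ ?N) * (\<integral>\<^sup>+\<Sigma>. g \<Sigma> \<partial>posdef_lborel)"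
  proof -
    have "ennreal (t ^ ?N) * (\<integral>\<^sup>+\<Sigma>. g \<Sigma> \<partial>posdef_lborel)
        = ennreal (t ^ ?N) * (ennreal ((1 / t) ^ ?N) * (\<integral>\<^sup>+\<Sigma>. g ((1 / t) *\<^sub>R \<Sigma>) \<partial>posdef_lborel))"
      using nn_integral_posdef_lborel_scale[OF _ gm', of "1 / t"] t by simp
    also have "\<dots> = ennreal (t ^ ?N * (1 / t) ^ ?N) * (\<integral>\<^sup>+\<Sigma>. g ((1 / t) *\<^sub>R \<Sigma>) \<partial>posdef_lborel)"
      using t by (subst ennreal_mult) (auto simp: mult.assoc)
    also have "t ^ ?N * (1 / t) ^ ?N = 1" using t by (simp add: power_mult_distrib[symmetric])
    finally show ?thesis by simp
  qed
  also have "(\<integral>\<^sup>+\<Sigma>. g \<Sigma> \<partial>posdef_lborel) = G z"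
    unfolding G_def g_def by (rule nn_integral_D[symmetric]) measurable
  also have "ennreal (t powr ?b) * (ennreal (t ^ ?N) * G z) = ennreal (t powr ?b * t ^ ?N) * G z"
    using t by (subst ennreal_mult) (auto simp: mult.assoc)
  also have "t powr ?b * t ^ ?N = t powr \<kappa>"
    using t by (simp add: \<kappa>_def powr_realpow[symmetric] powr_add[symmetric])
  finally show ?thesis .
qed

text \<open>With t the smallest ratio of coordinates, z' dominates t z, and \<open>G\<close> is
  antitone and homogeneous. Finiteness at a single point thus settles the whole orthant.\<close>

lemma G_finite_iff:
  assumes z: "z \<in> posZ" and z': "z' \<in> posZ" and fin: "G z < \<infinity>" shows "G z' < \<infinity>"
proof -
  define t where "t = Min (range (\<lambda>i. z' $ i / z $ i))"
  have pos: "z' $ i / z $ i > 0" for i using z z' by (simp add: posZ_def)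
  then have t: "t > 0" unfolding t_def by (subst Min_gr_iff) auto
  have "t \<le> z' $ i / z $ i" for i unfolding t_def by (rule Min_le) auto
  then have "(t *\<^sub>R z) $ i \<le> z' $ i" for i
    using z by (simp add: posZ_def pos_le_divide_eq)
  then have "G z' \<le> G (t *\<^sub>R z)" by (rule G_antimono)
  also have "\<dots> < \<infinity>" unfolding G_scale[OF t] using fin by (simp add: ennreal_mult_less_top)
  finally show ?thesis .
qed

text \<open>\<open>\<phi>\<close> is strictly positive, so whether \<open>G\<close> vanishes does
  not depend on z.\<close>

lemma G_zero_iff: "G z = 0 \<longleftrightarrow> emeasure D (space D) = 0"
proof -
  have "G z = 0 \<longleftrightarrow> (AE x in D. ennreal (\<phi> x z) = 0)"
    unfolding G_def by (subst nn_integral_0_iff_AE) auto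
  also have "\<dots> \<longleftrightarrow> (AE x in D. False)"
    by (intro AE_cong) (metis \<phi>_pos ennreal_eq_0_iff not_le)
  also have "\<dots> \<longleftrightarrow> emeasure D (space D) = 0"
    by (simp add: AE_iff_measurable[OF sets.top])
  finally show ?thesis .
qed

end

section \<open>The Gaussian and inverse Wishart conditionals\<close>

lemma nn_integral_lborel_translate:
  fixes f :: "'a::euclidean_space \<Rightarrow> ennreal"
  assumes [measurable]: "f \<in> borel_measurable borel"
  shows "(\<integral>\<^sup>+x. f (x - c) \<partial>lborel) = (\<integral>\<^sup>+x. f x \<partial>lborel)"
proof -
  have "(\<integral>\<^sup>+x. f x \<partial>lborel) = (\<integral>\<^sup>+x. f x \<partial>distr lborel borel ((+) (- c)))"
    by (simp add: lborel_distr_plus)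
  also have "\<dots> = (\<integral>\<^sup>+x. f (- c + x) \<partial>lborel)"
    by (rule nn_integral_distr) measurable
  finally show ?thesis by simp
qed

context da_chain
begin

definition "m = real CARD('n) - real CARD('p) + 2 * a - real CARD('d) - 1"
text \<open>The prefactor of the matrix normal density, without the power of det \<Sigma>; the
  exponent of det (A z) is positive because the row covariance is the inverse of
  \<open>A z\<close>.\<close>

definition "beta_const z = (2 * pi) powr (- (real CARD('p) * real CARD('d)) / 2) * det (A z) powr (real CARD('d) / 2)"

lemma A_pos: "z \<in> posZ \<Longrightarrow> pos_def (A z)" by (rule pos_def_A) (simp add: posZ_def)
lemma S_pos: "z \<in> posZ \<Longrightarrow> pos_def (S z)" by (rule pos_def_S) (simp add: posZ_def)

lemma beta_const_pos: "z \<in> posZ \<Longrightarrow> beta_const z > 0"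
  using pos_def_det_pos[OF A_pos, of z] by (simp add: beta_const_def)

text \<open>Since m + d + 1 = n - p + 2 a, the exponent of the determinant is that of
  \<open>\<phi>\<close> raised by p / 2.\<close>

lemma inv_wishart_kernel_eq:
  "z \<in> posZ \<Longrightarrow> inv_wishart_kernel m (matrix_inv (S z)) \<Sigma>
    = det \<Sigma> powr (- (real CARD('n) / 2 + a) + real CARD('p) / 2) * exp (- (1 / 2) * trace (S z ** matrix_inv \<Sigma>))"
  using matrix_inv_pos_def(2)[OF S_pos, of z]
  by (simp add: inv_wishart_kernel_def m_def field_simps)

lemma E_eq:
  assumes "z \<in> posZ"
  shows "E (\<beta>, \<Sigma>) z = trace (A z ** (\<beta> - \<mu> z) ** matrix_inv \<Sigma> ** transpose (\<beta> - \<mu> z)) + trace (S z ** matrix_inv \<Sigma>)"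
  unfolding E_def using sum_mahalanobis[of z \<beta> \<Sigma>] assms by (simp add: posZ_def)

text \<open>The Gaussian integral over \<beta> yields det \<Sigma> to the power p / 2, exactly the
  shift between \<open>\<phi>\<close> and the inverse Wishart kernel.\<close>

lemma nn_integral_\<phi>_beta:
  assumes z: "z \<in> posZ" and \<Sigma>: "pos_def \<Sigma>"
  shows "ennreal (beta_const z) * (\<integral>\<^sup>+\<beta>. ennreal (\<phi> (\<beta>, \<Sigma>) z) \<partial>lborel) = ennreal (inv_wishart_kernel m (matrix_inv (S z)) \<Sigma>)"
proof -
  let ?B = "matrix_inv \<Sigma>" and ?e = "- (real CARD('n) / 2 + a)"
  let ?c = "det \<Sigma> powr ?e * exp (- (1 / 2) * trace (S z ** ?B))"
  let ?f = "\<lambda>\<beta>. ennreal (exp (- (1 / 2) * trace (A z ** \<beta> ** ?B ** transpose \<beta>)))"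
  note B = matrix_inv_pos_def[OF \<Sigma>]
  have "\<phi> (\<beta>, \<Sigma>) z = ?c * exp (- (1 / 2) * trace (A z ** (\<beta> - \<mu> z) ** ?B ** transpose (\<beta> - \<mu> z)))" for \<beta>
    unfolding \<phi>_def E_eq[OF z] by (simp add: exp_add[symmetric] add_divide_distrib)
  then have "(\<integral>\<^sup>+\<beta>. ennreal (\<phi> (\<beta>, \<Sigma>) z) \<partial>lborel) = (\<integral>\<^sup>+\<beta>. ennreal ?c * ?f (\<beta> - \<mu> z) \<partial>lborel)"
    by (simp add: ennreal_mult)
  also have "\<dots> = ennreal ?c * (\<integral>\<^sup>+\<beta>. ?f (\<beta> - \<mu> z) \<partial>lborel)"
    by (rule nn_integral_cmult) measurable
  also have "(\<integral>\<^sup>+\<beta>. ?f (\<beta> - \<mu> z) \<partial>lborel) = (\<integral>\<^sup>+\<beta>. ?f \<beta> \<partial>lborel)"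
    by (rule nn_integral_lborel_translate) measurable
  also have "\<dots> = ennreal ((2 * pi) powr (real CARD('p) * real CARD('d) / 2) * det (A z) powr (- real CARD('d) / 2) * det ?B powr (- real CARD('p) / 2))"
    by (rule nn_integral_matrix_gaussian[OF A_pos[OF z] B(1)])
  finally have "ennreal (beta_const z) * (\<integral>\<^sup>+\<beta>. ennreal (\<phi> (\<beta>, \<Sigma>) z) \<partial>lborel) =
    ennreal (beta_const z * (?c * ((2 * pi) powr (real CARD('p) * real CARD('d) / 2) * det (A z) powr (- real CARD('d) / 2) * det ?B powr (- real CARD('p) / 2))))"
    using beta_const_pos[OF z] by (simp add: ennreal_mult)
  also have "beta_const z * (?c * ((2 * pi) powr (real CARD('p) * real CARD('d) / 2) * det (A z) powr (- real CARD('d) / 2) * det ?B powr (- real CARD('p) / 2)))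
    = inv_wishart_kernel m (matrix_inv (S z)) \<Sigma>"
  proof -
    have d: "det \<Sigma> > 0" "det (A z) > 0" using pos_def_det_pos[OF \<Sigma>] pos_def_det_pos[OF A_pos[OF z]] by auto
    have dB: "det ?B powr (- real CARD('p) / 2) = det \<Sigma> powr (real CARD('p) / 2)"
      unfolding B(3) using d by (simp add: powr_minus inverse_powr powr_powr[symmetric] powr_divide powr_minus_divide)
    have 1: "(2 * pi) powr (- (real CARD('p) * real CARD('d)) / 2) * (2 * pi) powr (real CARD('p) * real CARD('d) / 2) = 1"
      by (simp add: powr_add[symmetric])
    have 2: "det (A z) powr (real CARD('d) / 2) * det (A z) powr (- real CARD('d) / 2) = 1"
      using d by (simp add: powr_add[symmetric])
    have 3: "det \<Sigma> powr ?e * det \<Sigma> powr (real CARD('p) / 2) = det \<Sigma> powr (?e + real CARD('p) / 2)"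
      by (simp add: powr_add)
    have "beta_const z * (?c * ((2 * pi) powr (real CARD('p) * real CARD('d) / 2) * det (A z) powr (- real CARD('d) / 2) * det ?B powr (- real CARD('p) / 2)))
      = ((2 * pi) powr (- (real CARD('p) * real CARD('d)) / 2) * (2 * pi) powr (real CARD('p) * real CARD('d) / 2))
        * (det (A z) powr (real CARD('d) / 2) * det (A z) powr (- real CARD('d) / 2))
        * (det \<Sigma> powr ?e * det \<Sigma> powr (real CARD('p) / 2)) * exp (- (1 / 2) * trace (S z ** ?B))"
      unfolding beta_const_def dB by (simp only: mult_ac)
    then show ?thesis unfolding 1 2 3 inv_wishart_kernel_eq[OF z] by simp
  qed
  finally show ?thesis .
qed

definition "G_real z = enn2real (G z)"

text \<open>Integrating the identity for the \<beta>-integral over \<Sigma> ties the Wishart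
  constant to \<open>G\<close>. Infinite values are covered too: a divergent Bochner integral and
  \<open>enn2real \<infinity>\<close> are both 0.\<close>

lemma inv_wishart_normalizer:
  assumes z: "z \<in> posZ"
  shows "(LINT v|posdef_lborel. inv_wishart_kernel m (matrix_inv (S z)) v) = beta_const z * G_real z"
proof -
  interpret pair_sigma_finite "lborel :: (real^'d^'p) measure" "posdef_lborel :: (real^'d^'d) measure"
    by (rule pair_sigma_finite_D)
  have [measurable]: "(\<lambda>v. inv_wishart_kernel m (matrix_inv (S z)) v) \<in> borel_measurable posdef_lborel"
    unfolding inv_wishart_kernel_eq[OF z] trace_def matrix_matrix_mult_def vec_lambda_beta by measurable
  have [measurable]: "(\<lambda>p. ennreal (\<phi> p z)) \<in> borel_measurable (lborel \<Otimes>\<^sub>M posdef_lborel)"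
    using \<phi>_measurable1[of z] unfolding state_measure_def by measurable
  have "(LINT v|posdef_lborel. inv_wishart_kernel m (matrix_inv (S z)) v)
    = enn2real (\<integral>\<^sup>+v. ennreal (inv_wishart_kernel m (matrix_inv (S z)) v) \<partial>posdef_lborel)"
    by (rule integral_eq_nn_integral, measurable) (simp add: inv_wishart_kernel_def)
  also have "(\<integral>\<^sup>+v. ennreal (inv_wishart_kernel m (matrix_inv (S z)) v) \<partial>posdef_lborel)
    = (\<integral>\<^sup>+v. ennreal (beta_const z) * (\<integral>\<^sup>+\<beta>. ennreal (\<phi> (\<beta>, v) z) \<partial>lborel) \<partial>posdef_lborel)"
    by (rule nn_integral_cong) (simp add: nn_integral_\<phi>_beta[OF z])
  also have "\<dots> = ennreal (beta_const z) * (\<integral>\<^sup>+v. \<integral>\<^sup>+\<beta>. ennreal (\<phi> (\<beta>, v) z) \<partial>lborel \<partial>posdef_lborel)"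
    by (rule nn_integral_cmult) measurable
  also have "(\<integral>\<^sup>+v. \<integral>\<^sup>+\<beta>. ennreal (\<phi> (\<beta>, v) z) \<partial>lborel \<partial>posdef_lborel) = G z"
    unfolding G_def by (rule nn_integral_D[symmetric]) measurable
  finally show ?thesis using beta_const_pos[OF z] by (simp add: enn2real_mult G_real_def)
qed

text \<open>If the inverse Wishart normalizer is infinite or zero, then both sides are \<open>0\<close>, because \<open>x / 0 = 0\<close>.\<close>

lemma conditional_density_eq:
  assumes z: "z \<in> posZ" and \<Sigma>: "pos_def \<Sigma>"
  shows "cond_beta X y \<Sigma> z \<beta> * cond_Sigma a X y z \<Sigma> = \<phi> (\<beta>, \<Sigma>) z / G_real z"
proof -
  have z': "\<And>i. z $ i > 0" using z by (simp add: posZ_def)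
  have Q: "matrix_inv (Q_mat z) = diag_mat z" by (rule matrix_inv_Q_mat[OF z'])
  have \<Omega>: "Omega_mat X z = matrix_inv (A z)" by (simp add: Omega_mat_def Q A_def)
  have \<mu>: "mu_mat X y z = \<mu> z" by (simp add: mu_mat_def Q A_def \<mu>_def)
  note A = matrix_inv_pos_def[OF A_pos[OF z]]
  have dA: "det (matrix_inv (A z)) powr (- real CARD('d) / 2) = det (A z) powr (real CARD('d) / 2)"
    unfolding A(3) using pos_def_det_pos[OF A_pos[OF z]] by (simp add: powr_minus inverse_powr powr_minus_divide)
  have 3: "det \<Sigma> powr (- real CARD('p) / 2) * det \<Sigma> powr (- (real CARD('n) / 2 + a) + real CARD('p) / 2) = det \<Sigma> powr (- (real CARD('n) / 2 + a))"
    by (simp add: powr_add[symmetric])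
  have b: "cond_beta X y \<Sigma> z \<beta> = beta_const z * det \<Sigma> powr (- real CARD('p) / 2) * exp (- (1 / 2) * trace (A z ** (\<beta> - \<mu> z) ** matrix_inv \<Sigma> ** transpose (\<beta> - \<mu> z)))"
    unfolding cond_beta_def matrix_normal_density_def \<Omega> \<mu> A(2) dA beta_const_def ..
  have "cond_Sigma a X y z \<Sigma> = inv_wishart_kernel m (matrix_inv (S z)) \<Sigma> / (beta_const z * G_real z)"
    unfolding cond_Sigma_def \<Omega> \<mu> A(2) Q S_eq[OF z', symmetric] inv_wishart_density_def m_def[symmetric] inv_wishart_normalizer[OF z] ..
  also have "\<dots> = det \<Sigma> powr (- (real CARD('n) / 2 + a) + real CARD('p) / 2) * exp (- (1 / 2) * trace (S z ** matrix_inv \<Sigma>)) / (beta_const z * G_real z)"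
    unfolding inv_wishart_kernel_eq[OF z] ..
  finally have "cond_beta X y \<Sigma> z \<beta> * cond_Sigma a X y z \<Sigma>
     = (det \<Sigma> powr (- real CARD('p) / 2) * det \<Sigma> powr (- (real CARD('n) / 2 + a) + real CARD('p) / 2))
      * (exp (- (1 / 2) * trace (A z ** (\<beta> - \<mu> z) ** matrix_inv \<Sigma> ** transpose (\<beta> - \<mu> z))) * exp (- (1 / 2) * trace (S z ** matrix_inv \<Sigma>))) / G_real z"
    unfolding b using beta_const_pos[OF z] by simp
  also have "\<dots> = \<phi> (\<beta>, \<Sigma>) z / G_real z"
    unfolding 3 \<phi>_def E_eq[OF z] by (simp add: exp_add[symmetric] add_divide_distrib)
  finally show ?thesis .
qed

end

section \<open>Mixing weights, the posterior density and its total mass\<close>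

lemma nn_integral_lborel_vec_prod:
  fixes f :: "'n::finite \<Rightarrow> real \<Rightarrow> ennreal"
  assumes [measurable]: "\<And>i. f i \<in> borel_measurable borel"
  shows "(\<integral>\<^sup>+z. (\<Prod>i\<in>UNIV. f i (z $ i)) \<partial>lborel) = (\<Prod>i\<in>UNIV. \<integral>\<^sup>+u. f i u \<partial>lborel)"
proof -
  let ?ax = "\<lambda>i::'n. axis i (1::real)"
  have inj: "inj ?ax" by (auto simp: inj_on_def axis_eq_axis)
  have B: "Basis = range ?ax" by (auto simp: Basis_vec_def)
  have P: "(\<Prod>b\<in>Basis. g b) = (\<Prod>i\<in>UNIV. g (?ax i))" for g :: "real^'n \<Rightarrow> ennreal"
    unfolding B by (subst prod.reindex[OF inj]) (simp add: o_def)
  have "(\<integral>\<^sup>+z. (\<Prod>b\<in>Basis. f (inv ?ax b) (z \<bullet> b)) \<partial>lborel) = (\<Prod>b\<in>Basis. \<integral>\<^sup>+u. f (inv ?ax b) u \<partial>lborel)"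
    by (rule nn_integral_lborel_prod) auto
  then show ?thesis by (simp add: P inv_f_f[OF inj] inner_axis)
qed

definition gauss_const :: "nat \<Rightarrow> nat \<Rightarrow> real" where
  "gauss_const d n = (1 / (2 * pi) powr (real d / 2)) ^ n"

lemma gauss_const_pos: "gauss_const d n > 0"
  by (simp add: gauss_const_def)

context da_chain
begin

definition "psi_const s = enn2real (\<Psi> s)"
definition "mix_weight z = (\<Prod>i\<in>UNIV. z $ i powr (real CARD('d) / 2) * H (z $ i))" for z :: "real^'n"
definition "psi_const_prod x = (\<Prod>i\<in>UNIV. psi_const (mahalanobis X y (fst x) (snd x) i))"
text \<open>The unnormalized posterior density (likelihood times prior), and also the joint density
  of x and z with z integrated out.\<close>

definition "joint_marginal x = gauss_const CARD('d) CARD('n) * det (snd x) powr (- (real CARD('n) / 2 + a)) * psi_const_prod x"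

lemma psi_const_pos: "s \<ge> 0 \<Longrightarrow> psi_const s > 0"
  using \<Psi>_pos[of s] \<Psi>_finite[of s] by (simp add: psi_const_def enn2real_positive_iff)

lemma ennreal_psi_const: "s \<ge> 0 \<Longrightarrow> ennreal (psi_const s) = \<Psi> s"
  using \<Psi>_finite[of s] by (simp add: psi_const_def)

lemma psi_kernel_integral: "(LBINT v:{0<..}. psi_kernel h CARD('d) s v) = psi_const s"
proof -
  have "(LBINT v:{0<..}. psi_kernel h CARD('d) s v) = (LINT v|lborel. v powr (real CARD('d) / 2) * exp (- s * v / 2) * H v)"
    unfolding set_lebesgue_integral_def by (intro Bochner_Integration.integral_cong) (auto simp: psi_kernel_def H_def)
  also have "\<dots> = psi_const s"
    unfolding psi_const_def \<Psi>_def by (intro integral_eq_nn_integral) (auto simp: H_nonneg)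
  finally show ?thesis .
qed

lemma space_D: "x \<in> space D \<longleftrightarrow> pos_def (snd x)"
  by (cases x) (simp add: space_state_measure)

lemma psi_const_prod_pos: "x \<in> space D \<Longrightarrow> psi_const_prod x > 0"
  unfolding psi_const_prod_def by (intro prod_pos psi_const_pos mahalanobis_nonneg) (simp add: space_D)


lemma joint_marginal_pos: "x \<in> space D \<Longrightarrow> joint_marginal x > 0"
  using psi_const_prod_pos[of x] gauss_const_pos pos_def_det_pos[of "snd x"] by (simp add: joint_marginal_def space_D)

lemma \<Psi>_measurable[measurable]: "\<Psi> \<in> borel_measurable borel"
  unfolding \<Psi>_def[abs_def] by measurable

lemma psi_const_measurable[measurable]: "psi_const \<in> borel_measurable borel"
  unfolding psi_const_def[abs_def] by measurable

lemma joint_marginal_measurable[measurable]: "joint_marginal \<in> borel_measurable D"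
  unfolding joint_marginal_def[abs_def] psi_const_prod_def by measurable

lemma mix_weight_measurable[measurable]: "mix_weight \<in> borel_measurable borel"
  unfolding mix_weight_def[abs_def] by measurable

lemma mix_weight_nonneg: "mix_weight z \<ge> 0"
  unfolding mix_weight_def by (intro prod_nonneg) (auto simp: H_nonneg)

lemma mix_weight_outside: "z \<notin> posZ \<Longrightarrow> mix_weight z = 0"
proof -
  assume "z \<notin> posZ"
  then obtain i where "z $ i \<le> 0" by (auto simp: posZ_def not_less)
  then have "z $ i powr (real CARD('d) / 2) * H (z $ i) = 0" by (simp add: H_nonpos)
  then show ?thesis unfolding mix_weight_def by (intro prod_zero) auto
qed

lemma likelihood_prior:
  assumes \<Sigma>: "pos_def \<Sigma>"
  shows "likelihood h X y \<beta> \<Sigma> * prior a \<beta> \<Sigma> = joint_marginal (\<beta>, \<Sigma>)"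
proof -
  have d: "det \<Sigma> > 0" by (rule pos_def_det_pos[OF \<Sigma>])
  let ?c = "1 / ((2 * pi) powr (real CARD('d) / 2) * det \<Sigma> powr (1 / 2))"
  have "(LBINT u:{0<..}. u powr (real CARD('d) / 2) / ((2 * pi) powr (real CARD('d) / 2) * det \<Sigma> powr (1 / 2)) * exp (- (u / 2) * s) * h u)
    = ?c * (LBINT v:{0<..}. psi_kernel h CARD('d) s v)" for s
    unfolding set_lebesgue_integral_def integral_mult_right_zero[symmetric]
    by (intro Bochner_Integration.integral_cong) (auto simp: psi_kernel_def mult_ac)
  then have I: "(LBINT u:{0<..}. u powr (real CARD('d) / 2) / ((2 * pi) powr (real CARD('d) / 2) * det \<Sigma> powr (1 / 2)) * exp (- (u / 2) * s) * h u)
    = ?c * psi_const s" for s unfolding psi_kernel_integral .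
  have "likelihood h X y \<beta> \<Sigma> = ?c ^ CARD('n) * psi_const_prod (\<beta>, \<Sigma>)"
    unfolding likelihood_def I psi_const_prod_def prod.distrib prod_constant by simp
  also have "?c ^ CARD('n) = gauss_const CARD('d) CARD('n) * det \<Sigma> powr (- (real CARD('n) / 2))"
    using d by (simp add: gauss_const_def power_mult_distrib power_divide powr_power powr_minus_divide)
  finally have l: "likelihood h X y \<beta> \<Sigma> = gauss_const CARD('d) CARD('n) * det \<Sigma> powr (- (real CARD('n) / 2)) * psi_const_prod (\<beta>, \<Sigma>)" .
  have e: "det \<Sigma> powr (- (real CARD('n) / 2)) * det \<Sigma> powr (- a) = det \<Sigma> powr (- (real CARD('n) / 2 + a))"
    by (simp add: powr_add[symmetric])
  have "prior a \<beta> \<Sigma> = det \<Sigma> powr (- a)" using \<Sigma> by (simp add: prior_def)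
  then show ?thesis unfolding l joint_marginal_def snd_conv e[symmetric] by (simp only: mult_ac)
qed

lemma cond_z_eq:
  assumes z: "z \<in> posZ"
  shows "cond_z h X y \<beta> \<Sigma> z = mix_weight z * exp (- E (\<beta>, \<Sigma>) z / 2) / psi_const_prod (\<beta>, \<Sigma>)"
proof -
  have "cond_z h X y \<beta> \<Sigma> z = (\<Prod>i\<in>UNIV. (z $ i powr (real CARD('d) / 2) * H (z $ i)) * exp (- (z $ i * mahalanobis X y \<beta> \<Sigma> i) / 2) / psi_const (mahalanobis X y \<beta> \<Sigma> i))"
    unfolding cond_z_def psi_def psi_kernel_integral
    using z by (intro prod.cong) (auto simp: posZ_def psi_kernel_def H_pos_eq mult_ac)
  also have "\<dots> = mix_weight z * (\<Prod>i\<in>UNIV. exp (- (z $ i * mahalanobis X y \<beta> \<Sigma> i) / 2)) / psi_const_prod (\<beta>, \<Sigma>)"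
    by (simp add: prod_dividef prod.distrib mix_weight_def psi_const_prod_def)
  also have "(\<Prod>i\<in>UNIV. exp (- (z $ i * mahalanobis X y \<beta> \<Sigma> i) / 2)) = exp (- E (\<beta>, \<Sigma>) z / 2)"
    by (simp add: exp_sum[symmetric] E_def sum_negf sum_divide_distrib)
  finally show ?thesis .
qed

lemma mix_weight_exp_eq: "mix_weight z * exp (c * E x z) = (\<Prod>i\<in>UNIV. z $ i powr (real CARD('d) / 2) * H (z $ i) * exp (c * (z $ i * mahalanobis X y (fst x) (snd x) i)))"
  by (simp add: mix_weight_def prod.distrib exp_sum[symmetric] E_def sum_distrib_left)

text \<open>The integrand splits over the coordinates of z, and each factor integrates to the
  normalizing constant at one residual.\<close>

lemma nn_integral_cond_z:
  assumes x: "x \<in> space D"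
  shows "(\<integral>\<^sup>+z. ennreal (mix_weight z * exp (- E x z / 2)) \<partial>lborel) = ennreal (psi_const_prod x)"
proof -
  let ?s = "\<lambda>i. mahalanobis X y (fst x) (snd x) i"
  have s: "?s i \<ge> 0" for i using x by (intro mahalanobis_nonneg) (simp add: space_D)
  have "ennreal (mix_weight z * exp (- E x z / 2)) = (\<Prod>i\<in>UNIV. ennreal (z $ i powr (real CARD('d) / 2) * exp (- ?s i * (z $ i) / 2) * H (z $ i)))" for z
    using mix_weight_exp_eq[of z "- 1 / 2" x] H_nonneg by (simp add: prod_ennreal mult_ac)
  then have "(\<integral>\<^sup>+z. ennreal (mix_weight z * exp (- E x z / 2)) \<partial>lborel) = (\<Prod>i\<in>UNIV. \<Psi> (?s i))"
    unfolding \<Psi>_def by (simp only:) (rule nn_integral_lborel_vec_prod, measurable)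
  also have "\<dots> = (\<Prod>i\<in>UNIV. ennreal (psi_const (?s i)))" by (simp add: ennreal_psi_const[OF s])
  also have "\<dots> = ennreal (psi_const_prod x)" unfolding psi_const_prod_def using psi_const_pos[OF s] by (intro prod_ennreal) (simp add: less_imp_le)
  finally show ?thesis .
qed

lemma nn_integral_joint_z:
  assumes x: "x \<in> space D"
  shows "(\<integral>\<^sup>+z. ennreal (gauss_const CARD('d) CARD('n) * mix_weight z * \<phi> x z) \<partial>lborel) = ennreal (joint_marginal x)"
proof -
  let ?c = "gauss_const CARD('d) CARD('n) * det (snd x) powr (- (real CARD('n) / 2 + a))"
  have [measurable]: "(\<lambda>z. E x z) \<in> borel_measurable borel" unfolding E_def by measurable
  have "ennreal (gauss_const CARD('d) CARD('n) * mix_weight z * \<phi> x z) = ennreal ?c * ennreal (mix_weight z * exp (- E x z / 2))" for z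
    unfolding \<phi>_def using gauss_const_pos[of "CARD('d)" "CARD('n)"] mix_weight_nonneg[of z]
    by (subst ennreal_mult[symmetric]) (auto simp: mult_ac)
  then have "(\<integral>\<^sup>+z. ennreal (gauss_const CARD('d) CARD('n) * mix_weight z * \<phi> x z) \<partial>lborel) = (\<integral>\<^sup>+z. ennreal ?c * ennreal (mix_weight z * exp (- E x z / 2)) \<partial>lborel)"
    by (simp only:)
  also have "\<dots> = ennreal ?c * ennreal (psi_const_prod x)"
    unfolding nn_integral_cond_z[OF x, symmetric] by (rule nn_integral_cmult) measurable
  also have "\<dots> = ennreal (joint_marginal x)"
    unfolding joint_marginal_def using gauss_const_pos[of "CARD('d)" "CARD('n)"] psi_const_prod_pos[OF x]
    by (subst ennreal_mult[symmetric]) auto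
  finally show ?thesis .
qed

text \<open>Exchanging the order of integration expresses the total mass through \<open>G\<close>,
  so that its finiteness can be tested in z alone.\<close>

lemma nn_integral_joint_marginal: "(\<integral>\<^sup>+x. ennreal (joint_marginal x) \<partial>D) = (\<integral>\<^sup>+z. ennreal (gauss_const CARD('d) CARD('n) * mix_weight z) * G z \<partial>lborel)"
proof -
  interpret pair_sigma_finite D "lborel :: (real^'n) measure"
    by (intro pair_sigma_finite.intro sigma_finite_D lborel.sigma_finite_measure_axioms)
  have m: "(\<lambda>(x, z). ennreal (gauss_const CARD('d) CARD('n) * mix_weight z * \<phi> x z)) \<in> borel_measurable (D \<Otimes>\<^sub>M lborel)"
  proof -
    have "(\<lambda>(x, z). \<phi> x z) \<in> borel_measurable (D \<Otimes>\<^sub>M lborel)"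
      using \<phi>_measurable by (simp add: measurable_cong_sets[OF sets_pair_measure_cong[OF refl sets_lborel] refl])
    then show ?thesis by (simp add: case_prod_beta')
  qed
  have "(\<integral>\<^sup>+x. ennreal (joint_marginal x) \<partial>D) = (\<integral>\<^sup>+x. \<integral>\<^sup>+z. ennreal (gauss_const CARD('d) CARD('n) * mix_weight z * \<phi> x z) \<partial>lborel \<partial>D)"
    by (intro nn_integral_cong) (simp add: nn_integral_joint_z)
  also have "\<dots> = (\<integral>\<^sup>+z. \<integral>\<^sup>+x. ennreal (gauss_const CARD('d) CARD('n) * mix_weight z * \<phi> x z) \<partial>D \<partial>lborel)"
    using Fubini'[OF m] by simp
  also have "\<dots> = (\<integral>\<^sup>+z. ennreal (gauss_const CARD('d) CARD('n) * mix_weight z) * G z \<partial>lborel)"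
  proof (rule nn_integral_cong)
    fix z :: "real^'n"
    have "(\<integral>\<^sup>+x. ennreal (gauss_const CARD('d) CARD('n) * mix_weight z * \<phi> x z) \<partial>D) = (\<integral>\<^sup>+x. ennreal (gauss_const CARD('d) CARD('n) * mix_weight z) * ennreal (\<phi> x z) \<partial>D)"
    proof -
      have "ennreal (gauss_const CARD('d) CARD('n) * mix_weight z * \<phi> x z) = ennreal (gauss_const CARD('d) CARD('n) * mix_weight z) * ennreal (\<phi> x z)" for x
        using gauss_const_pos[of "CARD('d)" "CARD('n)"] mix_weight_nonneg[of z]
        by (subst ennreal_mult) (auto simp: \<phi>_def)
      then show ?thesis by (simp only:)
    qed
    also have "\<dots> = ennreal (gauss_const CARD('d) CARD('n) * mix_weight z) * G z"
      unfolding G_def by (rule nn_integral_cmult) measurable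
    finally show "(\<integral>\<^sup>+x. ennreal (gauss_const CARD('d) CARD('n) * mix_weight z * \<phi> x z) \<partial>D) = ennreal (gauss_const CARD('d) CARD('n) * mix_weight z) * G z" .
  qed
  finally show ?thesis .
qed

definition one_vec :: "real^'n" where "one_vec = (\<chi> i. 1)"

lemma one_posZ: "one_vec \<in> posZ" by (simp add: one_vec_def posZ_def)

text \<open>z dominates t times the vector of ones, where t is the smaller of 1 and the least
  coordinate. The resulting power of t is at most a product over all coordinates with factors at
  least 1; in this form the variables separate.\<close>

lemma G_bound:
  assumes z: "z \<in> posZ"
  shows "G z \<le> ennreal (\<Prod>i\<in>UNIV. max 1 (z $ i powr min \<kappa> 0)) * G one_vec"
proof -
  define t where "t = min 1 (Min (range (($) z)))"
  have zp: "z $ i > 0" for i using z by (simp add: posZ_def)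
  then have "Min (range (($) z)) > 0" by (subst Min_gr_iff) auto
  then have t: "t > 0" "t \<le> 1" by (auto simp: t_def)
  have "t \<le> z $ i" for i unfolding t_def by (rule min.coboundedI2) simp
  then have "G z \<le> G (t *\<^sub>R one_vec)" by (intro G_antimono) (simp add: one_vec_def)
  also have "\<dots> = ennreal (t powr \<kappa>) * G one_vec" by (rule G_scale[OF t(1)])
  also have "\<dots> \<le> ennreal (\<Prod>i\<in>UNIV. max 1 (z $ i powr min \<kappa> 0)) * G one_vec"
  proof (intro mult_right_mono ennreal_leI)
    \<comment> \<open>As t <= 1, lowering the exponent to min \<kappa> 0 can only increase the
      power.\<close>
    have "t powr \<kappa> \<le> t powr min \<kappa> 0" using t by (intro powr_mono') auto
    also have "\<dots> \<le> (\<Prod>i\<in>UNIV. max 1 (z $ i powr min \<kappa> 0))"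
    proof (cases "t = 1")
      case True
      then show ?thesis by (auto intro!: prod_ge_1)
    next
      case False
      then have tm: "t = Min (range (($) z))" by (auto simp: t_def min_def)
      have "Min (range (($) z)) \<in> range (($) z)" by (rule Min_in) auto
      then obtain j where "Min (range (($) z)) = z $ j" by (rule rangeE)
      with tm have j: "t = z $ j" by simp
      have "max 1 (z $ j powr min \<kappa> 0) * 1 \<le> max 1 (z $ j powr min \<kappa> 0) * (\<Prod>i\<in>UNIV - {j}. max 1 (z $ i powr min \<kappa> 0))"
        by (intro mult_left_mono prod_ge_1) auto
      also have "\<dots> = (\<Prod>i\<in>UNIV. max 1 (z $ i powr min \<kappa> 0))"
        by (rule prod.remove[symmetric]) auto
      finally show ?thesis unfolding j by simp
    qed
    finally show "t powr \<kappa> \<le> (\<Prod>i\<in>UNIV. max 1 (z $ i powr min \<kappa> 0))" .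
  qed simp
  finally show ?thesis .
qed

text \<open>The separated bound for \<open>G\<close> leaves a product of one-dimensional integrals
  with a nonpositive power of u, each finite by \<open>negative_moment_finite\<close>.\<close>

lemma nn_integral_joint_marginal_finite:
  assumes "G one_vec < \<infinity>"
  shows "(\<integral>\<^sup>+x. ennreal (joint_marginal x) \<partial>D) < \<infinity>"
proof -
  let ?f = "\<lambda>u. ennreal (u powr (real CARD('d) / 2) * H u * max 1 (u powr min \<kappa> 0))"
  have "(\<integral>\<^sup>+x. ennreal (joint_marginal x) \<partial>D) \<le> (\<integral>\<^sup>+z. ennreal (gauss_const CARD('d) CARD('n)) * G one_vec * (\<Prod>i\<in>(UNIV::'n set). ?f (z $ i)) \<partial>lborel)"
    unfolding nn_integral_joint_marginal
  proof (rule nn_integral_mono)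
    fix z :: "real^'n"
    show "ennreal (gauss_const CARD('d) CARD('n) * mix_weight z) * G z \<le> ennreal (gauss_const CARD('d) CARD('n)) * G one_vec * (\<Prod>i\<in>UNIV. ?f (z $ i))"
    proof (cases "z \<in> posZ")
      case True
      have p: "(\<Prod>i\<in>UNIV. ?f (z $ i)) = ennreal (mix_weight z) * ennreal (\<Prod>i\<in>UNIV. max 1 (z $ i powr min \<kappa> 0))"
      proof -
        have "(\<Prod>i\<in>UNIV. ?f (z $ i)) = ennreal (\<Prod>i\<in>UNIV. z $ i powr (real CARD('d) / 2) * H (z $ i) * max 1 (z $ i powr min \<kappa> 0))"
          using H_nonneg by (intro prod_ennreal) simp
        also have "(\<Prod>i\<in>UNIV. z $ i powr (real CARD('d) / 2) * H (z $ i) * max 1 (z $ i powr min \<kappa> 0)) = mix_weight z * (\<Prod>i\<in>UNIV. max 1 (z $ i powr min \<kappa> 0))"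
          by (simp add: mix_weight_def prod.distrib)
        finally show ?thesis using mix_weight_nonneg[of z] by (simp add: ennreal_mult' prod_nonneg)
      qed
      have gu: "ennreal (gauss_const CARD('d) CARD('n) * mix_weight z) = ennreal (gauss_const CARD('d) CARD('n)) * ennreal (mix_weight z)"
        using gauss_const_pos[of "CARD('d)" "CARD('n)"] mix_weight_nonneg[of z] by (intro ennreal_mult) auto
      have "ennreal (gauss_const CARD('d) CARD('n) * mix_weight z) * G z \<le> ennreal (gauss_const CARD('d) CARD('n) * mix_weight z) * (ennreal (\<Prod>i\<in>UNIV. max 1 (z $ i powr min \<kappa> 0)) * G one_vec)"
        by (intro mult_left_mono G_bound True) simp
      also have "\<dots> = ennreal (gauss_const CARD('d) CARD('n)) * G one_vec * (\<Prod>i\<in>UNIV. ?f (z $ i))"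
        unfolding p gu by (simp only: mult_ac)
      finally show ?thesis .
    qed (simp add: mix_weight_outside)
  qed
  also have "\<dots> = ennreal (gauss_const CARD('d) CARD('n)) * G one_vec * (\<integral>\<^sup>+z. (\<Prod>i\<in>(UNIV::'n set). ?f (z $ i)) \<partial>lborel)"
    by (rule nn_integral_cmult) measurable
  also have "(\<integral>\<^sup>+z. (\<Prod>i\<in>(UNIV::'n set). ?f (z $ i)) \<partial>lborel) = (\<Prod>i\<in>(UNIV::'n set). \<integral>\<^sup>+u. ?f u \<partial>lborel)"
    by (rule nn_integral_lborel_vec_prod) measurable
  also have "ennreal (gauss_const CARD('d) CARD('n)) * G one_vec * \<dots> < \<infinity>"
    using assms negative_moment_finite[of "min \<kappa> 0"] by (simp add: ennreal_mult_less_top power_less_top_ennreal)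
  finally show ?thesis .
qed

lemma DA_operator_degenerate:
  assumes "\<And>z. z \<in> posZ \<Longrightarrow> G_real z = 0"
  shows "DA_operator h a X y = (\<lambda>f x. 0)"
proof (intro ext)
  fix f :: "(real^'d^'p) \<times> (real^'d^'d) \<Rightarrow> real" and x
  have "DA_kernel h a X y x x' = 0" if x': "x' \<in> space D" for x'
  proof -
    have "indicator {z. \<forall>i. 0 < z $ i} z *\<^sub>R (cond_beta X y (snd x') z (fst x') * cond_Sigma a X y z (snd x') * cond_z h X y (fst x) (snd x) z) = 0" for z
      using conditional_density_eq[of z "snd x'" "fst x'"] x' assms[of z]
      by (cases "z \<in> posZ") (auto simp: space_D posZ_def)
    then show ?thesis
      unfolding DA_kernel_def case_prod_beta set_lebesgue_integral_def by (simp only:) simp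
  qed
  then have "DA_operator h a X y f x = (LINT x'|D. 0)"
    unfolding DA_operator_def by (intro Bochner_Integration.integral_cong) auto
  then show "DA_operator h a X y f x = 0" by simp
qed

end

text \<open>The finite intersections of a countable basis, restricted to \<Omega>, remain countable
  and are closed under intersection; weak compactness was proved for such generators.\<close>

lemma countable_Int_stable_generator:
  fixes M :: "'a::second_countable_topology measure"
  assumes M: "sets M = sets (restrict_space borel \<Omega>)" and \<Omega>: "\<Omega> \<in> sets borel"
  obtains G where "countable G" "G \<subseteq> Pow \<Omega>" "Int_stable G" "\<Omega> \<in> G" "sets M = sigma_sets \<Omega> G"
proof -
  obtain B :: "'a set set" where B: "countable B" "topological_basis B"
    using ex_countable_basis by auto
  define G0 where "G0 = Inter ` {F. finite F \<and> F \<subseteq> B}"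
  have c0: "countable G0"
    unfolding G0_def by (intro countable_image countable_Collect_finite_subset B)
  have B0: "B \<subseteq> G0" unfolding G0_def by (auto intro!: image_eqI[of _ _ "{_}"])
  have bB: "b \<in> B \<Longrightarrow> b \<in> sigma_sets UNIV B" for b by auto
  have G0B: "g \<in> sigma_sets UNIV B" if "g \<in> G0" for g
  proof -
    from that obtain F where F: "g = \<Inter>F" "finite F" "F \<subseteq> B" by (auto simp: G0_def)
    interpret sigma_algebra UNIV "sigma_sets UNIV B" by (rule sigma_algebra_sigma_sets) simp
    show ?thesis
    proof (cases "F = {}")
      case True
      then show ?thesis using F(1) top by simp
    next
      case False
      have "(\<Inter>b\<in>F. b) \<in> sigma_sets UNIV B" using F False by (intro finite_INT) auto
      then show ?thesis using F(1) by simp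
    qed
  qed
  have "sets (borel :: 'a measure) = sigma_sets UNIV B"
    by (subst borel_eq_countable_basis[OF B]) simp
  also have "\<dots> = sigma_sets UNIV G0"
    by (rule sigma_sets_eqI) (use B0 G0B in auto)
  finally have b: "sets (borel :: 'a measure) = sigma_sets UNIV G0" .
  have "sets M = (\<inter>) \<Omega> ` sigma_sets UNIV G0" unfolding M sets_restrict_space b ..
  also have "\<dots> = sigma_sets \<Omega> ((\<inter>) \<Omega> ` G0)"
    by (rule sigma_sets_Int) (use \<Omega> b in auto)
  finally have s: "sets M = sigma_sets \<Omega> ((\<inter>) \<Omega> ` G0)" .
  have "Int_stable ((\<inter>) \<Omega> ` G0)"
  proof (rule Int_stableI)
    fix a b assume "a \<in> (\<inter>) \<Omega> ` G0" "b \<in> (\<inter>) \<Omega> ` G0"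
    then obtain F F' where "a = \<Omega> \<inter> \<Inter>F" "b = \<Omega> \<inter> \<Inter>F'" "finite F" "F \<subseteq> B" "finite F'" "F' \<subseteq> B"
      by (auto simp: G0_def)
    then have "a \<inter> b = \<Omega> \<inter> \<Inter>(F \<union> F')" "finite (F \<union> F')" "F \<union> F' \<subseteq> B" by auto
    then show "a \<inter> b \<in> (\<inter>) \<Omega> ` G0" unfolding G0_def by blast
  qed
  \<comment> \<open>The empty intersection is the whole space, whose trace is \<Omega>.\<close>
  moreover have "\<Omega> \<in> (\<inter>) \<Omega> ` G0"
    unfolding G0_def by (intro image_eqI[where x="\<Inter>{}"] image_eqI[where x="{}"]) auto
  ultimately show ?thesis
    using c0 s by (intro that[of "(\<inter>) \<Omega> ` G0"]) auto
qed

text \<open>Rectangles built from the two generators. Each generator contains its whole space, which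
  is what makes the rectangles generate the product.\<close>

lemma state_measure_generator:
  obtains G where "countable G" "G \<subseteq> Pow (space (state_measure :: ((real^'d^'p) \<times> (real^'d^'d)) measure))" "Int_stable G"
    "sets (state_measure :: ((real^'d^'p) \<times> (real^'d^'d)) measure) = sigma_sets (space state_measure) G"
proof -
  have "sets (borel :: (real^'d^'p) measure) = sets (restrict_space borel UNIV)"
    by (simp add: sets_restrict_space)
  from countable_Int_stable_generator[OF this] obtain Ga :: "(real^'d^'p) set set" where
    a: "countable Ga" "Ga \<subseteq> Pow UNIV" "Int_stable Ga" "UNIV \<in> Ga" "sets (borel :: (real^'d^'p) measure) = sigma_sets UNIV Ga"
    by auto
  let ?\<Omega> = "{S::real^'d^'d. pos_def S}"
  have "sets (posdef_lborel :: (real^'d^'d) measure) = sets (restrict_space borel ?\<Omega>)"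
    unfolding posdef_lborel_def by (rule sets_restrict_space_cong) simp
  from countable_Int_stable_generator[OF this pos_def_measurable] obtain Gb where
    b: "countable Gb" "Gb \<subseteq> Pow ?\<Omega>" "Int_stable Gb" "?\<Omega> \<in> Gb" "sets (posdef_lborel :: (real^'d^'d) measure) = sigma_sets ?\<Omega> Gb"
    by auto
  let ?G = "{a \<times> b |a b. a \<in> Ga \<and> b \<in> Gb}"
  have "sets (state_measure :: ((real^'d^'p) \<times> (real^'d^'d)) measure) = sets (borel \<Otimes>\<^sub>M posdef_lborel)"
    by (rule sets_state_measure)
  also have "\<dots> = sets (sigma (space borel \<times> space posdef_lborel) ?G)"
    by (rule sets_pair_eq[of _ _ "{UNIV}" _ _ "{?\<Omega>}"]) (use a b in auto)
  also have "\<dots> = sigma_sets (UNIV \<times> ?\<Omega>) ?G"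
    using b(2) by (subst sets_measure_of) auto
  finally have s: "sets (state_measure :: ((real^'d^'p) \<times> (real^'d^'d)) measure) = sigma_sets (space state_measure) ?G"
    by (simp add: space_state_measure)
  have "countable ?G"
  proof -
    have "?G = (\<lambda>(a, b). a \<times> b) ` (Ga \<times> Gb)" by auto
    then show ?thesis using a(1) b(1) by simp
  qed
  moreover have "Int_stable ?G"
    using a(3) b(3) unfolding Int_stable_def by (auto simp: Times_Int_Times) blast
  moreover have "?G \<subseteq> Pow (space state_measure)"
    using b(2) by (auto simp: space_state_measure)
  ultimately show ?thesis using s that by blast
qed

section \<open>The Hilbert--Schmidt bound for the chain\<close>

lemma prod_mono_ennreal:
  fixes f g :: "'a \<Rightarrow> ennreal"
  assumes "\<And>i. i \<in> I \<Longrightarrow> f i \<le> g i" shows "(\<Prod>i\<in>I. f i) \<le> (\<Prod>i\<in>I. g i)"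
  using assms by (induction I rule: infinite_finite_induct) (auto intro!: mult_mono)

context da_chain
begin

lemma G_real_measurable[measurable]: "G_real \<in> borel_measurable borel"
  unfolding G_real_def[abs_def] by measurable

text \<open>Bayes' rule for z given x: the Gaussian constant and the power of the determinant
  cancel.\<close>

lemma joint_ratio: 
  assumes x: "x \<in> space D"
  shows "gauss_const CARD('d) CARD('n) * mix_weight z * \<phi> x z / joint_marginal x = mix_weight z * exp (- E x z / 2) / psi_const_prod x"
proof -
  have "det (snd x) powr (- (real CARD('n) / 2 + a)) > 0"
    using pos_def_det_pos[of "snd x"] x by (simp add: space_D)
  then show ?thesis using gauss_const_pos[of "CARD('d)" "CARD('n)"] by (simp add: joint_marginal_def \<phi>_def)
qed

text \<open>What remains of the exponent is the same function at z / 2, whose integral over x is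
  \<open>G\<close> at a scaled point.\<close>

lemma \<phi>_half: "\<phi> x z * exp (E x z / 4) = \<phi> x ((1 / 2) *\<^sub>R z)"
proof -
  have "E x ((1 / 2) *\<^sub>R z) = E x z / 2" by (simp add: E_def sum_divide_distrib)
  then show ?thesis by (simp add: \<phi>_def exp_add[symmetric])
qed

text \<open>The one-dimensional bounds multiply: their exponents add up to a quarter of
  \<open>E\<close>, and the normalizing constants cancel.\<close>

lemma cond_z_bound:
  assumes x: "x \<in> space D"
  shows "ennreal (mix_weight z * exp (- E x z / 2) / psi_const_prod x) \<le> (\<Prod>i\<in>UNIV. majorant (z $ i)) * ennreal (exp (E x z / 4))"
proof -
  let ?s = "\<lambda>i. mahalanobis X y (fst x) (snd x) i"
  have s: "?s i \<ge> 0" for i using x by (intro mahalanobis_nonneg) (simp add: space_D)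
  have P: "psi_const_prod x > 0" by (rule psi_const_prod_pos[OF x])
  have "ennreal (mix_weight z * exp (- E x z / 2)) = (\<Prod>i\<in>UNIV. ennreal (z $ i powr (real CARD('d) / 2) * exp (- ?s i * (z $ i) / 2) * H (z $ i)))"
    using mix_weight_exp_eq[of z "- 1 / 2" x] H_nonneg by (simp add: prod_ennreal mult_ac)
  also have "\<dots> \<le> (\<Prod>i\<in>UNIV. majorant (z $ i) * ennreal (exp (?s i * z $ i / 4)) * ennreal (psi_const (?s i)))"
    unfolding ennreal_psi_const[OF s] by (intro prod_mono_ennreal majorant_bound[OF s])
  also have "\<dots> = (\<Prod>i\<in>UNIV. majorant (z $ i)) * ennreal (exp (E x z / 4)) * ennreal (psi_const_prod x)"
  proof -
    have "(\<Prod>i\<in>UNIV. ennreal (exp (?s i * z $ i / 4))) = ennreal (exp (E x z / 4))"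
      by (simp add: prod_ennreal exp_sum[symmetric] E_def sum_divide_distrib mult.commute)
    moreover have "(\<Prod>i\<in>UNIV. ennreal (psi_const (?s i))) = ennreal (psi_const_prod x)"
      unfolding psi_const_prod_def using psi_const_pos[OF s] by (intro prod_ennreal) (simp add: less_imp_le)
    ultimately show ?thesis by (simp add: prod.distrib)
  qed
  finally have "ennreal (mix_weight z * exp (- E x z / 2)) * ennreal (1 / psi_const_prod x)
      \<le> (\<Prod>i\<in>UNIV. majorant (z $ i)) * ennreal (exp (E x z / 4)) * ennreal (psi_const_prod x) * ennreal (1 / psi_const_prod x)"
    by (rule mult_right_mono) simp
  moreover have "ennreal (psi_const_prod x) * ennreal (1 / psi_const_prod x) = 1"
    using P by (subst ennreal_mult[symmetric]) auto
  moreover have "ennreal (mix_weight z * exp (- E x z / 2)) * ennreal (1 / psi_const_prod x) = ennreal (mix_weight z * exp (- E x z / 2) / psi_const_prod x)"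
    using P mix_weight_nonneg[of z] by (subst ennreal_mult[symmetric]) auto
  ultimately show ?thesis by (simp add: mult.assoc)
qed

text \<open>The chain is an instance of \<open>da_kernel\<close>. The square of \<open>q\<close>,
  weighted by both marginal densities, is the product of the two conditional densities, so the
  marginals cancel from the Hilbert--Schmidt norm.\<close>

lemma trace_class_nondegenerate:
  assumes G1: "0 < G one_vec" "G one_vec < \<infinity>"
  shows "trace_class (posterior h a X y) (DA_operator h a X y)"
proof -
  let ?gc = "gauss_const CARD('d) CARD('n)" and ?M = "posterior h a X y :: ((real^'d^'p) \<times> (real^'d^'d)) measure"
  have gc: "?gc > 0" by (rule gauss_const_pos)
  have Gfin: "G z < \<infinity>" if "z \<in> posZ" for z using G_finite_iff[OF one_posZ that G1(2)] .
  have Gpos: "G z \<noteq> 0" for z using G1(1) G_zero_iff[of z] G_zero_iff[of one_vec] by auto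
  have G_real: "G_real z > 0" and eGr: "ennreal (G_real z) = G z" if "z \<in> posZ" for z
    using Gfin[OF that] Gpos[of z] by (auto simp: G_real_def enn2real_positive_iff zero_less_iff_neq_zero)
  have Gr0: "G_real z \<ge> 0" for z by (simp add: G_real_def)
  have Lfin: "(\<integral>\<^sup>+x. ennreal (joint_marginal x) \<partial>D) < \<infinity>" by (rule nn_integral_joint_marginal_finite[OF G1(2)])
  have L0: "AE x in D. joint_marginal x \<ge> 0" using joint_marginal_pos by (intro AE_I2) (auto intro: less_imp_le)
  have Li: "integrable D joint_marginal"
  proof (rule integrableI_bounded)
    have "(\<integral>\<^sup>+x. ennreal (norm (joint_marginal x)) \<partial>D) = (\<integral>\<^sup>+x. ennreal (joint_marginal x) \<partial>D)"
      using joint_marginal_pos by (intro nn_integral_cong) (simp add: less_imp_le)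
    then show "(\<integral>\<^sup>+x. ennreal (norm (joint_marginal x)) \<partial>D) < \<infinity>" using Lfin by simp
  qed measurable
  define mm where "mm = (LINT x|D. joint_marginal x)"
  have emm: "ennreal mm = (\<integral>\<^sup>+x. ennreal (joint_marginal x) \<partial>D)"
    unfolding mm_def by (rule nn_integral_eq_integral[symmetric, OF Li L0])
  have "(\<integral>\<^sup>+x. ennreal (joint_marginal x) \<partial>D) \<noteq> 0"
  proof
    assume "(\<integral>\<^sup>+x. ennreal (joint_marginal x) \<partial>D) = 0"
    then have "AE x in D. ennreal (joint_marginal x) = 0" by (subst (asm) nn_integral_0_iff_AE) auto
    then have "AE x in D. False" using AE_space by eventually_elim (use joint_marginal_pos in force)
    then have "emeasure D (space D) = 0" by (simp add: AE_iff_measurable[OF sets.top])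
    with Gpos G_zero_iff show False by blast
  qed
  then have mm: "mm > 0" using emm by (metis ennreal_eq_0_iff not_le)
  have marg: "marginal h a X y = mm"
  proof -
    interpret pair_sigma_finite "lborel :: (real^'d^'p) measure" "posdef_lborel :: (real^'d^'d) measure"
      by (rule pair_sigma_finite_D)
    have Li': "integrable (lborel \<Otimes>\<^sub>M posdef_lborel) (case_prod (\<lambda>\<beta> \<Sigma>. joint_marginal (\<beta>, \<Sigma>)))"
      using Li by (simp add: state_measure_def)
    have "marginal h a X y = (LINT \<Sigma>|posdef_lborel. LINT \<beta>|lborel. joint_marginal (\<beta>, \<Sigma>))"
      unfolding marginal_def by (intro Bochner_Integration.integral_cong) (simp_all add: likelihood_prior)
    also have "\<dots> = mm"
      unfolding integral_snd[OF Li'] mm_def by (simp add: state_measure_def)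
    finally show ?thesis .
  qed
  let ?p = "\<lambda>x. joint_marginal x / mm"
  have p: "x \<in> space D \<Longrightarrow> ?p x > 0" for x using joint_marginal_pos mm by simp
  have pd: "(case x of (\<beta>, \<Sigma>) \<Rightarrow> ennreal (posterior_density h a X y \<beta> \<Sigma>)) = ennreal (?p x)" if "x \<in> space D" for x
    using that likelihood_prior[of "snd x" "fst x"] by (cases x) (simp add: posterior_density_def marg space_D)
  have M: "?M = density D (\<lambda>x. ennreal (?p x))"
  proof -
    have m1: "(\<lambda>x. ennreal (?p x)) \<in> borel_measurable D" by measurable
    then have "(\<lambda>x. case x of (\<beta>, \<Sigma>) \<Rightarrow> ennreal (posterior_density h a X y \<beta> \<Sigma>)) \<in> borel_measurable D"
      by (rule measurable_cong[THEN iffD2, rotated]) (rule pd)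
    then show ?thesis
      unfolding posterior_def using m1 pd by (intro density_cong) (auto intro!: AE_I2)
  qed
  \<comment> \<open>The marginal density of the latent vector.\<close>
  define w where "w z = ?gc / mm * mix_weight z * G_real z" for z
  have [measurable]: "w \<in> borel_measurable borel" unfolding w_def[abs_def] by measurable
  have w0: "w z \<ge> 0" for z using gc mm mix_weight_nonneg Gr0 by (simp add: w_def)
  have wout: "z \<notin> posZ \<Longrightarrow> w z = 0" for z by (simp add: w_def mix_weight_outside)
  define W where "W = density lborel (\<lambda>z. ennreal (w z))"
  have sW[measurable_cong]: "sets W = sets borel" by (simp add: W_def)
  have sM[measurable_cong]: "sets ?M = sets D" by (simp add: M)
  have spM: "space ?M = space D" by (simp add: M)
  \<comment> \<open>The joint density divided by the product of its marginals, set to 0 off the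
    orthant, where \<open>w\<close> vanishes as well.\<close>
  define q where "q x z = (if z \<in> posZ then \<phi> x z / (G_real z * ?p x) else 0)" for x z
  have \<phi>m[measurable]: "(\<lambda>p. \<phi> (fst p) (snd p)) \<in> borel_measurable (D \<Otimes>\<^sub>M borel)"
    using \<phi>_measurable by (simp add: case_prod_beta')
  have qm: "case_prod q \<in> borel_measurable (D \<Otimes>\<^sub>M borel)"
    unfolding q_def case_prod_beta' by measurable
  have smw: "sets (?M \<Otimes>\<^sub>M W) = sets (D \<Otimes>\<^sub>M borel)" by (rule sets_pair_measure_cong[OF sM sW])
  have qm'[measurable]: "case_prod q \<in> borel_measurable (?M \<Otimes>\<^sub>M W)"
    using qm by (simp add: measurable_cong_sets[OF smw refl])
  have qm2[measurable]: "q x \<in> borel_measurable borel" if "x \<in> space D" for x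
    using measurable_compose[OF measurable_Pair1'[OF that] qm] by simp
  have qm1[measurable]: "(\<lambda>x. q x z) \<in> borel_measurable D" for z
    using measurable_compose[OF measurable_Pair2' qm, of z] by simp
  \<comment> \<open>Both sides are the density of z given x.\<close>
  have key: "w z * q x z = mix_weight z * exp (- E x z / 2) / psi_const_prod x" if x: "x \<in> space D" for x z
  proof (cases "z \<in> posZ")
    case True
    have "w z * q x z = ?gc * mix_weight z * \<phi> x z / joint_marginal x"
      using G_real[OF True] mm True by (simp add: w_def q_def)
    then show ?thesis by (simp add: joint_ratio[OF x])
  qed (simp add: w_def mix_weight_outside)
  \<comment> \<open>Both sides are the density of x given z.\<close>
  have pq: "?p x * q x z = \<phi> x z / G_real z" if "x \<in> space D" "z \<in> posZ" for x z
    using joint_marginal_pos[OF that(1)] mm that(2) by (simp add: q_def)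
  have q0: "q x z \<ge> 0" if "x \<in> space D" for x z
    using joint_marginal_pos[OF that] mm \<phi>_pos[OF that, of z] Gr0[of z] unfolding q_def
    by (auto intro!: divide_nonneg_nonneg mult_nonneg_nonneg simp: less_imp_le)
  have finM: "finite_measure ?M"
  proof (rule finite_measureI)
    have "emeasure ?M (space ?M) = (\<integral>\<^sup>+x. ennreal (?p x) \<partial>D)"
      unfolding spM unfolding M by (subst emeasure_density) (auto intro!: nn_integral_cong simp: indicator_def)
    also have "\<dots> = (\<integral>\<^sup>+x. ennreal (1 / mm) * ennreal (joint_marginal x) \<partial>D)"
      using mm by (intro nn_integral_cong) (simp add: ennreal_mult'[symmetric])
    also have "\<dots> = ennreal (1 / mm) * (\<integral>\<^sup>+x. ennreal (joint_marginal x) \<partial>D)" by (rule nn_integral_cmult) measurable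
    also have "\<dots> < \<infinity>" using Lfin by (simp add: ennreal_mult_less_top)
    finally show "emeasure ?M (space ?M) \<noteq> \<infinity>" by simp
  qed
  have finW: "finite_measure W"
  proof (rule finite_measureI)
    have "emeasure W (space W) = (\<integral>\<^sup>+z. ennreal (w z) \<partial>lborel)"
      unfolding W_def by (simp add: emeasure_density)
    also have "\<dots> = (\<integral>\<^sup>+z. ennreal (1 / mm) * (ennreal (?gc * mix_weight z) * G z) \<partial>lborel)"
    proof (rule nn_integral_cong)
      fix z
      show "ennreal (w z) = ennreal (1 / mm) * (ennreal (?gc * mix_weight z) * G z)"
      proof (cases "z \<in> posZ")
        case True
        have "w z = (1 / mm) * ((?gc * mix_weight z) * G_real z)" by (simp add: w_def)
        then show ?thesis unfolding eGr[OF True, symmetric]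
          using mm gc mix_weight_nonneg[of z] Gr0[of z] by (simp add: ennreal_mult'[symmetric] mult_nonneg_nonneg)
      qed (simp add: w_def mix_weight_outside)
    qed
    also have "\<dots> = ennreal (1 / mm) * (\<integral>\<^sup>+z. ennreal (?gc * mix_weight z) * G z \<partial>lborel)" by (rule nn_integral_cmult) measurable
    also have "\<dots> < \<infinity>" using Lfin unfolding nn_integral_joint_marginal by (simp add: ennreal_mult_less_top)
    finally show "emeasure W (space W) \<noteq> \<infinity>" by simp
  qed
  interpret MW: pair_sigma_finite ?M W
    by (intro pair_sigma_finite.intro finite_measure.sigma_finite_measure finM finW)
  have sq: "sq_int (?M \<Otimes>\<^sub>M W) (\<lambda>(x, z). q x z)"
    unfolding sq_int_def
  proof
    show "(\<lambda>(x, z). q x z) \<in> borel_measurable (?M \<Otimes>\<^sub>M W)" by (rule qm')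
    show "integrable (?M \<Otimes>\<^sub>M W) (\<lambda>x. (case x of (x, z) \<Rightarrow> q x z)\<^sup>2)"
    proof (rule integrableI_bounded)
      show "(\<lambda>x. (case x of (x, z) \<Rightarrow> q x z)\<^sup>2) \<in> borel_measurable (?M \<Otimes>\<^sub>M W)" using qm' by measurable
      then have m2: "(\<lambda>(x, z). ennreal ((q x z)\<^sup>2)) \<in> borel_measurable (?M \<Otimes>\<^sub>M W)"
        by (simp add: case_prod_beta')
      have "(\<integral>\<^sup>+x. ennreal (norm ((case x of (x, z) \<Rightarrow> q x z)\<^sup>2)) \<partial>(?M \<Otimes>\<^sub>M W))
        = (\<integral>\<^sup>+z. \<integral>\<^sup>+x. ennreal ((q x z)\<^sup>2) \<partial>?M \<partial>W)"
        using MW.nn_integral_snd[OF m2] by (simp add: case_prod_beta')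
      also have "\<dots> = (\<integral>\<^sup>+z. ennreal (w z) * (\<integral>\<^sup>+x. ennreal ((q x z)\<^sup>2) \<partial>?M) \<partial>lborel)"
      proof -
        have "(\<lambda>z. \<integral>\<^sup>+x. ennreal ((q x z)\<^sup>2) \<partial>?M) \<in> borel_measurable W"
          using MW.M1.borel_measurable_nn_integral[of "\<lambda>z x. ennreal ((q x z)\<^sup>2)" W]
            measurable_compose[OF measurable_pair_swap' m2] by (simp add: case_prod_beta')
        then have "(\<lambda>z. \<integral>\<^sup>+x. ennreal ((q x z)\<^sup>2) \<partial>?M) \<in> borel_measurable lborel"
          by (simp add: measurable_cong_sets[OF sW refl])
        then show ?thesis unfolding W_def by (intro nn_integral_density) measurable
      qed
      also have "\<dots> \<le> (\<integral>\<^sup>+z. ennreal ((1 / 2) powr \<kappa>) * (\<Prod>i\<in>(UNIV::'n set). majorant (z $ i)) \<partial>lborel)"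
      proof (rule nn_integral_mono)
        fix z
        show "ennreal (w z) * (\<integral>\<^sup>+x. ennreal ((q x z)\<^sup>2) \<partial>?M) \<le> ennreal ((1 / 2) powr \<kappa>) * (\<Prod>i\<in>UNIV. majorant (z $ i))"
        proof (cases "z \<in> posZ")
          case False
          then show ?thesis by (simp add: wout)
        next
          case z: True
          have "ennreal (w z) * (\<integral>\<^sup>+x. ennreal ((q x z)\<^sup>2) \<partial>?M) = (\<integral>\<^sup>+x. ennreal (w z) * (ennreal (?p x) * ennreal ((q x z)\<^sup>2)) \<partial>D)"
            unfolding M by (subst nn_integral_density) (auto simp: nn_integral_cmult)
          also have "\<dots> \<le> (\<integral>\<^sup>+x. ((\<Prod>i\<in>UNIV. majorant (z $ i)) * ennreal (1 / G_real z)) * ennreal (\<phi> x ((1 / 2) *\<^sub>R z)) \<partial>D)"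
          proof (rule nn_integral_mono)
            fix x assume x: "x \<in> space D"
            have f0: "\<phi> x z / G_real z \<ge> 0" using \<phi>_pos[OF x, of z] Gr0[of z] by simp
            have "w z * (?p x * (q x z)\<^sup>2) = (w z * q x z) * (?p x * q x z)" by (simp add: power2_eq_square)
            also have "\<dots> = (mix_weight z * exp (- E x z / 2) / psi_const_prod x) * (\<phi> x z / G_real z)" by (simp only: key[OF x] pq[OF x z])
            finally have "ennreal (w z) * (ennreal (?p x) * ennreal ((q x z)\<^sup>2)) = ennreal (mix_weight z * exp (- E x z / 2) / psi_const_prod x) * ennreal (\<phi> x z / G_real z)"
              using w0[of z] p[OF x] f0 by (simp only: ennreal_mult''[symmetric] zero_le_power2 less_imp_le mult_nonneg_nonneg)
            also have "\<dots> \<le> (\<Prod>i\<in>UNIV. majorant (z $ i)) * ennreal (exp (E x z / 4)) * ennreal (\<phi> x z / G_real z)"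
              by (rule mult_right_mono[OF cond_z_bound[OF x]]) simp
            also have "\<dots> = (\<Prod>i\<in>UNIV. majorant (z $ i)) * (ennreal (exp (E x z / 4)) * ennreal (\<phi> x z / G_real z))"
              by (simp only: mult.assoc)
            also have "ennreal (exp (E x z / 4)) * ennreal (\<phi> x z / G_real z) = ennreal (1 / G_real z) * ennreal (\<phi> x ((1 / 2) *\<^sub>R z))"
              unfolding \<phi>_half[symmetric] using \<phi>_pos[OF x, of z] Gr0[of z]
              by (subst (1 2) ennreal_mult[symmetric]) (auto simp: less_imp_le mult_ac)
            finally show "ennreal (w z) * (ennreal (?p x) * ennreal ((q x z)\<^sup>2)) \<le> (\<Prod>i\<in>UNIV. majorant (z $ i)) * ennreal (1 / G_real z) * ennreal (\<phi> x ((1 / 2) *\<^sub>R z))"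
              by (simp only: mult.assoc)
          qed
          also have "\<dots> = (\<Prod>i\<in>UNIV. majorant (z $ i)) * ennreal (1 / G_real z) * G ((1 / 2) *\<^sub>R z)"
            unfolding G_def by (rule nn_integral_cmult) measurable
          \<comment> \<open>Homogeneity at t = 1/2 turns \<open>G\<close> at z / 2 into a multiple
            of \<open>G z\<close>, which cancels the denominator.\<close>
          also have "\<dots> = ennreal ((1 / 2) powr \<kappa>) * (\<Prod>i\<in>UNIV. majorant (z $ i)) * (ennreal (1 / G_real z) * ennreal (G_real z))"
            unfolding G_scale[of "1 / 2", simplified] eGr[OF z] by (simp add: mult_ac)
          also have "ennreal (1 / G_real z) * ennreal (G_real z) = 1"
            using G_real[OF z] by (subst ennreal_mult[symmetric]) auto
          finally show ?thesis by simp
        qed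
      qed
      also have "\<dots> = ennreal ((1 / 2) powr \<kappa>) * (\<integral>\<^sup>+z. (\<Prod>i\<in>(UNIV::'n set). majorant (z $ i)) \<partial>lborel)"
        by (rule nn_integral_cmult) measurable
      also have "(\<integral>\<^sup>+z. (\<Prod>i\<in>(UNIV::'n set). majorant (z $ i)) \<partial>lborel) = (\<Prod>i\<in>(UNIV::'n set). \<integral>\<^sup>+u. majorant u \<partial>lborel)"
        by (rule nn_integral_lborel_vec_prod) measurable
      also have "ennreal ((1 / 2) powr \<kappa>) * \<dots> < \<infinity>"
        using majorant_finite by (simp add: ennreal_mult_less_top power_less_top_ennreal)
      finally show "(\<integral>\<^sup>+x. ennreal (norm ((case x of (x, z) \<Rightarrow> q x z)\<^sup>2)) \<partial>(?M \<Otimes>\<^sub>M W)) < \<infinity>" .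
    qed
  qed
  obtain B where B: "countable B" "B \<subseteq> Pow (space D)" "Int_stable B" "sets D = sigma_sets (space D) B"
    by (rule state_measure_generator)
  have "da_kernel ?M W q B (DA_operator h a X y)"
  proof (intro da_kernel.intro hs_kernel.intro hs_kernel_axioms.intro da_kernel_axioms.intro finM finW sq)
    have "AE z in W. z \<in> posZ"
      unfolding W_def using wout by (subst AE_density) (auto intro!: AE_I2, metis less_irrefl)
    then show "AE z in W. (LINT x|?M. q x z) = 1"
    proof eventually_elim
      case (elim z)
      have "(LINT x|?M. q x z) = (LINT x|D. ?p x * q x z)"
        unfolding M using p by (subst integral_real_density) (auto intro!: AE_I2 simp: less_imp_le)
      also have "\<dots> = (LINT x|D. \<phi> x z / G_real z)"
        by (intro Bochner_Integration.integral_cong) (simp_all only: pq elim)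
      also have "\<dots> = (LINT x|D. \<phi> x z) / G_real z" by simp
      also have "(LINT x|D. \<phi> x z) = G_real z"
        unfolding G_real_def G_def using \<phi>_pos by (intro integral_eq_nn_integral) (auto intro!: AE_I2 simp: less_imp_le)
      finally show ?case using G_real[OF elim] by simp
    qed
    show "AE x in ?M. (LINT z|W. q x z) = 1"
    proof (rule AE_I2)
      fix x assume "x \<in> space ?M"
      then have x: "x \<in> space D" by (simp add: spM)
      have "(LINT z|W. q x z) = (LINT z|lborel. w z * q x z)"
        unfolding W_def using w0 qm2[OF x] by (subst integral_real_density) auto
      also have "\<dots> = (LINT z|lborel. mix_weight z * exp (- E x z / 2)) / psi_const_prod x"
        unfolding key[OF x] by simp
      also have "(LINT z|lborel. mix_weight z * exp (- E x z / 2)) = psi_const_prod x"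
      proof -
        have [measurable]: "E x \<in> borel_measurable borel" unfolding E_def[abs_def] by measurable
        have "(LINT z|lborel. mix_weight z * exp (- E x z / 2)) = enn2real (\<integral>\<^sup>+z. ennreal (mix_weight z * exp (- E x z / 2)) \<partial>lborel)"
          using mix_weight_nonneg by (intro integral_eq_nn_integral) auto
        then show ?thesis unfolding nn_integral_cond_z[OF x] using psi_const_prod_pos[OF x] by simp
      qed
      finally show "(LINT z|W. q x z) = 1" using psi_const_prod_pos[OF x] by simp
    qed
    show "sets ?M = sigma_sets (space ?M) B" "countable B" "B \<subseteq> Pow (space ?M)" "Int_stable B"
      using B by (simp_all add: sM spM)
    fix f :: "(real^'d^'p) \<times> (real^'d^'d) \<Rightarrow> real" and x assume f: "f \<in> L2_zero ?M" and "x \<in> space ?M"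
    then have x: "x \<in> space D" by (simp add: spM)
    have fm[measurable]: "f \<in> borel_measurable D" using f by (simp add: L2_zero_def measurable_cong_sets[OF sM refl])
    have km: "(\<lambda>x'. LINT z|W. q x z * q x' z) \<in> borel_measurable ?M"
    proof (rule MW.M2.borel_measurable_lebesgue_integral)
      have "q x \<in> borel_measurable W" using qm2[OF x] by (simp add: measurable_cong_sets[OF sW refl])
      then show "(\<lambda>(x', z). q x z * q x' z) \<in> borel_measurable (?M \<Otimes>\<^sub>M W)"
        using qm' by (simp add: case_prod_beta')
    qed
    have km'[measurable]: "(\<lambda>x'. LINT z|W. q x z * q x' z) \<in> borel_measurable D"
      using km by (simp add: measurable_cong_sets[OF sM refl])
    have "(LINT x'|?M. f x' * (LINT z|W. q x z * q x' z)) = (LINT x'|D. ?p x' * (f x' * (LINT z|W. q x z * q x' z)))"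
      unfolding M using p by (subst integral_real_density) (auto intro!: AE_I2 simp: less_imp_le)
    also have "\<dots> = (LINT x'|D. f x' * DA_kernel h a X y x x')"
    proof (intro Bochner_Integration.integral_cong refl)
      fix x' assume x': "x' \<in> space D"
      have "(LINT z|W. q x z * q x' z) = (LINT z|lborel. w z * (q x z * q x' z))"
        unfolding W_def using w0 qm2[OF x] qm2[OF x'] by (subst integral_real_density) auto
      then have "?p x' * (LINT z|W. q x z * q x' z) = (LINT z|lborel. ?p x' * (w z * (q x z * q x' z)))" by simp
      also have "\<dots> = (LINT z|lborel. indicator {z. \<forall>i. 0 < z $ i} z *\<^sub>R
          (cond_beta X y (snd x') z (fst x') * cond_Sigma a X y z (snd x') * cond_z h X y (fst x) (snd x) z))"
      proof (intro Bochner_Integration.integral_cong refl)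
        fix z :: "real^'n"
        show "?p x' * (w z * (q x z * q x' z)) = indicator {z. \<forall>i. 0 < z $ i} z *\<^sub>R
          (cond_beta X y (snd x') z (fst x') * cond_Sigma a X y z (snd x') * cond_z h X y (fst x) (snd x) z)"
        proof (cases "z \<in> posZ")
          case True
          \<comment> \<open>The posterior density is grouped with the slice at x', giving the
            density of x' given z, and \<open>w\<close> with the slice at x, giving that of z given
            x.\<close>
          have "?p x' * (w z * (q x z * q x' z)) = (?p x' * q x' z) * (w z * q x z)" by (simp only: mult_ac)
          also have "\<dots> = (\<phi> x' z / G_real z) * (mix_weight z * exp (- E x z / 2) / psi_const_prod x)" by (simp only: pq[OF x' True] key[OF x])
          also have "\<dots> = cond_beta X y (snd x') z (fst x') * cond_Sigma a X y z (snd x') * cond_z h X y (fst x) (snd x) z"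
            using conditional_density_eq[OF True, of "snd x'" "fst x'"] cond_z_eq[OF True, of "fst x" "snd x"] x' by (simp add: space_D)
          finally show ?thesis using True by (simp add: posZ_def)
        next
          case False
          then show ?thesis by (auto simp: wout posZ_def indicator_def)
        qed
      qed
      also have "\<dots> = DA_kernel h a X y x x'"
        by (simp add: DA_kernel_def case_prod_beta set_lebesgue_integral_def)
      finally have "DA_kernel h a X y x x' = ?p x' * (LINT z|W. q x z * q x' z)" ..
      then show "?p x' * (f x' * (LINT z|W. q x z * q x' z)) = f x' * DA_kernel h a X y x x'" by simp
    qed
    finally show "DA_operator h a X y f x = (LINT x'|?M. f x' * (LINT z|W. q x z * q x' z))"
      by (simp add: DA_operator_def)
  qed
  then show ?thesis by (rule da_kernel.trace_class_K)
qed

text \<open>If \<open>G\<close> is zero or infinite, then so are all inverse Wishart normalizers, and since \<open>x / 0 = 0\<close>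
  the formal transition density vanishes.\<close>

theorem trace_class_DA: "trace_class (posterior h a X y) (DA_operator h a X y)"
proof (cases "0 < G one_vec \<and> G one_vec < \<infinity>")
  case True
  then show ?thesis by (intro trace_class_nondegenerate) auto
next
  case False
  have "G_real z = 0" if z: "z \<in> posZ" for z
  proof (cases "G one_vec = 0")
    case True
    then have "G z = 0" using G_zero_iff by blast
    then show ?thesis by (simp add: G_real_def)
  next
    case nz: False
    with False have "\<not> G one_vec < \<infinity>" by (simp add: zero_less_iff_neq_zero)
    then have "\<not> G z < \<infinity>" using G_finite_iff[OF z one_posZ] by blast
    then have "G z = top" using top.not_eq_extremum[of "G z"] by simp
    then show ?thesis by (simp add: G_real_def)
  qed
  then show ?thesis by (simp only: DA_operator_degenerate trace_class_zero)
qed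

end

theorem corollary1:
  fixes h :: "real \<Rightarrow> real" and a :: real
    and X :: "real^'p^'n" and y :: "real^'d^'n"
  assumes h: "mixing_density h"
    and S1: "rank (concat_cols X y) = CARD('p) + CARD('d)"
    and S2: "real CARD('n) > real CARD('p) + 2 * real CARD('d) - 2 * a"
    and S3: "set_integrable lborel {0<..} (\<lambda>u. u powr (real CARD('d) / 2) * h u)"
    and S4: "set_integrable lborel {0<..}
      (\<lambda>u. u powr (- (real CARD('n) - real CARD('p) + 2 * a - 2 * real CARD('d) - 1) / 2) * h u)"
    and mono: "\<exists>\<rho> \<tau> \<eta>. \<rho> > 0 \<and> \<eta> > 0 \<and> mono_on {0<..<\<eta>} (\<lambda>u. h u / g_fun \<rho> \<tau> u)"
  shows "trace_class (posterior h a X y) (DA_operator h a X y)"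
proof -
  obtain \<rho> \<tau> \<eta> where "\<rho> > 0" "\<eta> > 0" "mono_on {0<..<\<eta>} (\<lambda>u. h u / g_fun \<rho> \<tau> u)"
    using mono by blast
  then interpret da_chain X y h \<rho> \<tau> \<eta> a
    using h S1 S3 by unfold_locales auto
  show ?thesis by (rule trace_class_DA)
qed

end
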